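(* Let $N \geq 2$ and set $d\nu:=e^{-|x|^{2}}|x|^{2}\,dx$. For every $v \in C_{0}^{\infty}(\mathbb{R}^{N})$, real- or complex-valued, $$\begin{aligned}\int_{\mathbb{R}^{N}} |\nabla v|^{2}\,d\nu &\geq D_{1}\inf_{c}\int_{\mathbb{R}^{N}} |v-c|^{2}\,d\nu+(D_{2}-D_{1})\inf_{c,\mathbf{a}}\int_{\mathbb{R}^{N}}\left|v-c-|x|^{\frac{D_{1}}{2}-1}\mathbf{a}\cdot x\right|^{2} d\nu\\ &\quad+(4-D_{2})\inf_{c,\mathbf{a},\mathbf{b}}\int_{\mathbb{R}^{N}}\left|v-c-|x|^{\frac{D_{1}}{2}-1}\mathbf{a}\cdot x-|x|^{\frac{D_{2}}{2}}\mathbf{b}\cdot\mathbf{\Phi}_{2}\right|^{2} d\nu\\ &\quad+(D_{3}-4)\inf_{c,d,\mathbf{a},\mathbf{b}}\int_{\mathbb{R}^{N}}\left|v-c-d|x|^{2}-|x|^{\frac{D_{1}}{2}-1}\mathbf{a}\cdot x-|x|^{\frac{D_{2}}{2}}\mathbf{b}\cdot\mathbf{\Phi}_{2}\right|^{2} d\nu,\end{aligned}$$ where the infima are taken over $c,d \in \mathbb{R}$ (resp. $\mathbb{C}$), $\mathbf{a} \in \mathbb{R}^{N}$ (resp. $\mathbb{C}^{N}$), and $\mathbf{b} \in \mathbb{R}^{N_{2}}$ (resp. $\mathbb{C}^{N_{2}}$) when $v$ is real-valued (resp. complex-valued).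
   Context: $D_k:=\sqrt{N^2+4k(N+k-2)}-N$, so $D_1=\sqrt{N^2+4N-4}-N$, $D_2=\sqrt{N^2+8N}-N$, $D_3=\sqrt{N^2+12N+12}-N$. $\mathbf{\Phi}_2=(\phi_{2,1},\dots,\phi_{2,N_2})$, where $\{\phi_{2,i}\}_{i=1}^{N_2}$ is an $L^2(\mathbb{S}^{N-1})$-orthonormal basis of real-valued spherical harmonics of degree $2$; in the integrals $\mathbf{\Phi}_2$ is evaluated at $x/|x|$. Dot products are bilinear. *)

theory Defs
  imports "HOL-Analysis.Analysis"
begin

definition partial :: "'n \<Rightarrow> (real ^ 'n::finite \<Rightarrow> 'a::real_normed_vector) \<Rightarrow> real ^ 'n \<Rightarrow> 'a" where
  "partial i f x = vector_derivative (\<lambda>t. f (x + t *\<^sub>R axis i 1)) (at 0)"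

primrec iterated_partial ::
  "'n list \<Rightarrow> (real ^ 'n::finite \<Rightarrow> 'a::real_normed_vector) \<Rightarrow> real ^ 'n \<Rightarrow> 'a" where
  "iterated_partial [] f = f"
| "iterated_partial (i # is) f = partial i (iterated_partial is f)"

(* C^infinity: the iterated partial derivatives of every order exist and are (totally)
   differentiable, hence continuous. *)
definition smooth :: "(real ^ 'n::finite \<Rightarrow> 'a::real_normed_vector) \<Rightarrow> bool" where
  "smooth f \<longleftrightarrow> (\<forall>is x. iterated_partial is f differentiable (at x))"

definition test_function :: "(real ^ 'n::finite \<Rightarrow> 'a::real_normed_vector) \<Rightarrow> bool" where
  "test_function f \<longleftrightarrow> smooth f \<and> compact (closure {x. f x \<noteq> 0})"

(* The norm on 'a ^ 'n is Euclidean, so norm (grad f x) ^ 2 is the sum of the squared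
   moduli of the partial derivatives, also for complex-valued f. *)
definition grad :: "(real ^ 'n::finite \<Rightarrow> 'a::real_normed_vector) \<Rightarrow> real ^ 'n \<Rightarrow> 'a ^ 'n" where
  "grad f x = (\<chi> i. partial i f x)"

definition laplacian :: "(real ^ 'n::finite \<Rightarrow> real) \<Rightarrow> real ^ 'n \<Rightarrow> real" where
  "laplacian f x = (\<Sum>i\<in>UNIV. partial i (partial i f) x)"

(* Bilinear (no conjugation); the left factor is real or complex. *)
definition bdot :: "'a::real_normed_field ^ 'm::finite \<Rightarrow> real ^ 'm \<Rightarrow> 'a" where
  "bdot a y = (\<Sum>i\<in>UNIV. a $ i * of_real (y $ i))"

(* Surface measure on the unit sphere by polar coordinates: the measure of A is N times the
   volume of the cone {r y | 0 < r < 1, y \<in> A}. *)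
definition sphere_measure :: "(real ^ 'n::finite) measure" where
  "sphere_measure =
     scale_measure (of_nat CARD('n))
       (distr (restrict_space lborel (ball 0 1 - {0})) (restrict_space borel (sphere 0 1))
          (\<lambda>x. x /\<^sub>R norm x))"

(* Restrictions to the unit sphere of homogeneous harmonic polynomials of degree k;
   the values of Y off the sphere are irrelevant. *)
definition spherical_harmonic :: "nat \<Rightarrow> (real ^ 'n::finite \<Rightarrow> real) \<Rightarrow> bool" where
  "spherical_harmonic k Y \<longleftrightarrow>
     (\<exists>p. real_polynomial_function p \<and> (\<forall>t x. p (t *\<^sub>R x) = t ^ k * p x) \<and>
          (\<forall>x. laplacian p x = 0) \<and> (\<forall>x\<in>sphere 0 1. Y x = p x))"

(* The components of \<Phi> are the basis; CARD('m) is the dimension of the space of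
   spherical harmonics of degree k. *)
definition orthonormal_harmonic_basis ::
  "nat \<Rightarrow> (real ^ 'n::finite \<Rightarrow> real ^ 'm::finite) \<Rightarrow> bool" where
  "orthonormal_harmonic_basis k \<Phi> \<longleftrightarrow>
     (\<forall>i. spherical_harmonic k (\<lambda>x. \<Phi> x $ i)) \<and>
     (\<forall>i j. (LINT x|sphere_measure. \<Phi> x $ i * \<Phi> x $ j) = (if i = j then 1 else 0)) \<and>
     (\<forall>Y. spherical_harmonic k Y \<longrightarrow> (\<exists>b. \<forall>x\<in>sphere 0 1. Y x = (\<Sum>i\<in>UNIV. b i * \<Phi> x $ i)))"

definition nu :: "(real ^ 'n::finite) measure" where
  "nu = density lborel (\<lambda>x. ennreal (exp (- (norm x)\<^sup>2) * (norm x)\<^sup>2))"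

definition Dk :: "nat \<Rightarrow> real \<Rightarrow> real" where
  "Dk k N = sqrt (N\<^sup>2 + 4 * real k * (N + real k - 2)) - N"

end

(* The operator L = Laplacian + (2/|x|^2 - 2) x . grad is symmetric with respect to nu, and if h is a
   harmonic homogeneous polynomial of degree k, then |x|^(Dk/2 - k) h times a Laguerre polynomial of
   degree m in |x|^2 is an eigenfunction of -L with eigenvalue Dk + 4 m. Hence the spectrum starts with
   0 < D1 < D2 < 4 < D3 and the functions subtracted in the four infima span the eigenspaces below D3.
   These eigenfunctions are total in L^2(nu): a test function is uniformly close to p(x) g(|x|^2) with
   p a polynomial and g a cutoff, p is a sum of terms |x|^(2j) h, and on each term the radial factor is
   approximated by polynomials in exp(-|x|^2/4), hence by polynomials in |x|^2. Bessel's inequality for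
   the gradients and Pythagoras for the functions then give the inequality up to an arbitrarily small
   error. Of the properties of Phi only the spanning property is used, so no integration on the sphere
   is needed. *)

theory Submission
  imports Defs
begin

section \<open>Integration against the Gaussian weight\<close>

text \<open>The exponents come from one computation: on |x|^(s-k) h with h harmonic of degree k the
  operator yields -2s times the function plus \<open>s (s + N) - k (k + N - 2)\<close> times
  |x|^(s-k-2) h, and D_k/2 is the nonnegative root of that second coefficient. The obstacle is the
  origin. Since D_k/2 < k for k >= 1, eigenfunctions need not be differentiable there, and the
  operator itself has a singular coefficient. Derivatives are therefore taken off the origin only,
  and the factor |x|^2 of the measure is distributed over the integrands, so that a derivative
  always appears in a product such as |x| F, which stays bounded near 0. The coefficients D1, D2 -
  D1, 4 - D2, D3 - 4 are the gaps of the spectrum: by telescoping, a component with eigenvalue D1,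
  D2 or 4 is counted with its own eigenvalue and every component from D3 on is counted with D3. An
  eigenspace enters through a single function, the sum of its contributions, which is never
  normalized and may be zero. The complex inequality is the sum of the real ones for the real and
  imaginary parts.\<close>

lemma nn_integral_exp_minus_abs_finite:
  fixes c :: real
  assumes "c > 0"
  shows "(\<integral>\<^sup>+x. ennreal (exp (- c * \<bar>x\<bar>)) \<partial>lborel) < \<infinity>"
proof -
  define I where "I = (\<integral>\<^sup>+x. ennreal (exp (- c * x)) * indicator {0..} x \<partial>lborel)"
  have "I = ennreal (0 - (- 1 / c * exp (- c * 0)))"
    unfolding I_def
  proof (rule nn_integral_FTC_atLeast)
    show "((\<lambda>x. - 1 / c * exp (- c * x)) \<longlongrightarrow> 0) at_top"
    proof (rule tendsto_mult_right_zero)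
      show "((\<lambda>x. exp (- c * x)) \<longlongrightarrow> 0) at_top"
        using assms
        by (intro filterlim_compose[OF exp_at_bot] filterlim_tendsto_neg_mult_at_bot[OF tendsto_const])
           (auto simp: filterlim_ident)
    qed
    show "((\<lambda>x. - 1 / c * exp (- c * x)) has_real_derivative exp (- c * x)) (at x)" for x
      using assms by (auto intro!: derivative_eq_intros)
  qed auto
  then have fin: "I < \<infinity>" by simp
  have refl: "(\<integral>\<^sup>+x. ennreal (exp (c * x)) * indicator {..0} x \<partial>lborel) = I"
    unfolding I_def
    by (subst nn_integral_real_affine[where c="-1" and t=0])
       (auto intro!: nn_integral_cong simp: indicator_def)
  have "(\<integral>\<^sup>+x. ennreal (exp (- c * \<bar>x\<bar>)) \<partial>lborel) \<le>
     (\<integral>\<^sup>+x. ennreal (exp (- c * x)) * indicator {0..} x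
        + ennreal (exp (c * x)) * indicator {..0} x \<partial>lborel)"
    by (intro nn_integral_mono) (auto simp: indicator_def)
  also have "\<dots> = I + I"
    using refl by (subst nn_integral_add) (auto simp: I_def)
  also have "\<dots> < \<infinity>" using fin by simp
  finally show ?thesis .
qed

text \<open>The norm is at least the average of the absolute coordinates. With \<open>c\<close> the
  reciprocal of the dimension the radial exponential is thus dominated by a product of one-variable
  exponentials, to which Tonelli applies.\<close>

lemma integrable_exp_minus_norm: "integrable lborel (\<lambda>x::real^'n::finite. exp (- norm x))"
proof -
  define c :: real where "c = 1 / real CARD('n)"
  have c: "c > 0" by (simp add: c_def)
  have le: "exp (- norm x) \<le> (\<Prod>b\<in>Basis. exp (- c * \<bar>x \<bullet> b\<bar>))" for x :: "real^'n"
  proof -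
    have "(\<Sum>b\<in>(Basis :: (real^'n) set). c * \<bar>x \<bullet> b\<bar>) \<le> (\<Sum>b\<in>(Basis :: (real^'n) set). c * norm x)"
      using c by (intro sum_mono mult_left_mono Basis_le_norm) auto
    also have "\<dots> = norm x" by (simp add: c_def)
    finally have "- norm x \<le> (\<Sum>b\<in>Basis. - c * \<bar>x \<bullet> b\<bar>)"
      by (simp add: sum_negf)
    then show ?thesis by (simp add: exp_sum[symmetric])
  qed
  have "(\<integral>\<^sup>+x. ennreal (norm (exp (- norm (x::real^'n)))) \<partial>lborel)
     \<le> (\<integral>\<^sup>+x. ennreal (\<Prod>b\<in>(Basis :: (real^'n) set). exp (- c * \<bar>x \<bullet> b\<bar>)) \<partial>lborel)"
    using le by (intro nn_integral_mono ennreal_leI) simp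
  also have "\<dots> = (\<integral>\<^sup>+x. (\<Prod>b\<in>(Basis :: (real^'n) set). ennreal (exp (- c * \<bar>x \<bullet> b\<bar>))) \<partial>lborel)"
    by (simp add: prod_ennreal)
  also have "\<dots> = (\<Prod>b\<in>(Basis :: (real^'n) set). (\<integral>\<^sup>+x. ennreal (exp (- c * \<bar>x\<bar>)) \<partial>lborel))"
    by (rule nn_integral_lborel_prod[where f = "\<lambda>_ t. ennreal (exp (- c * \<bar>t\<bar>))"]) auto
  also have "\<dots> < \<infinity>"
    using nn_integral_exp_minus_abs_finite[OF c] by (simp add: power_less_top_ennreal)
  finally show ?thesis
    by (intro integrableI_bounded) auto
qed

text \<open>A class closed under sums and products that every Gaussian makes integrable. Applied to
  \<open>norm x * F x\<close> it allows \<open>F\<close> a singularity of order 1/|x| at the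
  origin.\<close>

definition exp_bounded :: "(real^'n::finite \<Rightarrow> real) \<Rightarrow> bool" where
  "exp_bounded f \<longleftrightarrow> f \<in> borel_measurable borel \<and> (\<exists>C. \<forall>x. \<bar>f x\<bar> \<le> C * exp (C * norm x))"

lemma exp_boundedI:
  assumes "f \<in> borel_measurable borel" "\<And>x. \<bar>f x\<bar> \<le> C * exp (a * norm x)"
  shows "exp_bounded f"
proof -
  have C: "C \<ge> 0" using assms(2)[of 0] by simp
  have "\<bar>f x\<bar> \<le> (C + \<bar>a\<bar>) * exp ((C + \<bar>a\<bar>) * norm x)" for x
    by (rule order_trans[OF assms(2)], rule mult_mono) (use C in \<open>auto intro!: mult_right_mono\<close>)
  then show ?thesis using assms(1) unfolding exp_bounded_def by blast
qed

lemma exp_boundedE: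
  assumes "exp_bounded f"
  obtains C where "C \<ge> 0" "\<And>x. \<bar>f x\<bar> \<le> C * exp (C * norm x)"
proof -
  obtain C where C: "\<forall>x. \<bar>f x\<bar> \<le> C * exp (C * norm x)" using assms unfolding exp_bounded_def by blast
  have "C \<ge> 0" using C[rule_format, of 0] by simp
  then show ?thesis using C that by blast
qed

lemma exp_bounded_measurable [measurable_dest]: "exp_bounded f \<Longrightarrow> f \<in> borel_measurable borel"
  by (simp add: exp_bounded_def)

lemma exp_bounded_mono:
  assumes "exp_bounded g" "f \<in> borel_measurable borel" "\<And>x. \<bar>f x\<bar> \<le> \<bar>g x\<bar>"
  shows "exp_bounded f"
  using assms by (elim exp_boundedE) (meson exp_boundedI order_trans)

lemma exp_bounded_const [simp, intro]: "exp_bounded (\<lambda>x. c)"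
  by (rule exp_boundedI[where C = "\<bar>c\<bar>" and a = 0]) auto

lemma exp_bounded_norm [simp, intro]: "exp_bounded (\<lambda>x. norm x)"
proof (rule exp_boundedI[where C = 1 and a = 1])
  show "\<bar>norm x\<bar> \<le> 1 * exp (1 * norm x)" for x :: "real^'n"
    using exp_ge_add_one_self[of "norm x"] by (simp del: exp_ge_add_one_self)
qed auto

lemma exp_bounded_add [intro]:
  assumes "exp_bounded f" "exp_bounded g" shows "exp_bounded (\<lambda>x. f x + g x)"
proof -
  obtain C D where C: "C \<ge> 0" "\<And>x. \<bar>f x\<bar> \<le> C * exp (C * norm x)"
    and D: "D \<ge> 0" "\<And>x. \<bar>g x\<bar> \<le> D * exp (D * norm x)"
    using assms by (metis exp_boundedE)
  have "\<bar>f x + g x\<bar> \<le> (C + D) * exp ((C + D) * norm x)" for x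
  proof -
    have "\<bar>f x + g x\<bar> \<le> C * exp (C * norm x) + D * exp (D * norm x)"
      using C(2)[of x] D(2)[of x] by linarith
    also have "\<dots> \<le> C * exp ((C + D) * norm x) + D * exp ((C + D) * norm x)"
      using C(1) D(1) by (intro add_mono mult_left_mono) (auto intro!: mult_right_mono)
    finally show ?thesis by (simp add: algebra_simps)
  qed
  then show ?thesis using assms by (intro exp_boundedI) auto
qed

lemma exp_bounded_mult [intro]:
  assumes "exp_bounded f" "exp_bounded g" shows "exp_bounded (\<lambda>x. f x * g x)"
proof -
  obtain C D where C: "C \<ge> 0" "\<And>x. \<bar>f x\<bar> \<le> C * exp (C * norm x)"
    and D: "D \<ge> 0" "\<And>x. \<bar>g x\<bar> \<le> D * exp (D * norm x)"
    using assms by (metis exp_boundedE)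
  have "\<bar>f x * g x\<bar> \<le> (C * D) * exp ((C + D) * norm x)" for x
  proof -
    have "\<bar>f x * g x\<bar> \<le> (C * exp (C * norm x)) * (D * exp (D * norm x))"
      unfolding abs_mult using C D by (intro mult_mono) auto
    then show ?thesis by (simp add: algebra_simps exp_add)
  qed
  then show ?thesis using assms by (intro exp_boundedI) auto
qed

lemma exp_bounded_minus [intro]: "exp_bounded f \<Longrightarrow> exp_bounded (\<lambda>x. - f x)"
  using exp_bounded_mult[OF exp_bounded_const[of "-1"]] by simp

lemma exp_bounded_diff [intro]: "exp_bounded f \<Longrightarrow> exp_bounded g \<Longrightarrow> exp_bounded (\<lambda>x. f x - g x)"
  using exp_bounded_add[OF _ exp_bounded_minus] by simp

lemma exp_bounded_power [intro]: "exp_bounded f \<Longrightarrow> exp_bounded (\<lambda>x. f x ^ n)"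
  by (induction n) auto

lemma exp_bounded_sum [intro]: "(\<And>i. i \<in> I \<Longrightarrow> exp_bounded (f i)) \<Longrightarrow> exp_bounded (\<lambda>x. \<Sum>i\<in>I. f i x)"
  by (induction I rule: infinite_finite_induct) auto

text \<open>Complete the square for the linear coefficient \<open>a + 1\<close> instead of
  \<open>a\<close>; the surplus is the integrable factor \<open>exp (- r)\<close>.\<close>

lemma quadratic_exponent_bound:
  fixes a e r :: real
  assumes "e > 0"
  shows "exp (a * r - e * r\<^sup>2) \<le> exp ((a + 1)\<^sup>2 / (4 * e)) * exp (- r)"
proof -
  have "0 \<le> (2 * e * r - (a + 1))\<^sup>2 / (4 * e)" using assms by simp
  also have "\<dots> = e * r\<^sup>2 - (a + 1) * r + (a + 1)\<^sup>2 / (4 * e)"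
    using assms by (simp add: field_simps power2_eq_square)
  finally have "a * r - e * r\<^sup>2 \<le> (a + 1)\<^sup>2 / (4 * e) + - r" by (simp add: algebra_simps)
  then show ?thesis by (metis exp_add exp_le_cancel_iff)
qed

lemma exp_bounded_gauss_le:
  assumes "exp_bounded f" "e > 0"
  obtains C where "\<And>x. \<bar>exp (- e * (norm x)\<^sup>2) * f x\<bar> \<le> C * exp (- norm x)"
proof -
  obtain C where C: "C \<ge> 0" "\<And>x. \<bar>f x\<bar> \<le> C * exp (C * norm x)"
    using assms by (metis exp_boundedE)
  have "\<bar>exp (- e * (norm x)\<^sup>2) * f x\<bar> \<le> (C * exp ((C + 1)\<^sup>2 / (4 * e))) * exp (- norm x)" for x
  proof -
    have "\<bar>exp (- e * (norm x)\<^sup>2) * f x\<bar> \<le> exp (- e * (norm x)\<^sup>2) * (C * exp (C * norm x))"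
      using C by (simp add: abs_mult)
    also have "\<dots> = C * exp (C * norm x - e * (norm x)\<^sup>2)"
      by (simp add: exp_diff exp_minus field_simps)
    also have "\<dots> \<le> C * (exp ((C + 1)\<^sup>2 / (4 * e)) * exp (- norm x))"
      using C(1) assms(2) by (intro mult_left_mono quadratic_exponent_bound)
    finally show ?thesis by simp
  qed
  then show ?thesis using that by blast
qed

lemma integrable_gauss:
  assumes "exp_bounded f" "e > 0"
  shows "integrable lborel (\<lambda>x. exp (- e * (norm x)\<^sup>2) * f x)"
proof -
  obtain C where C: "\<And>x. \<bar>exp (- e * (norm x)\<^sup>2) * f x\<bar> \<le> C * exp (- norm x)"
    using assms by (metis exp_bounded_gauss_le)
  have [measurable]: "f \<in> borel_measurable borel" using assms by auto
  show ?thesis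
  proof (rule Bochner_Integration.integrable_bound)
    show "integrable lborel (\<lambda>x::real^'n. C * exp (- norm x))"
      by (intro integrable_mult_right integrable_exp_minus_norm)
    have "norm (exp (- e * (norm x)\<^sup>2) * f x) \<le> norm (C * exp (- norm x))" for x
      using C[of x] unfolding real_norm_def by linarith
    then show "AE x in lborel. norm (exp (- e * (norm x)\<^sup>2) * f x) \<le> norm (C * exp (- norm x))"
      by simp
  qed auto
qed

text \<open>Only the Gaussian part of the weight. The factor |x|^2 is carried by the integrands,
  usually as one \<open>norm x\<close> on each of two factors, because the factors may be bounded
  near the origin only after this multiplication.\<close>

definition gint :: "(real^'n::finite \<Rightarrow> real) \<Rightarrow> real" where
  "gint f = (LINT x|lborel. exp (- (norm x)\<^sup>2) * f x)"

lemma integrable_gint: "exp_bounded f \<Longrightarrow> integrable lborel (\<lambda>x. exp (- (norm x)\<^sup>2) * f x)"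
  using integrable_gauss[of f 1] by simp

lemma gint_add: "exp_bounded f \<Longrightarrow> exp_bounded g \<Longrightarrow> gint (\<lambda>x. f x + g x) = gint f + gint g"
  unfolding gint_def by (simp add: distrib_left integrable_gint)

lemma gint_diff: "exp_bounded f \<Longrightarrow> exp_bounded g \<Longrightarrow> gint (\<lambda>x. f x - g x) = gint f - gint g"
  unfolding gint_def by (simp add: right_diff_distrib integrable_gint)

lemma gint_cmult: "gint (\<lambda>x. c * f x) = c * gint f"
proof -
  have "(\<lambda>x. exp (- (norm x)\<^sup>2) * (c * f x)) = (\<lambda>x. c * (exp (- (norm x)\<^sup>2) * f x))" by auto
  then show ?thesis by (simp only: gint_def integral_mult_right_zero)
qed

lemma gint_sum: "(\<And>i. i \<in> I \<Longrightarrow> exp_bounded (f i)) \<Longrightarrow> gint (\<lambda>x. \<Sum>i\<in>I. f i x) = (\<Sum>i\<in>I. gint (f i))"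
  unfolding gint_def by (simp add: sum_distrib_left integrable_gint Bochner_Integration.integral_sum)

lemma AE_lborel_neq: "AE x in lborel. x \<noteq> (c :: 'a::euclidean_space)"
  by (rule AE_I[where N = "{c}"]) auto

lemma gint_cong:
  assumes "\<And>x. x \<noteq> 0 \<Longrightarrow> f x = g x" "f \<in> borel_measurable borel" "g \<in> borel_measurable borel"
  shows "gint f = gint g"
  unfolding gint_def
  by (rule integral_cong_AE) (use assms AE_lborel_neq[of 0] in \<open>auto elim: eventually_mono\<close>)

lemma gint_nonneg: "(\<And>x. f x \<ge> 0) \<Longrightarrow> gint f \<ge> 0"
  unfolding gint_def by (rule Bochner_Integration.integral_nonneg) auto

lemma gint_mono:
  assumes "exp_bounded f" "exp_bounded g" "\<And>x. f x \<le> g x"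
  shows "gint f \<le> gint g"
  unfolding gint_def using assms by (intro integral_mono integrable_gint) auto

text \<open>The origin is excluded because functions such as |x|^(s-1) \<open>x $ i\<close> with 0 <
  s < 1 are not differentiable there.\<close>

definition has_partial :: "'n \<Rightarrow> (real^'n::finite \<Rightarrow> real) \<Rightarrow> (real^'n \<Rightarrow> real) \<Rightarrow> bool" where
  "has_partial i f f' \<longleftrightarrow>
     (\<forall>x. x \<noteq> 0 \<longrightarrow> ((\<lambda>t. f (x + t *\<^sub>R axis i 1)) has_real_derivative f' x) (at 0))"

lemma has_partial_along:
  assumes "has_partial i f f'" "x + t *\<^sub>R axis i 1 \<noteq> 0"
  shows "((\<lambda>t. f (x + t *\<^sub>R axis i 1)) has_real_derivative f' (x + t *\<^sub>R axis i 1)) (at t)"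
proof -
  have "((\<lambda>s. f (x + t *\<^sub>R axis i 1 + s *\<^sub>R axis i 1)) has_real_derivative f' (x + t *\<^sub>R axis i 1)) (at 0)"
    using assms unfolding has_partial_def by blast
  moreover have "(\<lambda>s. f (x + t *\<^sub>R axis i 1 + s *\<^sub>R axis i 1)) = (\<lambda>s. f (x + (s + t) *\<^sub>R axis i 1))"
    by (simp add: scaleR_left_distrib add_ac)
  ultimately show ?thesis
    using DERIV_at_within_shift[of "\<lambda>t. f (x + t *\<^sub>R axis i 1)" "f' (x + t *\<^sub>R axis i 1)" t 0 UNIV]
    by (simp add: add.commute)
qed

lemma lborel_integral_translate:
  fixes f :: "real^'n::finite \<Rightarrow> real"
  assumes [measurable]: "f \<in> borel_measurable borel"
  shows "(LINT x|lborel. f (x + c)) = (LINT x|lborel. f x)"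
    and "integrable lborel (\<lambda>x. f (x + c)) \<longleftrightarrow> integrable lborel f"
proof -
  have d: "distr lborel borel (\<lambda>x. x + c) = lborel"
    using lborel_affine[of 1 c] by (simp add: density_1 add.commute)
  show "(LINT x|lborel. f (x + c)) = (LINT x|lborel. f x)"
    using integral_distr[of "\<lambda>x. x + c" lborel borel f] d by simp
  show "integrable lborel (\<lambda>x. f (x + c)) \<longleftrightarrow> integrable lborel f"
    using integrable_distr_eq[of "\<lambda>x. x + c" lborel borel f] d by simp
qed

text \<open>The integral of \<open>F\<close> does not change under translation, so the difference quotients in direction
  \<open>i\<close> integrate to 0. In dimension at least 2 almost every line in that direction avoids the origin.\<close>

lemma integral_partial_eq_0:
  fixes F :: "real^'n::finite \<Rightarrow> real"
  assumes dim: "CARD('n) \<ge> 2"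
    and F: "integrable lborel F" and F': "has_partial i F F'" "F' \<in> borel_measurable borel"
    and bd: "\<And>x. x \<noteq> 0 \<Longrightarrow> \<bar>F' x\<bar> \<le> C * exp (- norm x)"
  shows "(LINT x|lborel. F' x) = 0"
proof -
  define h :: "nat \<Rightarrow> real" where "h n = inverse (real (Suc n))" for n
  have h: "h n > 0" "h n \<le> 1" for n by (auto simp: h_def field_simps)
  have h0: "h \<longlonglongrightarrow> 0" unfolding h_def by (rule LIMSEQ_inverse_real_of_nat)
  have [measurable]: "F \<in> borel_measurable borel" using F by auto
  have [measurable]: "F' \<in> borel_measurable borel" by fact
  define q where "q n x = (F (x + h n *\<^sub>R axis i 1) - F x) / h n" for n x
  have q0: "(LINT x|lborel. q n x) = 0" for n
    unfolding q_def using F lborel_integral_translate[of F "h n *\<^sub>R axis i 1"]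
    by simp
  obtain j where j: "j \<noteq> i"
  proof -
    have "\<not> (\<forall>j. j = i)"
    proof
      assume "\<forall>j. j = i"
      then have "UNIV = {i}" by auto
      then have "CARD('n) = card {i}" by simp
      then show False using dim by simp
    qed
    then show ?thesis using that by blast
  qed
  have AEj: "AE x in lborel. (x::real^'n) $ j \<noteq> 0"
  proof (rule AE_I')
    have "negligible {x::real^'n. x $ j = 0}" by (rule negligible_standard_hyperplane_cart)
    then show "{x::real^'n. x $ j = 0} \<in> null_sets lborel"
      by (simp add: negligible_iff_null_sets null_sets_completion_iff)
  qed auto
  have nz: "x + t *\<^sub>R axis i 1 \<noteq> 0" if "x $ j \<noteq> 0" for x :: "real^'n" and t
    using that j by (auto simp: vec_eq_iff axis_def intro!: exI[of _ j])
  have "(\<lambda>n. LINT x|lborel. q n x) \<longlonglongrightarrow> (LINT x|lborel. F' x)"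
  proof (rule integral_dominated_convergence[where w = "\<lambda>x. (C * exp 1) * exp (- norm x)"])
    show "integrable lborel (\<lambda>x::real^'n. (C * exp 1) * exp (- norm x))"
      by (intro integrable_mult_right integrable_exp_minus_norm)
    show "AE x in lborel. (\<lambda>n. q n x) \<longlonglongrightarrow> F' x"
    proof (rule eventually_mono[OF AEj])
      fix x :: "real^'n" assume x: "x $ j \<noteq> 0"
      have "((\<lambda>t. F (x + t *\<^sub>R axis i 1)) has_real_derivative F' x) (at 0)"
        using has_partial_along[OF F'(1) nz[OF x], of 0] by simp
      then have "((\<lambda>t. (F (x + t *\<^sub>R axis i 1) - F x) / t) \<longlongrightarrow> F' x) (at 0)"
        unfolding DERIV_def by simp
      moreover have "filterlim h (at 0) sequentially"
        using h(1) h0 by (auto simp: filterlim_at intro!: always_eventually less_imp_neq[symmetric])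
      ultimately show "(\<lambda>n. q n x) \<longlonglongrightarrow> F' x"
        unfolding q_def by (rule filterlim_compose)
    qed
    \<comment> \<open>By the mean value theorem the quotient is a value of \<open>F'\<close> at
      distance at most 1 from \<open>x\<close>, so the exponential bound deteriorates by a factor
      \<open>exp 1\<close> at most.\<close>
    show "AE x in lborel. norm (q n x) \<le> (C * exp 1) * exp (- norm x)" for n
    proof (rule eventually_mono[OF AEj])
      fix x :: "real^'n" assume x: "x $ j \<noteq> 0"
      have C: "C \<ge> 0"
        using bd[of x] x by (metis abs_ge_zero exp_gt_zero order_trans zero_index zero_le_mult_iff not_less)
      obtain z where z: "0 < z" "z < h n"
        "F (x + h n *\<^sub>R axis i 1) - F (x + 0 *\<^sub>R axis i 1) = (h n - 0) * F' (x + z *\<^sub>R axis i 1)"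
        using MVT2[OF h(1)[of n], of "\<lambda>t. F (x + t *\<^sub>R axis i 1)" "\<lambda>t. F' (x + t *\<^sub>R axis i 1)"]
          has_partial_along[OF F'(1) nz[OF x]] by blast
      have "norm (q n x) = \<bar>F' (x + z *\<^sub>R axis i 1)\<bar>"
        using z(3) h(1)[of n] by (simp add: q_def)
      also have "\<dots> \<le> C * exp (- norm (x + z *\<^sub>R axis i 1))"
        by (rule bd[OF nz[OF x]])
      also have "\<dots> \<le> C * exp (1 - norm x)"
      proof -
        have "norm x \<le> norm (x + z *\<^sub>R axis i 1) + norm (z *\<^sub>R axis i 1 :: real^'n)"
          using norm_triangle_ineq4[of "x + z *\<^sub>R axis i 1" "z *\<^sub>R axis i 1"] by simp
        also have "norm (z *\<^sub>R axis i 1 :: real^'n) \<le> 1"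
          using z h(2)[of n] by (simp add: norm_axis_1)
        finally show ?thesis using C by (intro mult_left_mono) auto
      qed
      also have "\<dots> = (C * exp 1) * exp (- norm x)" by (simp add: exp_diff exp_minus field_simps)
      finally show "norm (q n x) \<le> (C * exp 1) * exp (- norm x)" .
    qed
  qed (auto simp: q_def)
  then have "(\<lambda>n. 0) \<longlonglongrightarrow> (LINT x|lborel. F' x)" by (simp add: q0)
  then show ?thesis by (simp add: LIMSEQ_const_iff)
qed

section \<open>The weighted Dirichlet form and its operator\<close>

lemma has_partial_partial: "has_partial i f F \<Longrightarrow> x \<noteq> 0 \<Longrightarrow> partial i f x = F x"
  unfolding has_partial_def partial_def
  by (auto simp: has_real_derivative_iff_has_vector_derivative intro: vector_derivative_at)

lemma has_partial_cong:
  assumes "has_partial i f F" "\<And>x. x \<noteq> 0 \<Longrightarrow> F x = G x" shows "has_partial i f G"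
  using assms unfolding has_partial_def by simp

lemma has_partial_const: "has_partial i (\<lambda>x. c) (\<lambda>x. 0)"
  by (simp add: has_partial_def)

lemma has_partial_component: "has_partial i (\<lambda>x. x $ j) (\<lambda>x. if j = i then 1 else 0)"
  unfolding has_partial_def
proof (intro allI impI)
  fix x :: "real^'a"
  have "((\<lambda>t. x $ j + t * c) has_real_derivative c) (at 0)" for c
    by (auto intro!: derivative_eq_intros)
  then show "((\<lambda>t. (x + t *\<^sub>R axis i 1) $ j) has_real_derivative (if j = i then 1 else 0)) (at 0)"
    by (simp add: axis_def)
qed

lemma has_partial_add:
  "has_partial i f F \<Longrightarrow> has_partial i g G \<Longrightarrow> has_partial i (\<lambda>x. f x + g x) (\<lambda>x. F x + G x)"
  unfolding has_partial_def by (simp add: DERIV_add)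

lemma has_partial_cmult: "has_partial i f F \<Longrightarrow> has_partial i (\<lambda>x. c * f x) (\<lambda>x. c * F x)"
  unfolding has_partial_def by (simp add: DERIV_cmult)

lemma has_partial_mult:
  assumes "has_partial i f F" "has_partial i g G"
  shows "has_partial i (\<lambda>x. f x * g x) (\<lambda>x. F x * g x + f x * G x)"
  unfolding has_partial_def
proof (intro allI impI)
  fix x :: "real^'a" assume "x \<noteq> 0"
  then have "((\<lambda>t. f (x + t *\<^sub>R axis i 1)) has_real_derivative F x) (at 0)"
    "((\<lambda>t. g (x + t *\<^sub>R axis i 1)) has_real_derivative G x) (at 0)"
    using assms unfolding has_partial_def by auto
  from DERIV_mult[OF this]
  show "((\<lambda>t. f (x + t *\<^sub>R axis i 1) * g (x + t *\<^sub>R axis i 1)) has_real_derivative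
       F x * g x + f x * G x) (at 0)"
    by (simp add: algebra_simps)
qed

lemma has_partial_compose:
  assumes "has_partial i f F" "\<And>x. x \<noteq> 0 \<Longrightarrow> (g has_real_derivative g' x) (at (f x))"
  shows "has_partial i (\<lambda>x. g (f x)) (\<lambda>x. g' x * F x)"
  unfolding has_partial_def
proof (intro allI impI)
  fix x :: "real^'a" assume "x \<noteq> 0"
  then have "((\<lambda>t. f (x + t *\<^sub>R axis i 1)) has_real_derivative F x) (at 0)"
    "(g has_real_derivative g' x) (at (f (x + 0 *\<^sub>R axis i 1)))"
    using assms unfolding has_partial_def by auto
  from DERIV_chain2[OF this(2,1)]
  show "((\<lambda>t. g (f (x + t *\<^sub>R axis i 1))) has_real_derivative g' x * F x) (at 0)" .
qed

lemma has_partial_norm_sq: "has_partial i (\<lambda>x. (norm x)\<^sup>2) (\<lambda>x. 2 * x $ i)"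
  unfolding has_partial_def
proof (intro allI impI)
  fix x :: "real^'a"
  have "(norm (x + t *\<^sub>R axis i 1))\<^sup>2 = (norm x)\<^sup>2 + 2 * t * x $ i + t\<^sup>2" for t
    using dot_norm[of x "t *\<^sub>R axis i 1"] by (simp add: inner_axis norm_axis_1 power_mult_distrib)
  then have "(\<lambda>t. (norm (x + t *\<^sub>R axis i 1))\<^sup>2) = (\<lambda>t. (norm x)\<^sup>2 + 2 * t * x $ i + t\<^sup>2)" by blast
  moreover have "((\<lambda>t. (norm x)\<^sup>2 + 2 * t * x $ i + t\<^sup>2) has_real_derivative 2 * x $ i) (at 0)"
    by (auto intro!: derivative_eq_intros)
  ultimately show "((\<lambda>t. (norm (x + t *\<^sub>R axis i 1))\<^sup>2) has_real_derivative 2 * x $ i) (at 0)"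
    by simp
qed

text \<open>The gradient may blow up like 1/|x| at the origin: the factor |x|^2 of the measure keeps
  its square integrable.\<close>

definition tame :: "(real^'n::finite \<Rightarrow> real) \<Rightarrow> bool" where
  "tame f \<longleftrightarrow> exp_bounded f \<and> (\<forall>i. \<exists>F. has_partial i f F \<and> exp_bounded (\<lambda>x. norm x * F x))"

text \<open>Each derivative is granted one power of |x|. This is the behaviour at the origin of a
  function that is homogeneous of nonnegative degree.\<close>

definition Lop_witness ::
  "(real^'n::finite \<Rightarrow> real) \<Rightarrow> (real^'n \<Rightarrow> real) \<Rightarrow> ('n \<Rightarrow> real^'n \<Rightarrow> real) \<Rightarrow> ('n \<Rightarrow> real^'n \<Rightarrow> real) \<Rightarrow> bool" where
  "Lop_witness f g F1 F2 \<longleftrightarrow> exp_bounded f \<and>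
     (\<forall>i. has_partial i f (F1 i)) \<and> (\<forall>i. has_partial i (F1 i) (F2 i)) \<and>
     (\<forall>i. exp_bounded (\<lambda>x. norm x * F1 i x)) \<and> (\<forall>i. exp_bounded (\<lambda>x. (norm x)\<^sup>2 * F2 i x)) \<and>
     (\<forall>x. x \<noteq> 0 \<longrightarrow> (\<Sum>i\<in>UNIV. F2 i x) + (2 / (norm x)\<^sup>2 - 2) * (\<Sum>i\<in>UNIV. x $ i * F1 i x) = g x)"

text \<open>\<open>Lop f g\<close>: off the origin \<open>g\<close> is the image of \<open>f\<close> under the operator
  \<open>\<Delta> + (2/|x|^2 - 2) x \<bullet> \<nabla>\<close> that is symmetric with respect to \<open>\<nu>\<close>.\<close>

definition Lop :: "(real^'n::finite \<Rightarrow> real) \<Rightarrow> (real^'n \<Rightarrow> real) \<Rightarrow> bool" where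
  "Lop f g \<longleftrightarrow> (\<exists>F1 F2. Lop_witness f g F1 F2)"

lemma Lop_witnessD:
  assumes "Lop_witness f g F1 F2"
  shows "exp_bounded f"
    "\<And>i. has_partial i f (F1 i)" "\<And>i. has_partial i (F1 i) (F2 i)"
    "\<And>i. exp_bounded (\<lambda>x. norm x * F1 i x)" "\<And>i. exp_bounded (\<lambda>x. (norm x)\<^sup>2 * F2 i x)"
    "\<And>x. x \<noteq> 0 \<Longrightarrow> (\<Sum>i\<in>UNIV. F2 i x) + (2 / (norm x)\<^sup>2 - 2) * (\<Sum>i\<in>UNIV. x $ i * F1 i x) = g x"
  using assms unfolding Lop_witness_def by simp_all

lemma LopI:
  assumes "exp_bounded f"
    "\<And>i. has_partial i f (F1 i)" "\<And>i. has_partial i (F1 i) (F2 i)"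
    "\<And>i. exp_bounded (\<lambda>x. norm x * F1 i x)" "\<And>i. exp_bounded (\<lambda>x. (norm x)\<^sup>2 * F2 i x)"
    "\<And>x. x \<noteq> 0 \<Longrightarrow> (\<Sum>i\<in>UNIV. F2 i x) + (2 / (norm x)\<^sup>2 - 2) * (\<Sum>i\<in>UNIV. x $ i * F1 i x) = g x"
  shows "Lop f g"
  unfolding Lop_def Lop_witness_def
  by (intro exI[of _ F1] exI[of _ F2] conjI allI impI assms)

text \<open>The inner product of L^2(nu).\<close>

definition bform :: "(real^'n::finite \<Rightarrow> real) \<Rightarrow> (real^'n \<Rightarrow> real) \<Rightarrow> real" where
  "bform f g = gint (\<lambda>x. (norm x * f x) * (norm x * g x))"

abbreviation bsq :: "(real^'n::finite \<Rightarrow> real) \<Rightarrow> real" where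
  "bsq f \<equiv> bform f f"

text \<open>The Dirichlet form of nu. At the origin \<open>partial\<close> may be an arbitrary
  value, which the factor \<open>norm x\<close> cancels.\<close>

definition eform :: "(real^'n::finite \<Rightarrow> real) \<Rightarrow> (real^'n \<Rightarrow> real) \<Rightarrow> real" where
  "eform f g = gint (\<lambda>x. \<Sum>i\<in>UNIV. (norm x * partial i f x) * (norm x * partial i g x))"

lemma bform_commute: "bform f g = bform g f"
  by (simp add: bform_def mult.commute)

lemma eform_commute: "eform f g = eform g f"
  by (simp add: eform_def mult.commute)

lemma tame_exp_bounded: "tame f \<Longrightarrow> exp_bounded f"
  by (simp add: tame_def)

lemma tame_norm_partial:
  assumes "tame f" shows "exp_bounded (\<lambda>x. norm x * partial i f x)"
proof -
  obtain F where F: "has_partial i f F" "exp_bounded (\<lambda>x. norm x * F x)"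
    using assms unfolding tame_def by blast
  have "(\<lambda>x. norm x * partial i f x) = (\<lambda>x. norm x * F x)"
  proof
    show "norm x * partial i f x = norm x * F x" for x
      using has_partial_partial[OF F(1), of x] by (cases "x = 0") auto
  qed
  then show ?thesis using F(2) by simp
qed

lemma Lop_tame:
  assumes "Lop f g" shows "tame f"
proof -
  obtain F1 F2 where "Lop_witness f g F1 F2" using assms unfolding Lop_def by blast
  note F = Lop_witnessD[OF this]
  have "\<exists>F. has_partial i f F \<and> exp_bounded (\<lambda>x. norm x * F x)" for i
    by (rule exI[of _ "F1 i"]) (simp add: F(2,4))
  then show ?thesis unfolding tame_def using F(1) by simp
qed

lemma Lop_cmult:
  assumes "Lop f g" shows "Lop (\<lambda>x. c * f x) (\<lambda>x. c * g x)"
proof -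
  obtain F1 F2 where "Lop_witness f g F1 F2" using assms unfolding Lop_def by blast
  note F = Lop_witnessD[OF this]
  have "exp_bounded (\<lambda>x. norm x * (c * F1 i x))" "exp_bounded (\<lambda>x. (norm x)\<^sup>2 * (c * F2 i x))" for i
    using exp_bounded_mult[OF exp_bounded_const F(4)[of i], of c]
      exp_bounded_mult[OF exp_bounded_const F(5)[of i], of c]
    by (simp_all add: mult.left_commute)
  moreover have "(\<Sum>i\<in>UNIV. c * F2 i x) + (2 / (norm x)\<^sup>2 - 2) * (\<Sum>i\<in>UNIV. x $ i * (c * F1 i x)) = c * g x"
    if "x \<noteq> 0" for x
  proof -
    have "(\<Sum>i\<in>UNIV. c * F2 i x) = c * (\<Sum>i\<in>UNIV. F2 i x)"
      "(\<Sum>i\<in>UNIV. x $ i * (c * F1 i x)) = c * (\<Sum>i\<in>UNIV. x $ i * F1 i x)"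
      by (simp_all add: sum_distrib_left mult.left_commute)
    then show ?thesis unfolding F(6)[OF that, symmetric] by (simp add: algebra_simps)
  qed
  ultimately show ?thesis
    using F(1-3)
    by (intro LopI[of _ "\<lambda>i x. c * F1 i x" "\<lambda>i x. c * F2 i x"])
       (simp_all add: has_partial_cmult exp_bounded_mult[OF exp_bounded_const])
qed

lemma Lop_add:
  assumes "Lop f g" "Lop f' g'" shows "Lop (\<lambda>x. f x + f' x) (\<lambda>x. g x + g' x)"
proof -
  obtain F1 F2 where "Lop_witness f g F1 F2" using assms(1) unfolding Lop_def by blast
  note F = Lop_witnessD[OF this]
  obtain G1 G2 where "Lop_witness f' g' G1 G2" using assms(2) unfolding Lop_def by blast
  note G = Lop_witnessD[OF this]
  have "exp_bounded (\<lambda>x. norm x * (F1 i x + G1 i x))" "exp_bounded (\<lambda>x. (norm x)\<^sup>2 * (F2 i x + G2 i x))" for i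
    using exp_bounded_add[OF F(4) G(4), of i i] exp_bounded_add[OF F(5) G(5), of i i]
    by (simp_all add: distrib_left)
  moreover have "(\<Sum>i\<in>UNIV. F2 i x + G2 i x)
      + (2 / (norm x)\<^sup>2 - 2) * (\<Sum>i\<in>UNIV. x $ i * (F1 i x + G1 i x)) = g x + g' x"
    if "x \<noteq> 0" for x
    using F(6)[OF that, symmetric] G(6)[OF that, symmetric] by (simp add: sum.distrib distrib_left)
  ultimately show ?thesis
    using F(1-3) G(1-3)
    by (intro LopI[of _ "\<lambda>i x. F1 i x + G1 i x" "\<lambda>i x. F2 i x + G2 i x"])
       (simp_all add: has_partial_add exp_bounded_add)
qed

lemma Lop_zero: "Lop (\<lambda>x. 0) (\<lambda>x. 0)"
  by (rule LopI[of _ "\<lambda>i x. 0" "\<lambda>i x. 0"]) (simp_all add: has_partial_const)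

lemma Lop_sum: "(\<And>i. i \<in> I \<Longrightarrow> Lop (f i) (g i)) \<Longrightarrow> Lop (\<lambda>x. \<Sum>i\<in>I. f i x) (\<lambda>x. \<Sum>i\<in>I. g i x)"
proof (induction I rule: infinite_finite_induct)
  case (insert i I)
  then show ?case using Lop_add[of "f i" "g i" "\<lambda>x. \<Sum>i\<in>I. f i x" "\<lambda>x. \<Sum>i\<in>I. g i x"] by simp
qed (simp_all add: Lop_zero)

lemma Lop_cong:
  assumes "Lop f g" "\<And>x. x \<noteq> 0 \<Longrightarrow> g x = g' x" shows "Lop f g'"
proof -
  obtain F1 F2 where "Lop_witness f g F1 F2" using assms(1) unfolding Lop_def by blast
  then have "Lop_witness f g' F1 F2" using assms(2) unfolding Lop_witness_def by simp
  then show ?thesis unfolding Lop_def by blast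
qed

lemma exp_bounded_unit_component: "exp_bounded (\<lambda>x::real^'n::finite. x $ i / norm x)"
  by (rule exp_bounded_mono[OF exp_bounded_const[of 1]])
     (auto simp: divide_le_eq_1 component_le_norm_cart)

text \<open>Integration by parts: off the origin \<open>exp (- |x|^2) * Z i\<close> is the partial
  derivative in direction \<open>i\<close> of the weight times \<open>f * F1 i\<close>, so it
  integrates to 0; the sum of the \<open>Z i\<close> is the integrand of
  \<open>eform f \<phi> + bform f g\<close>.\<close>

lemma green:
  fixes f \<phi> g :: "real^'n::finite \<Rightarrow> real"
  assumes dim: "CARD('n) \<ge> 2" and f: "tame f" and \<phi>: "Lop \<phi> g" and g: "exp_bounded g"
  shows "eform f \<phi> = - bform f g"
proof -
  obtain F1 F2 where "Lop_witness \<phi> g F1 F2" using \<phi> unfolding Lop_def by blast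
  note F = Lop_witnessD[OF this]
  have fb: "exp_bounded f" using f by (rule tame_exp_bounded)
  \<comment> \<open>The middle term stems from the derivative of the weight, which contributes
    \<open>2 x_i (1 - |x|^2)\<close>. Writing \<open>x_i\<close> as \<open>norm x\<close> times a
    component of the unit vector provides the \<open>norm x\<close> that makes \<open>F1 i\<close>
    bounded near 0.\<close>
  define Z where "Z i x = (norm x * partial i f x) * (norm x * F1 i x)
      + f x * (2 * (x $ i / norm x) * (1 - (norm x)\<^sup>2)) * (norm x * F1 i x)
      + f x * ((norm x)\<^sup>2 * F2 i x)" for i x
  have Zb: "exp_bounded (Z i)" for i
    unfolding Z_def
    by (intro exp_bounded_add exp_bounded_mult exp_bounded_diff exp_bounded_power
        tame_norm_partial f fb F exp_bounded_unit_component exp_bounded_const exp_bounded_norm)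
  have Z0: "gint (Z i) = 0" for i
  proof -
    obtain C where C: "\<And>x. \<bar>exp (- 1 * (norm x)\<^sup>2) * Z i x\<bar> \<le> C * exp (- norm x)"
      using exp_bounded_gauss_le[OF Zb[of i], of 1] by auto
    define W where "W x = exp (- (norm x)\<^sup>2) * (norm x * f x * (norm x * F1 i x))" for x
    have "integrable lborel W"
      unfolding W_def by (intro integrable_gint exp_bounded_mult fb F exp_bounded_norm)
    moreover have "has_partial i W (\<lambda>x. exp (- (norm x)\<^sup>2) * Z i x)"
    proof -
      obtain f' where f': "has_partial i f f'" using f unfolding tame_def by blast
      have e: "has_partial i (\<lambda>x. exp (- (norm x)\<^sup>2)) (\<lambda>x. - exp (- (norm x)\<^sup>2) * (2 * x $ i))"
        by (rule has_partial_compose[OF has_partial_norm_sq, of "\<lambda>t. exp (- t)" "\<lambda>x. - exp (- (norm x)\<^sup>2)" i])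
           (auto intro!: derivative_eq_intros)
      have "has_partial i (\<lambda>x. exp (- (norm x)\<^sup>2) * ((norm x)\<^sup>2 * (f x * F1 i x)))
         (\<lambda>x. (- exp (- (norm x)\<^sup>2) * (2 * x $ i)) * ((norm x)\<^sup>2 * (f x * F1 i x)) +
            exp (- (norm x)\<^sup>2) * ((2 * x $ i) * (f x * F1 i x) +
            (norm x)\<^sup>2 * (f' x * F1 i x + f x * F2 i x)))"
        by (intro has_partial_mult e has_partial_norm_sq f' F)
      moreover have "(\<lambda>x. exp (- (norm x)\<^sup>2) * ((norm x)\<^sup>2 * (f x * F1 i x))) = W"
        by (simp add: W_def fun_eq_iff power2_eq_square)
      moreover have "(- exp (- (norm x)\<^sup>2) * (2 * x $ i)) * ((norm x)\<^sup>2 * (f x * F1 i x)) +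
            exp (- (norm x)\<^sup>2) * ((2 * x $ i) * (f x * F1 i x) +
            (norm x)\<^sup>2 * (f' x * F1 i x + f x * F2 i x)) = exp (- (norm x)\<^sup>2) * Z i x" if "x \<noteq> 0" for x
        using that has_partial_partial[OF f' that]
        by (simp add: Z_def power2_eq_square field_simps)
      ultimately show ?thesis by (auto intro: has_partial_cong)
    qed
    moreover have "(\<lambda>x. exp (- (norm x)\<^sup>2) * Z i x) \<in> borel_measurable borel"
      using Zb[of i] by measurable
    ultimately show ?thesis
      using integral_partial_eq_0[OF dim, of W i "\<lambda>x. exp (- (norm x)\<^sup>2) * Z i x" C] C
      unfolding gint_def by simp
  qed
  have "0 = gint (\<lambda>x. \<Sum>i\<in>UNIV. Z i x)"
    using Zb by (simp add: gint_sum Z0)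
  also have "\<dots> = gint (\<lambda>x. (\<Sum>i\<in>UNIV. (norm x * partial i f x) * (norm x * partial i \<phi> x))
      + (norm x * f x) * (norm x * g x))"
  proof (rule gint_cong)
    fix x :: "real^'n" assume x: "x \<noteq> 0"
    have "(\<Sum>i\<in>UNIV. Z i x) = (\<Sum>i\<in>UNIV. (norm x * partial i f x) * (norm x * F1 i x))
      + f x * (norm x)\<^sup>2 * ((\<Sum>i\<in>UNIV. F2 i x) + (2 / (norm x)\<^sup>2 - 2) * (\<Sum>i\<in>UNIV. x $ i * F1 i x))"
      using x unfolding sum_distrib_left sum.distrib[symmetric]
      by (intro sum.cong refl) (simp add: Z_def field_simps power2_eq_square)
    then show "(\<Sum>i\<in>UNIV. Z i x) = (\<Sum>i\<in>UNIV. (norm x * partial i f x) * (norm x * partial i \<phi> x))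
      + (norm x * f x) * (norm x * g x)"
      using F(6)[OF x] has_partial_partial[OF F(2) x] by (simp add: power2_eq_square)
  qed (intro exp_bounded_measurable exp_bounded_sum exp_bounded_add exp_bounded_mult Zb
        tame_norm_partial f Lop_tame[OF \<phi>] fb g exp_bounded_norm)+
  also have "\<dots> = eform f \<phi> + bform f g"
    unfolding eform_def bform_def
    by (rule gint_add) (intro exp_bounded_sum exp_bounded_mult
        tame_norm_partial f Lop_tame[OF \<phi>] fb g exp_bounded_norm)+
  finally show ?thesis by simp
qed

definition eig :: "real \<Rightarrow> (real^'n::finite \<Rightarrow> real) \<Rightarrow> bool" where
  "eig l u \<longleftrightarrow> Lop u (\<lambda>x. - l * u x)"

lemma eig_tame: "eig l u \<Longrightarrow> tame u"
  unfolding eig_def by (rule Lop_tame)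

lemma eig_eform:
  fixes f u :: "real^'n::finite \<Rightarrow> real"
  assumes "CARD('n) \<ge> 2" "tame f" "eig l u"
  shows "eform f u = l * bform f u"
proof -
  have "eform f u = - bform f (\<lambda>x. - l * u x)"
    by (rule green[OF assms(1,2)])
       (use assms(3) eig_tame tame_exp_bounded in \<open>auto simp: eig_def intro!: exp_bounded_mult exp_bounded_minus\<close>)
  also have "bform f (\<lambda>x. - l * u x) = - l * bform f u"
    unfolding bform_def by (subst gint_cmult[symmetric]) (simp add: algebra_simps)
  finally show ?thesis by simp
qed

lemma eig_orthogonal:
  fixes u w :: "real^'n::finite \<Rightarrow> real"
  assumes "CARD('n) \<ge> 2" "eig l u" "eig m w" "l \<noteq> m"
  shows "bform u w = 0"
proof -
  have "eform u w = m * bform u w" "eform w u = l * bform w u"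
    using assms by (auto intro!: eig_eform eig_tame)
  then have "(l - m) * bform u w = 0"
    using eform_commute[of u w] bform_commute[of u w] by (simp add: algebra_simps)
  then show ?thesis using assms(4) by simp
qed

text \<open>One expansion serves both forms: \<open>K = {()}\<close> gives Pythagoras for
  \<open>bform\<close>, and \<open>K = UNIV\<close>, the set of coordinate directions, gives Bessel
  for \<open>eform\<close>.\<close>

lemma gint_square_expand:
  fixes p :: "'k \<Rightarrow> real^'n::finite \<Rightarrow> real" and q :: "'k \<Rightarrow> 'l \<Rightarrow> real^'n \<Rightarrow> real"
  assumes p: "\<And>k. exp_bounded (p k)" and q: "\<And>k l. l \<in> L \<Longrightarrow> exp_bounded (q k l)"
    and K: "finite K" and L: "finite L"
    and orth: "\<And>l m. l \<in> L \<Longrightarrow> m \<in> L \<Longrightarrow> l \<noteq> m \<Longrightarrow> gint (\<lambda>x. \<Sum>k\<in>K. q k l x * q k m x) = 0"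
  shows "gint (\<lambda>x. \<Sum>k\<in>K. (p k x - (\<Sum>l\<in>L. a l * q k l x))\<^sup>2) =
     gint (\<lambda>x. \<Sum>k\<in>K. p k x * p k x) - 2 * (\<Sum>l\<in>L. a l * gint (\<lambda>x. \<Sum>k\<in>K. p k x * q k l x))
     + (\<Sum>l\<in>L. (a l)\<^sup>2 * gint (\<lambda>x. \<Sum>k\<in>K. q k l x * q k l x))"
proof -
  have exp: "(\<Sum>k\<in>K. (p k x - (\<Sum>l\<in>L. a l * q k l x))\<^sup>2) = (\<Sum>k\<in>K. p k x * p k x)
     - 2 * (\<Sum>l\<in>L. a l * (\<Sum>k\<in>K. p k x * q k l x))
     + (\<Sum>l\<in>L. \<Sum>m\<in>L. (a l * a m) * (\<Sum>k\<in>K. q k l x * q k m x))" for x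
  proof -
    have "(\<Sum>k\<in>K. (p k x - (\<Sum>l\<in>L. a l * q k l x))\<^sup>2) =
      (\<Sum>k\<in>K. p k x * p k x - 2 * (\<Sum>l\<in>L. a l * (p k x * q k l x))
        + (\<Sum>l\<in>L. \<Sum>m\<in>L. (a l * a m) * (q k l x * q k m x)))"
    proof (rule sum.cong[OF refl])
      fix k
      have "(\<Sum>l\<in>L. a l * q k l x)\<^sup>2 = (\<Sum>l\<in>L. \<Sum>m\<in>L. (a l * a m) * (q k l x * q k m x))"
        unfolding power2_eq_square sum_product by (intro sum.cong refl) (simp add: algebra_simps)
      moreover have "p k x * (\<Sum>l\<in>L. a l * q k l x) = (\<Sum>l\<in>L. a l * (p k x * q k l x))"
        unfolding sum_distrib_left by (intro sum.cong refl) (simp add: algebra_simps)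
      ultimately show "(p k x - (\<Sum>l\<in>L. a l * q k l x))\<^sup>2 = p k x * p k x
          - 2 * (\<Sum>l\<in>L. a l * (p k x * q k l x)) + (\<Sum>l\<in>L. \<Sum>m\<in>L. (a l * a m) * (q k l x * q k m x))"
        by (simp add: power2_eq_square algebra_simps)
    qed
    also have "\<dots> = (\<Sum>k\<in>K. p k x * p k x)
     - 2 * (\<Sum>k\<in>K. \<Sum>l\<in>L. a l * (p k x * q k l x))
     + (\<Sum>k\<in>K. \<Sum>l\<in>L. \<Sum>m\<in>L. (a l * a m) * (q k l x * q k m x))"
      by (simp only: sum.distrib sum_subtractf sum_distrib_left)
    also have "(\<Sum>k\<in>K. \<Sum>l\<in>L. a l * (p k x * q k l x)) = (\<Sum>l\<in>L. a l * (\<Sum>k\<in>K. p k x * q k l x))"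
      by (subst sum.swap) (simp add: sum_distrib_left)
    also have "(\<Sum>k\<in>K. \<Sum>l\<in>L. \<Sum>m\<in>L. (a l * a m) * (q k l x * q k m x))
       = (\<Sum>l\<in>L. \<Sum>m\<in>L. (a l * a m) * (\<Sum>k\<in>K. q k l x * q k m x))"
    proof -
      have "(\<Sum>k\<in>K. \<Sum>l\<in>L. \<Sum>m\<in>L. (a l * a m) * (q k l x * q k m x))
        = (\<Sum>l\<in>L. \<Sum>k\<in>K. \<Sum>m\<in>L. (a l * a m) * (q k l x * q k m x))" by (rule sum.swap)
      also have "\<dots> = (\<Sum>l\<in>L. \<Sum>m\<in>L. \<Sum>k\<in>K. (a l * a m) * (q k l x * q k m x))"
        by (intro sum.cong refl sum.swap)
      finally show ?thesis by (simp add: sum_distrib_left)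
    qed
    finally show ?thesis .
  qed
  have eb: "exp_bounded (\<lambda>x. \<Sum>k\<in>K. p k x * p k x)"
    "\<And>l. l \<in> L \<Longrightarrow> exp_bounded (\<lambda>x. \<Sum>k\<in>K. p k x * q k l x)"
    "\<And>l m. l \<in> L \<Longrightarrow> m \<in> L \<Longrightarrow> exp_bounded (\<lambda>x. \<Sum>k\<in>K. q k l x * q k m x)"
    using p q by (auto intro!: exp_bounded_sum exp_bounded_mult)
  have "gint (\<lambda>x. \<Sum>k\<in>K. (p k x - (\<Sum>l\<in>L. a l * q k l x))\<^sup>2) =
     gint (\<lambda>x. \<Sum>k\<in>K. p k x * p k x) - 2 * (\<Sum>l\<in>L. a l * gint (\<lambda>x. \<Sum>k\<in>K. p k x * q k l x))
     + (\<Sum>l\<in>L. \<Sum>m\<in>L. (a l * a m) * gint (\<lambda>x. \<Sum>k\<in>K. q k l x * q k m x))"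
  proof -
    have eb1: "exp_bounded (\<lambda>x. \<Sum>l\<in>L. a l * (\<Sum>k\<in>K. p k x * q k l x))"
      by (intro exp_bounded_sum exp_bounded_mult exp_bounded_const eb(2))
    have eb2: "exp_bounded (\<lambda>x. \<Sum>m\<in>L. (a l * a m) * (\<Sum>k\<in>K. q k l x * q k m x))" if "l \<in> L" for l
      by (intro exp_bounded_sum exp_bounded_mult exp_bounded_const eb(3) that)
    have "gint (\<lambda>x. \<Sum>l\<in>L. a l * (\<Sum>k\<in>K. p k x * q k l x)) = (\<Sum>l\<in>L. a l * gint (\<lambda>x. \<Sum>k\<in>K. p k x * q k l x))"
      using gint_sum[of L "\<lambda>l x. a l * (\<Sum>k\<in>K. p k x * q k l x)"] eb(2)
      by (simp add: exp_bounded_mult gint_cmult)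
    moreover have "gint (\<lambda>x. \<Sum>l\<in>L. \<Sum>m\<in>L. (a l * a m) * (\<Sum>k\<in>K. q k l x * q k m x))
      = (\<Sum>l\<in>L. \<Sum>m\<in>L. (a l * a m) * gint (\<lambda>x. \<Sum>k\<in>K. q k l x * q k m x))"
    proof -
      have "gint (\<lambda>x. \<Sum>m\<in>L. (a l * a m) * (\<Sum>k\<in>K. q k l x * q k m x))
        = (\<Sum>m\<in>L. (a l * a m) * gint (\<lambda>x. \<Sum>k\<in>K. q k l x * q k m x))" if "l \<in> L" for l
        using gint_sum[of L "\<lambda>m x. (a l * a m) * (\<Sum>k\<in>K. q k l x * q k m x)"] eb(3)[OF that]
        by (simp only: exp_bounded_mult exp_bounded_const gint_cmult)
      then show ?thesis
        using gint_sum[of L "\<lambda>l x. \<Sum>m\<in>L. (a l * a m) * (\<Sum>k\<in>K. q k l x * q k m x)"] eb2 by simp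
    qed
    ultimately show ?thesis
      unfolding exp using gint_add[OF exp_bounded_diff[OF eb(1) exp_bounded_mult[OF exp_bounded_const[of 2] eb1]]
          exp_bounded_sum[of L "\<lambda>l x. \<Sum>m\<in>L. (a l * a m) * (\<Sum>k\<in>K. q k l x * q k m x)"]] eb2
        gint_diff[OF eb(1) exp_bounded_mult[OF exp_bounded_const[of 2] eb1]]
      by (simp only: gint_cmult)
  qed
  also have "(\<Sum>l\<in>L. \<Sum>m\<in>L. (a l * a m) * gint (\<lambda>x. \<Sum>k\<in>K. q k l x * q k m x))
    = (\<Sum>l\<in>L. \<Sum>m\<in>L. if m = l then (a l)\<^sup>2 * gint (\<lambda>x. \<Sum>k\<in>K. q k l x * q k l x) else 0)"
    using orth by (intro sum.cong refl) (auto simp: power2_eq_square)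
  also have "\<dots> = (\<Sum>l\<in>L. (a l)\<^sup>2 * gint (\<lambda>x. \<Sum>k\<in>K. q k l x * q k l x))"
    using L by (simp add: sum.delta)
  finally show ?thesis .
qed

text \<open>If \<open>bsq u = 0\<close>, the nonnegative quantity \<open>bsq (v - t u)\<close> is an
  affine function of \<open>t\<close>, so its slope vanishes. This covers zero modes, whose
  projection coefficient is a division by 0.\<close>

lemma bform_null:
  assumes v: "exp_bounded v" and u: "exp_bounded u" and 0: "bform u u = 0"
  shows "bform v u = 0"
proof -
  have q: "2 * (t * bform v u) \<le> bsq v" for t
  proof -
    have "0 \<le> gint (\<lambda>x. \<Sum>k\<in>{()}. (norm x * v x - (\<Sum>l\<in>{()}. t * (norm x * u x)))\<^sup>2)"
      by (rule gint_nonneg) simp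
    also have "\<dots> = bsq v - 2 * (t * bform v u) + t\<^sup>2 * bform u u"
      by (subst gint_square_expand) (use v u in \<open>auto simp: bform_def\<close>)
    finally show ?thesis using 0 by simp
  qed
  show ?thesis
  proof (rule ccontr)
    assume "bform v u \<noteq> 0"
    then have "2 * ((bsq v + 1) / (2 * bform v u) * bform v u) = bsq v + 1" by simp
    then show False using q[of "(bsq v + 1) / (2 * bform v u)"] by linarith
  qed
qed

text \<open>The coefficients \<open>c l\<close> are those of the orthogonal projection of \<open>v\<close> onto the line of \<open>u l\<close>;
  they replace a complete orthonormal system, because \<open>\<Sum>c l * u l\<close> is at least as close to \<open>v\<close> as
  \<open>\<Sum>u l\<close> is.\<close>

lemma bessel_pythagoras:
  fixes v :: "real^'n::finite \<Rightarrow> real"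
  assumes dim: "CARD('n) \<ge> 2" and v: "tame v" and L: "finite L"
    and u: "\<And>l. l \<in> L \<Longrightarrow> eig l (u l)"
    and close: "bsq (\<lambda>x. v x - (\<Sum>l\<in>L. u l x)) \<le> e"
  shows "\<exists>c w. (\<Sum>l\<in>L. l * w l) \<le> eform v v \<and> (\<forall>l. w l \<ge> 0) \<and>
    (\<forall>M. M \<subseteq> L \<longrightarrow> bsq (\<lambda>x. v x - (\<Sum>l\<in>M. c l * u l x))
        \<le> e + (\<Sum>l\<in>L - M. w l))"
proof -
  define c where "c l = bform v (u l) / bsq (u l)" for l
  \<comment> \<open>\<open>w l\<close> is the squared norm of the projection of \<open>v\<close>
    onto the line of \<open>u l\<close>.\<close>
  define w where "w l = (c l)\<^sup>2 * bsq (u l)" for l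
  have vb: "exp_bounded v" using v by (rule tame_exp_bounded)
  have ut: "tame (u l)" and ub: "exp_bounded (u l)" if "l \<in> L" for l
    using u[OF that] by (auto intro: eig_tame tame_exp_bounded)
  \<comment> \<open>If \<open>bsq (u l) = 0\<close>, both sides are 0, the right one by
    \<open>bform_null\<close>.\<close>
  have c: "c l * bsq (u l) = bform v (u l)" if "l \<in> L" for l
    using bform_null[OF vb ub[OF that]] by (simp add: c_def)
  have orth: "bform (u l) (u m) = 0" if "l \<in> L" "m \<in> L" "l \<noteq> m" for l m
    using eig_orthogonal[OF dim u[OF that(1)] u[OF that(2)] that(3)] .
  have cw: "c l * bform v (u l) = w l" if "l \<in> L" for l
    using c[OF that] by (simp add: w_def power2_eq_square mult.assoc)
  have w: "w l \<ge> 0" for l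
    unfolding w_def bform_def by (intro mult_nonneg_nonneg[OF zero_le_power2] gint_nonneg) simp
  have B: "bsq (\<lambda>x. v x - (\<Sum>l\<in>M. a l * u l x))
    = bsq v - 2 * (\<Sum>l\<in>M. a l * bform v (u l)) + (\<Sum>l\<in>M. (a l)\<^sup>2 * bsq (u l))"
    if M: "M \<subseteq> L" for M a
  proof -
    have "bsq (\<lambda>x. v x - (\<Sum>l\<in>M. a l * u l x))
      = gint (\<lambda>x. \<Sum>k\<in>{()}. (norm x * v x - (\<Sum>l\<in>M. a l * (norm x * u l x)))\<^sup>2)"
      unfolding bform_def
      by (simp add: power2_eq_square right_diff_distrib sum_distrib_left mult.left_commute)
    also have "\<dots> = bsq v - 2 * (\<Sum>l\<in>M. a l * bform v (u l)) + (\<Sum>l\<in>M. (a l)\<^sup>2 * bsq (u l))"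
      by (subst gint_square_expand)
         (use M orth vb ub finite_subset[OF M L] in \<open>auto simp: bform_def subset_iff intro!: exp_bounded_mult\<close>)
    finally show ?thesis .
  qed
  have Bc: "bsq (\<lambda>x. v x - (\<Sum>l\<in>M. c l * u l x))
    = bsq v - (\<Sum>l\<in>M. w l)" if M: "M \<subseteq> L" for M
  proof -
    have "(\<Sum>l\<in>M. c l * bform v (u l)) = (\<Sum>l\<in>M. w l)"
      using M cw by (intro sum.cong) auto
    then show ?thesis by (subst B[OF M]) (simp add: w_def)
  qed
  have "bsq v - (\<Sum>l\<in>L. w l) \<le> e"
  proof -
    have "bsq v - 2 * (\<Sum>l\<in>L. bform v (u l)) + (\<Sum>l\<in>L. bsq (u l)) \<le> e"
      using close B[of L "\<lambda>_. 1"] by simp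
    moreover have "(\<Sum>l\<in>L. 2 * bform v (u l) - bsq (u l)) \<le> (\<Sum>l\<in>L. w l)"
    proof (rule sum_mono)
      fix l assume l: "l \<in> L"
      have "bsq (u l) \<ge> 0" unfolding bform_def by (rule gint_nonneg) simp
      then have "0 \<le> (c l - 1)\<^sup>2 * bsq (u l)" by simp
      also have "\<dots> = w l - 2 * bform v (u l) + bsq (u l)"
        unfolding w_def c[OF l, symmetric] by (simp add: power2_eq_square algebra_simps)
      finally show "2 * bform v (u l) - bsq (u l) \<le> w l" by simp
    qed
    ultimately show ?thesis by (simp add: sum_subtractf sum_distrib_left)
  qed
  then have M: "bsq (\<lambda>x. v x - (\<Sum>l\<in>M. c l * u l x))
        \<le> e + (\<Sum>l\<in>L - M. w l)" if "M \<subseteq> L" for M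
    using Bc[OF that] sum.subset_diff[OF that L, of w] by simp
  \<comment> \<open>The gradients of the \<open>u l\<close> inherit orthogonality, since
    \<open>eform\<close> against an eigenfunction is \<open>l\<close> times \<open>bform\<close>.
    Hence the mixed term is twice \<open>\<Sum> l * w l\<close> and the quadratic one is once the
    same sum.\<close>
  have "0 \<le> gint (\<lambda>x. \<Sum>i\<in>UNIV. (norm x * partial i v x - (\<Sum>l\<in>L. c l * (norm x * partial i (u l) x)))\<^sup>2)"
    by (intro gint_nonneg sum_nonneg) auto
  also have "\<dots> = eform v v - 2 * (\<Sum>l\<in>L. c l * eform v (u l)) + (\<Sum>l\<in>L. (c l)\<^sup>2 * eform (u l) (u l))"
    unfolding eform_def
  proof (rule gint_square_expand)
    show "gint (\<lambda>x. \<Sum>i\<in>UNIV. norm x * partial i (u l) x * (norm x * partial i (u m) x)) = 0"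
      if "l \<in> L" "m \<in> L" "l \<noteq> m" for l m
      using eig_eform[OF dim ut[OF that(1)] u[OF that(2)]] orth[OF that] by (simp add: eform_def)
  qed (use v ut L in \<open>auto intro: tame_norm_partial\<close>)
  also have "(\<Sum>l\<in>L. c l * eform v (u l)) = (\<Sum>l\<in>L. l * w l)"
    by (intro sum.cong refl) (simp add: eig_eform[OF dim v u] cw[symmetric])
  also have "(\<Sum>l\<in>L. (c l)\<^sup>2 * eform (u l) (u l)) = (\<Sum>l\<in>L. l * w l)"
    by (intro sum.cong refl) (simp add: eig_eform[OF dim ut u] w_def)
  finally have "(\<Sum>l\<in>L. l * w l) \<le> eform v v" by simp
  then show ?thesis using M w by (intro exI[of _ c] exI[of _ w]) simp
qed

section \<open>Regularity of test functions\<close>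

lemma differentiable_has_partial:
  assumes "v differentiable (at x)"
  shows "((\<lambda>t. v (x + t *\<^sub>R axis i 1)) has_vector_derivative partial i v x) (at 0)"
proof -
  obtain D where D: "(v has_derivative D) (at x)" using assms by (auto simp: differentiable_def)
  have "((\<lambda>t. v (x + t *\<^sub>R axis i 1)) has_derivative (\<lambda>t. D (t *\<^sub>R axis i 1))) (at 0)"
    by (rule has_derivative_compose[of "\<lambda>t. x + t *\<^sub>R axis i 1" "\<lambda>t. t *\<^sub>R axis i 1" 0 UNIV v D])
       (use D in \<open>auto intro!: derivative_eq_intros\<close>)
  then have "(\<lambda>t. v (x + t *\<^sub>R axis i 1)) differentiable (at 0)" by (auto simp: differentiable_def)
  then show ?thesis unfolding partial_def by (simp add: vector_derivative_works)
qed

lemma test_function_differentiable: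
  "test_function v \<Longrightarrow> iterated_partial is v differentiable (at x)"
  unfolding test_function_def smooth_def by blast

lemma test_function_continuous:
  assumes "test_function v"
  shows "continuous_on UNIV v" "continuous_on UNIV (partial i v)"
proof -
  have "continuous_on UNIV (iterated_partial is v)" for "is"
    using test_function_differentiable[OF assms]
    by (simp add: differentiable_imp_continuous_on differentiable_on_def differentiable_at_withinI)
  from this[of "[]"] this[of "[i]"]
  show "continuous_on UNIV v" "continuous_on UNIV (partial i v)" by simp_all
qed

lemma test_function_tame:
  fixes v :: "real^'n::finite \<Rightarrow> real"
  assumes "test_function v"
  shows "tame v"
proof -
  define K where "K = closure {x. v x \<noteq> 0}"
  have K: "compact K" using assms by (simp add: test_function_def K_def)
  have bd: "exp_bounded f" if f: "continuous_on UNIV f" and out: "\<And>x. x \<notin> K \<Longrightarrow> f x = 0" for f :: "real^'n \<Rightarrow> real"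
  proof -
    have "bounded (f ` K)"
      by (meson K compact_continuous_image compact_imp_bounded continuous_on_subset f subset_UNIV)
    then obtain B where B: "\<And>x. x \<in> K \<Longrightarrow> \<bar>f x\<bar> \<le> B" unfolding bounded_iff by auto
    \<comment> \<open>The outer bars are those of \<open>exp_bounded_mono\<close>, applied to the
      constant function with value \<open>\<bar>B\<bar>\<close>.\<close>
    have "\<bar>f x\<bar> \<le> \<bar>\<bar>B\<bar>\<bar>" for x using B[of x] out[of x] by (cases "x \<in> K") auto
    then show ?thesis
      by (rule exp_bounded_mono[OF exp_bounded_const borel_measurable_continuous_onI[OF f]])
  qed
  have vb: "exp_bounded v"
  proof (rule bd)
    show "continuous_on UNIV v" by (rule test_function_continuous[OF assms])
    show "v x = 0" if "x \<notin> K" for x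
      using that closure_subset[of "{x. v x \<noteq> 0}"] by (auto simp: K_def)
  qed
  have hp: "((\<lambda>t. v (x + t *\<^sub>R axis i 1)) has_real_derivative partial i v x) (at 0)" for i x
    unfolding has_real_derivative_iff_has_vector_derivative
    by (rule differentiable_has_partial) (use test_function_differentiable[OF assms, of "[]"] in simp)
  have pb: "exp_bounded (partial i v)" for i
  proof (rule bd)
    show "continuous_on UNIV (partial i v)" by (rule test_function_continuous[OF assms])
    fix x assume x: "x \<notin> K"
    have ev: "\<forall>\<^sub>F t in nhds 0. v (x + t *\<^sub>R axis i 1) = 0"
    proof -
      have "open (- K)" using K by (simp add: compact_imp_closed open_Compl)
      moreover have "continuous_on UNIV (\<lambda>t. x + t *\<^sub>R axis i 1 :: real^'n)" by (intro continuous_intros)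
      ultimately have "open ((\<lambda>t. x + t *\<^sub>R axis i 1) -` (- K))"
        by (simp add: open_vimage)
      moreover have "0 \<in> (\<lambda>t. x + t *\<^sub>R axis i 1) -` (- K)" using x by simp
      ultimately have "\<forall>\<^sub>F t in nhds 0. t \<in> (\<lambda>t. x + t *\<^sub>R axis i 1) -` (- K)"
        by (rule eventually_nhds_in_open)
      then show ?thesis
        by (rule eventually_mono) (use closure_subset[of "{x. v x \<noteq> 0}"] in \<open>auto simp: K_def\<close>)
    qed
    have "((\<lambda>t::real. 0) has_real_derivative partial i v x) (at 0)"
      using hp[of x i] DERIV_cong_ev[OF refl ev refl] by simp
    then show "partial i v x = 0" using DERIV_unique[OF _ DERIV_const] by blast
  qed
  show ?thesis
  proof -
    have "has_partial i v (partial i v) \<and> exp_bounded (\<lambda>x. norm x * partial i v x)" for i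
      using hp exp_bounded_mult[OF exp_bounded_norm pb] by (simp add: has_partial_def)
    then show ?thesis unfolding tame_def using vb by blast
  qed
qed

section \<open>Harmonic polynomials\<close>

lemma polynomial_partial:
  fixes p :: "real^'n::finite \<Rightarrow> real"
  assumes "real_polynomial_function p"
  shows "real_polynomial_function (partial i p)"
    and "((\<lambda>t. p (x + t *\<^sub>R axis i 1)) has_real_derivative partial i p x) (at 0)"
proof -
  \<comment> \<open>Existence of the derivative is proved together with a polynomial that represents
    it; only then does \<open>partial\<close>, a \<open>vector_derivative\<close>, have a known
    value.\<close>
  have "\<exists>q. real_polynomial_function q \<and>
    (\<forall>x. ((\<lambda>t. p (x + t *\<^sub>R axis i 1)) has_real_derivative q x) (at 0))"
    using assms
  proof (induction p rule: real_polynomial_function.induct)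
    case (linear f)
    have "((\<lambda>t. f x + t * f (axis i 1)) has_real_derivative f (axis i 1)) (at 0)" for x
      by (auto intro!: derivative_eq_intros)
    moreover have "f (x + t *\<^sub>R axis i 1) = f x + t * f (axis i 1)" for x t
      using linear by (simp add: bounded_linear.linear linear_add linear_cmul)
    ultimately show ?case by (intro exI[of _ "\<lambda>x. f (axis i 1)"]) auto
  next
    case (const c)
    show ?case by (intro exI[of _ "\<lambda>x. 0"]) auto
  next
    case (add f g)
    then obtain f' g' where
      "real_polynomial_function f'" "\<forall>x. ((\<lambda>t. f (x + t *\<^sub>R axis i 1)) has_real_derivative f' x) (at 0)"
      "real_polynomial_function g'" "\<forall>x. ((\<lambda>t. g (x + t *\<^sub>R axis i 1)) has_real_derivative g' x) (at 0)"
      by blast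
    then show ?case by (intro exI[of _ "\<lambda>x. f' x + g' x"]) (auto simp: DERIV_add)
  next
    case (mult f g)
    then obtain f' g' where fg:
      "real_polynomial_function f'" "\<forall>x. ((\<lambda>t. f (x + t *\<^sub>R axis i 1)) has_real_derivative f' x) (at 0)"
      "real_polynomial_function g'" "\<forall>x. ((\<lambda>t. g (x + t *\<^sub>R axis i 1)) has_real_derivative g' x) (at 0)"
      by blast
    have "((\<lambda>t. f (x + t *\<^sub>R axis i 1) * g (x + t *\<^sub>R axis i 1)) has_real_derivative
        f' x * g x + g' x * f x) (at 0)" for x
      using DERIV_mult[OF fg(2)[rule_format, of x] fg(4)[rule_format, of x]] by simp
    then show ?case
      using fg mult.hyps by (intro exI[of _ "\<lambda>x. f' x * g x + g' x * f x"]) auto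
  qed
  then obtain q where q: "real_polynomial_function q"
    "\<And>x. ((\<lambda>t. p (x + t *\<^sub>R axis i 1)) has_real_derivative q x) (at 0)" by blast
  have "partial i p = q"
    unfolding partial_def fun_eq_iff
    using q(2) by (auto simp: has_real_derivative_iff_has_vector_derivative intro: vector_derivative_at)
  then show "real_polynomial_function (partial i p)"
    "((\<lambda>t. p (x + t *\<^sub>R axis i 1)) has_real_derivative partial i p x) (at 0)" using q by auto
qed

lemma partial_eqI:
  "(\<And>x. ((\<lambda>t. p (x + t *\<^sub>R axis i 1)) has_real_derivative q x) (at 0)) \<Longrightarrow> partial i p = q"
  unfolding partial_def fun_eq_iff
  by (auto simp: has_real_derivative_iff_has_vector_derivative intro: vector_derivative_at)

lemma partial_const: "partial i (\<lambda>x. c::real) = (\<lambda>x. 0)"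
  by (rule partial_eqI) simp

lemma partial_linear:
  fixes f :: "real^'n::finite \<Rightarrow> real"
  assumes "bounded_linear f" shows "partial i f = (\<lambda>x. f (axis i 1))"
proof (rule partial_eqI)
  fix x :: "real^'n"
  have "((\<lambda>t. f x + t * f (axis i 1)) has_real_derivative f (axis i 1)) (at 0)"
    by (auto intro!: derivative_eq_intros)
  then show "((\<lambda>t. f (x + t *\<^sub>R axis i 1)) has_real_derivative f (axis i 1)) (at 0)"
    using assms by (simp add: bounded_linear.linear linear_add linear_cmul)
qed

lemma partial_add:
  assumes "real_polynomial_function p" "real_polynomial_function q"
  shows "partial i (\<lambda>x. p x + q x) = (\<lambda>x. partial i p x + partial i q x)"
  by (rule partial_eqI) (intro DERIV_add polynomial_partial(2) assms)

lemma partial_mult: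
  assumes "real_polynomial_function p" "real_polynomial_function q"
  shows "partial i (\<lambda>x. p x * q x) = (\<lambda>x. partial i p x * q x + partial i q x * p x)"
proof (rule partial_eqI)
  show "((\<lambda>t. p (x + t *\<^sub>R axis i 1) * q (x + t *\<^sub>R axis i 1)) has_real_derivative
      partial i p x * q x + partial i q x * p x) (at 0)" for x
    using DERIV_mult[OF polynomial_partial(2)[OF assms(1), of x i] polynomial_partial(2)[OF assms(2), of x i]]
    by simp
qed

lemma partial_commute:
  assumes "real_polynomial_function p"
  shows "partial i (partial j p) = partial j (partial i p)"
  using assms
proof (induction p rule: real_polynomial_function.induct)
  case (add f g)
  then show ?case by (simp add: partial_add polynomial_partial(1))
next
  case (mult f g)
  then show ?case
    by (simp add: partial_mult partial_add polynomial_partial(1) real_polynomial_function.intros(4))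
       (simp add: fun_eq_iff)
qed (simp_all add: partial_linear partial_const)

lemma linear_component_sum:
  fixes f :: "real^'n::finite \<Rightarrow> real"
  assumes "bounded_linear f" shows "f x = (\<Sum>i\<in>UNIV. x $ i * f (axis i 1))"
proof -
  have "f x = f (\<Sum>i\<in>UNIV. x $ i *\<^sub>R axis i 1)"
    using basis_expansion[of x] by (simp add: scalar_mult_eq_scaleR)
  then show ?thesis using assms by (simp add: bounded_linear.linear linear_sum linear_cmul)
qed

text \<open>At \<open>t = 1\<close> this yields Euler's identity; at \<open>t = 0\<close> it reads
  off the coefficients of a form of degree 1.\<close>

lemma polynomial_ray_derivative:
  fixes p :: "real^'n::finite \<Rightarrow> real"
  assumes "real_polynomial_function p"
  shows "((\<lambda>t. p (t *\<^sub>R x)) has_real_derivative (\<Sum>i\<in>UNIV. x $ i * partial i p (t *\<^sub>R x))) (at t)"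
  using assms
proof (induction p rule: real_polynomial_function.induct)
  case (linear f)
  have f: "f (t *\<^sub>R x) = t * f x" for t using linear by (simp add: bounded_linear.linear linear_cmul)
  show ?case
    using linear linear_component_sum[OF linear, of x] by (simp add: partial_linear f) (auto intro!: derivative_eq_intros)
next
  case (const c)
  show ?case by (simp add: partial_const)
next
  case (add f g)
  then show ?case
    by (auto simp: partial_add distrib_left sum.distrib intro!: DERIV_add)
next
  case (mult f g)
  have "(\<Sum>i\<in>UNIV. x $ i * partial i (\<lambda>x. f x * g x) (t *\<^sub>R x)) =
     (\<Sum>i\<in>UNIV. x $ i * partial i f (t *\<^sub>R x)) * g (t *\<^sub>R x) +
     (\<Sum>i\<in>UNIV. x $ i * partial i g (t *\<^sub>R x)) * f (t *\<^sub>R x)"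
    unfolding sum_distrib_right sum.distrib[symmetric] using mult.hyps
    by (intro sum.cong refl) (simp add: partial_mult algebra_simps)
  then show ?case using DERIV_mult[OF mult.IH] by simp
qed

lemma polynomial_continuous_on: "real_polynomial_function p \<Longrightarrow> continuous_on S p"
  by (simp add: continuous_on_polymonial_function real_polynomial_function_eq)

lemma polynomial_measurable: "real_polynomial_function p \<Longrightarrow> p \<in> borel_measurable borel"
  by (intro borel_measurable_continuous_onI polynomial_continuous_on)

lemma polynomial_component: "real_polynomial_function (\<lambda>x::real^'n::finite. x $ i)"
  by (intro real_polynomial_function.intros(1) bounded_linear_vec_nth)

lemma polynomial_cmult: "real_polynomial_function p \<Longrightarrow> real_polynomial_function (\<lambda>x. c * p x)"
  by (intro real_polynomial_function.intros(4) real_polynomial_function.intros(2))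

lemma norm_sq_sum: "(norm (x::real^'n::finite))\<^sup>2 = (\<Sum>i\<in>UNIV. x $ i * x $ i)"
  by (simp add: power2_norm_eq_inner inner_vec_def)

lemma polynomial_norm_sq: "real_polynomial_function (\<lambda>x::real^'n::finite. (norm x)\<^sup>2)"
  unfolding norm_sq_sum
  by (intro real_polynomial_function_sum real_polynomial_function.intros(4) polynomial_component) simp

lemma partial_component: "partial i (\<lambda>x::real^'n::finite. x $ j) = (\<lambda>x. if j = i then 1 else 0)"
  by (simp add: partial_linear bounded_linear_vec_nth axis_def)

lemma partial_cmult:
  "real_polynomial_function p \<Longrightarrow> partial i (\<lambda>x. c * p x) = (\<lambda>x. c * partial i p x)"
  by (simp add: partial_mult partial_const real_polynomial_function.intros(2) mult.commute)

lemma partial_norm_sq: "partial i (\<lambda>x::real^'n::finite. (norm x)\<^sup>2) = (\<lambda>x. 2 * x $ i)"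
proof (rule ext)
  fix x :: "real^'n"
  have sq: "has_partial i (\<lambda>x. (norm x)\<^sup>2) (\<lambda>x::real^'n. 2 * x $ i)" by (rule has_partial_norm_sq)
  show "partial i (\<lambda>x. (norm x)\<^sup>2) x = 2 * x $ i"
  proof (cases "x = 0")
    case False
    then show ?thesis using has_partial_partial[OF sq] by simp
  next
    case True
    have "(\<lambda>t. (norm (0 + t *\<^sub>R axis i 1 :: real^'n))\<^sup>2) = (\<lambda>t. t\<^sup>2)" by (simp add: norm_axis_1)
    moreover have "((\<lambda>t::real. t\<^sup>2) has_real_derivative 0) (at 0)" by (auto intro!: derivative_eq_intros)
    ultimately have "((\<lambda>t. (norm (x + t *\<^sub>R axis i 1))\<^sup>2) has_real_derivative 2 * x $ i) (at 0)"
      using True by simp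
    then show ?thesis
      by (simp add: partial_def has_real_derivative_iff_has_vector_derivative vector_derivative_at)
  qed
qed

lemma laplacian_add:
  assumes "real_polynomial_function p" "real_polynomial_function q"
  shows "laplacian (\<lambda>x. p x + q x) x = laplacian p x + laplacian q x"
  using assms by (simp add: laplacian_def partial_add polynomial_partial(1) sum.distrib)

lemma laplacian_cmult:
  assumes "real_polynomial_function p"
  shows "laplacian (\<lambda>x. c * p x) x = c * laplacian p x"
  using assms by (simp add: laplacian_def partial_cmult polynomial_partial(1) sum_distrib_left)

lemma laplacian_mult:
  assumes "real_polynomial_function p" "real_polynomial_function q"
  shows "laplacian (\<lambda>x. p x * q x) x =
     laplacian p x * q x + 2 * (\<Sum>i\<in>UNIV. partial i p x * partial i q x) + p x * laplacian q x"
proof -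
  have "partial i (partial i (\<lambda>x. p x * q x)) x =
     partial i (partial i p) x * q x + 2 * (partial i p x * partial i q x) + p x * partial i (partial i q) x" for i
    using assms by (simp add: partial_mult partial_add polynomial_partial(1) real_polynomial_function.intros(4))
  then show ?thesis
    by (simp add: laplacian_def sum.distrib sum_distrib_left sum_distrib_right)
qed

lemma laplacian_norm_sq: "laplacian (\<lambda>x::real^'n::finite. (norm x)\<^sup>2) x = 2 * real CARD('n)"
  by (simp add: laplacian_def partial_norm_sq partial_cmult polynomial_component partial_component)

section \<open>Homogeneous and harmonic polynomials\<close>

definition homogeneous :: "nat \<Rightarrow> (real^'n::finite \<Rightarrow> real) \<Rightarrow> bool" where
  "homogeneous k p \<longleftrightarrow> (\<forall>t x. p (t *\<^sub>R x) = t ^ k * p x)"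

definition harmonic :: "nat \<Rightarrow> (real^'n::finite \<Rightarrow> real) \<Rightarrow> bool" where
  "harmonic k p \<longleftrightarrow> real_polynomial_function p \<and> homogeneous k p \<and> (\<forall>x. laplacian p x = 0)"

text \<open>The chain rule for \<open>p (t x + t s e_i)\<close> as a function of \<open>s\<close>.
  Keeping the factor \<open>t\<close> on the left includes \<open>t = 0\<close> and
  \<open>k = 0\<close>.\<close>

lemma homogeneous_partial_ray:
  assumes "real_polynomial_function p" "homogeneous k p"
  shows "t * partial i p (t *\<^sub>R x) = t ^ k * partial i p x"
proof -
  have "((\<lambda>s. p (t *\<^sub>R x + s *\<^sub>R axis i 1)) has_real_derivative partial i p (t *\<^sub>R x)) (at (t * 0))"
    using polynomial_partial(2)[OF assms(1)] by simp
  moreover have "((\<lambda>s. t * s) has_real_derivative t) (at 0)" by (auto intro!: derivative_eq_intros)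
  ultimately have "((\<lambda>s. p (t *\<^sub>R x + (t * s) *\<^sub>R axis i 1)) has_real_derivative partial i p (t *\<^sub>R x) * t) (at 0)"
    by (rule DERIV_chain2)
  moreover have "p (t *\<^sub>R x + (t * s) *\<^sub>R axis i 1) = t ^ k * p (x + s *\<^sub>R axis i 1)" for s
    using assms(2)[unfolded homogeneous_def, rule_format, of t "x + s *\<^sub>R axis i 1"]
    by (simp add: scaleR_right_distrib)
  moreover have "((\<lambda>s. t ^ k * p (x + s *\<^sub>R axis i 1)) has_real_derivative t ^ k * partial i p x) (at 0)"
    by (intro DERIV_cmult polynomial_partial(2) assms)
  ultimately show ?thesis
    using DERIV_unique by (force simp: mult.commute)
qed

text \<open>Homogeneity at \<open>t = 0\<close> says this, because \<open>0 ^ 0 = 1\<close>.\<close>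

lemma homogeneous_0_const:
  assumes "homogeneous 0 p" shows "p = (\<lambda>x. p 0)"
proof
  show "p x = p 0" for x using assms[unfolded homogeneous_def, rule_format, of 0 x] by simp
qed

lemma homogeneous_0_partial:
  fixes p :: "real^'n::finite \<Rightarrow> real"
  assumes "homogeneous 0 p" shows "partial i p = (\<lambda>x. 0)"
proof -
  obtain c where "p = (\<lambda>x. c)" using homogeneous_0_const[OF assms] by blast
  then show ?thesis by (simp add: partial_const)
qed

text \<open>The truncated \<open>k - 1\<close> is harmless: for \<open>k = 0\<close> the derivative
  is zero, which is homogeneous of every degree.\<close>

lemma homogeneous_partial:
  fixes p :: "real^'n::finite \<Rightarrow> real"
  assumes p: "real_polynomial_function p" "homogeneous k p"
  shows "homogeneous (k - 1) (partial i p)"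
proof (cases k)
  case 0
  then have "partial i p = (\<lambda>x. 0)" using homogeneous_0_partial p(2) by blast
  then show ?thesis by (simp add: homogeneous_def)
next
  case (Suc m)
  have nz: "partial i p (t *\<^sub>R x) = t ^ m * partial i p x" if "t \<noteq> 0" for t x
    using homogeneous_partial_ray[OF p, of t i x] that Suc by simp
  \<comment> \<open>The ray identity is empty at \<open>t = 0\<close>, so this value is obtained as
    a limit along the ray.\<close>
  have "partial i p 0 = 0 ^ m * partial i p x" for x
  proof -
    have c: "continuous_on UNIV (partial i p)" by (intro polynomial_continuous_on polynomial_partial p)
    have L1: "((\<lambda>t. partial i p (t *\<^sub>R x)) \<longlongrightarrow> partial i p (0 *\<^sub>R x)) (at 0)"
    proof -
      have "((\<lambda>t. t *\<^sub>R x) \<longlongrightarrow> 0 *\<^sub>R x) (at (0::real))" by (intro tendsto_intros)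
      then show ?thesis using continuous_on_tendsto_compose[OF c] by simp
    qed
    have L2: "((\<lambda>t. t ^ m * partial i p x) \<longlongrightarrow> 0 ^ m * partial i p x) (at (0::real))"
      by (intro tendsto_intros)
    have ev: "\<forall>\<^sub>F t in at 0. partial i p (t *\<^sub>R x) = t ^ m * partial i p x"
      using nz by (auto simp: eventually_at_filter)
    have "((\<lambda>t. t ^ m * partial i p x) \<longlongrightarrow> partial i p (0 *\<^sub>R x)) (at 0)"
      using L1 tendsto_cong[OF ev] by simp
    then show ?thesis using LIM_unique[OF _ L2] by simp
  qed
  then have "partial i p (t *\<^sub>R x) = t ^ m * partial i p x" for t x
    using nz by (cases "t = 0") auto
  then show ?thesis using Suc by (simp add: homogeneous_def)
qed

lemma euler_homogeneous:
  assumes "real_polynomial_function p" "homogeneous k p"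
  shows "(\<Sum>i\<in>UNIV. x $ i * partial i p x) = real k * p x"
proof -
  have "((\<lambda>t. p (t *\<^sub>R x)) has_real_derivative (\<Sum>i\<in>UNIV. x $ i * partial i p x)) (at 1)"
    using polynomial_ray_derivative[OF assms(1), of x 1] by simp
  moreover have "((\<lambda>t. t ^ k * p x) has_real_derivative real k * p x) (at 1)"
    by (auto intro!: derivative_eq_intros)
  moreover have "(\<lambda>t. p (t *\<^sub>R x)) = (\<lambda>t. t ^ k * p x)"
    using assms(2) by (simp add: homogeneous_def)
  ultimately show ?thesis using DERIV_unique by metis
qed

lemma homogeneous_cmult: "homogeneous k p \<Longrightarrow> homogeneous k (\<lambda>x. c * p x)"
  by (simp add: homogeneous_def)

lemma harmonic_cmult: "harmonic k p \<Longrightarrow> harmonic k (\<lambda>x. c * p x)"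
  by (simp add: harmonic_def polynomial_cmult homogeneous_cmult laplacian_cmult)

lemma harmonic_zero: "harmonic k (\<lambda>x. 0)"
  by (auto simp: harmonic_def homogeneous_def laplacian_def partial_const)

lemma harmonic_add: "harmonic k p \<Longrightarrow> harmonic k q \<Longrightarrow> harmonic k (\<lambda>x. p x + q x)"
  by (auto simp: harmonic_def homogeneous_def laplacian_add distrib_left)

lemma harmonic_const: "harmonic 0 (\<lambda>x. c)"
  by (auto simp: harmonic_def homogeneous_def laplacian_def partial_const)

lemma harmonic_partial:
  assumes "harmonic k p" shows "harmonic (k - 1) (partial i p)"
proof -
  have p: "real_polynomial_function p" "homogeneous k p" and lap: "\<And>x. laplacian p x = 0"
    using assms by (auto simp: harmonic_def)
  have "partial j (partial j (partial i p)) = partial i (partial j (partial j p))" for j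
    using p by (metis partial_commute polynomial_partial(1))
  then have "laplacian (partial i p) x = (\<Sum>j\<in>UNIV. partial i (partial j (partial j p)) x)" for x
    by (simp add: laplacian_def)
  moreover have "partial i (laplacian p) = (\<lambda>x. \<Sum>j\<in>UNIV. partial i (partial j (partial j p)) x)"
    unfolding laplacian_def
    by (rule partial_eqI, rule DERIV_sum) (intro polynomial_partial p)
  moreover have "partial i (laplacian p) = (\<lambda>x. 0)"
  proof -
    have "laplacian p = (\<lambda>x. 0)" using lap by blast
    then show ?thesis by (simp add: partial_const)
  qed
  ultimately have "laplacian (partial i p) x = 0" for x by (metis (no_types, lifting))
  then show ?thesis
    unfolding harmonic_def using p by (intro conjI allI polynomial_partial(1) homogeneous_partial)
qed

text \<open>This replaces the Fischer decomposition. The denominator vanishes for \<open>k = 0\<close> in dimension 2, but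
  then \<open>partial i h = 0\<close>.\<close>

lemma harmonic_times_component:
  fixes h :: "real^'n::finite \<Rightarrow> real"
  assumes dim: "CARD('n) \<ge> 2" and h: "harmonic k h"
  shows "harmonic (Suc k)
    (\<lambda>x. x $ i * h x + - 1 / (real CARD('n) + 2 * real k - 2) * ((norm x)\<^sup>2 * partial i h x))"
proof -
  \<comment> \<open>For \<open>q\<close> harmonic of degree \<open>k - 1\<close> the Laplacian of
    \<open>|x|^2 q\<close> is \<open>2 d q\<close>, and that of \<open>x_i h\<close> is
    \<open>2 * partial i h\<close>; the coefficient -1/d balances the two.\<close>
  define d where "d = real CARD('n) + 2 * real k - 2"
  define c where "c = - 1 / d"
  have p: "real_polynomial_function h" "homogeneous k h" and lap: "\<And>x. laplacian h x = 0"
    using h by (auto simp: harmonic_def)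
  have dh: "real_polynomial_function (partial i h)" "homogeneous (k - 1) (partial i h)"
    "\<And>x. laplacian (partial i h) x = 0"
    using harmonic_partial[OF h] by (auto simp: harmonic_def)
  have "laplacian (\<lambda>x. x $ i * h x) x = 2 * partial i h x" for x
  proof -
    have "laplacian (\<lambda>x. x $ i) x = 0" for x :: "real^'n"
      by (simp add: laplacian_def partial_component partial_const)
    moreover have "(\<Sum>j\<in>UNIV. partial j (\<lambda>x. x $ i) x * partial j h x)
      = (\<Sum>j\<in>UNIV. if i = j then partial j h x else 0)"
      by (intro sum.cong) (auto simp: partial_component)
    ultimately show ?thesis
      using lap by (simp add: laplacian_mult polynomial_component p sum.delta)
  qed
  moreover have "c * laplacian (\<lambda>x. (norm x)\<^sup>2 * partial i h x) x = - 2 * partial i h x" for x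
  proof (cases k)
    case 0
    then have "partial i h = (\<lambda>x. 0)" using homogeneous_0_partial p(2) by blast
    then show ?thesis by (simp add: laplacian_def partial_const)
  next
    case (Suc m)
    have "(\<Sum>j\<in>UNIV. partial j (\<lambda>x. (norm x)\<^sup>2) x * partial j (partial i h) x)
        = 2 * (\<Sum>j\<in>UNIV. x $ j * partial j (partial i h) x)"
      by (simp add: partial_norm_sq sum_distrib_left mult.assoc)
    also have "\<dots> = 2 * (real m * partial i h x)"
      using euler_homogeneous[OF dh(1,2)] Suc by simp
    finally have "laplacian (\<lambda>x. (norm x)\<^sup>2 * partial i h x) x
       = 2 * d * partial i h x"
      using Suc by (simp add: laplacian_mult polynomial_norm_sq dh laplacian_norm_sq d_def algebra_simps)
    moreover have "d \<noteq> 0" using dim Suc by (simp add: d_def)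
    ultimately show ?thesis by (simp add: c_def)
  qed
  ultimately have "laplacian (\<lambda>x. x $ i * h x + c * ((norm x)\<^sup>2 * partial i h x)) x = 0" for x
    by (simp add: laplacian_add laplacian_cmult polynomial_cmult real_polynomial_function.intros(4)
        polynomial_component polynomial_norm_sq p dh)
  moreover have "homogeneous (Suc k) (\<lambda>x. x $ i * h x + c * ((norm x)\<^sup>2 * partial i h x))"
    unfolding homogeneous_def
  proof (intro allI)
    fix t :: real and x :: "real^'n"
    have "(norm (t *\<^sub>R x))\<^sup>2 * partial i h (t *\<^sub>R x) = t ^ Suc k * ((norm x)\<^sup>2 * partial i h x)"
    proof -
      have "(norm (t *\<^sub>R x))\<^sup>2 * partial i h (t *\<^sub>R x) = t * (norm x)\<^sup>2 * (t * partial i h (t *\<^sub>R x))"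
        by (simp add: power_mult_distrib power2_eq_square[of t])
      then show ?thesis unfolding homogeneous_partial_ray[OF p] by simp
    qed
    moreover have "(t *\<^sub>R x) $ i * h (t *\<^sub>R x) = t ^ Suc k * (x $ i * h x)"
      using p(2) by (simp add: homogeneous_def)
    ultimately show "(t *\<^sub>R x) $ i * h (t *\<^sub>R x) + c * ((norm (t *\<^sub>R x))\<^sup>2 * partial i h (t *\<^sub>R x))
       = t ^ Suc k * (x $ i * h x + c * ((norm x)\<^sup>2 * partial i h x))"
      by (simp only: distrib_left mult.left_commute[of c])
  qed
  ultimately show ?thesis
    unfolding harmonic_def d_def[symmetric] c_def[symmetric]
    by (intro conjI allI real_polynomial_function.intros(3) polynomial_cmult real_polynomial_function.intros(4)
        polynomial_component polynomial_norm_sq p dh)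
qed

text \<open>The classical decomposition of polynomials into |x|^(2j) times harmonics, put as a
  closure property so that it is proved and used by induction. Scalar factors are absorbed into
  \<open>h\<close>.\<close>

inductive harmonic_span :: "(real^'n::finite \<Rightarrow> real) \<Rightarrow> bool" where
  base: "harmonic k h \<Longrightarrow> harmonic_span (\<lambda>x. norm x ^ (2 * j) * h x)"
| add: "harmonic_span f \<Longrightarrow> harmonic_span g \<Longrightarrow> harmonic_span (\<lambda>x. f x + g x)"

lemma harmonic_span_cmult: "harmonic_span f \<Longrightarrow> harmonic_span (\<lambda>x. c * f x)"
proof (induction rule: harmonic_span.induct)
  case (base k h j)
  then show ?case using harmonic_span.base[OF harmonic_cmult[OF base], of j c] by (simp add: mult.left_commute)
next
  case (add f g)
  then show ?case using harmonic_span.add by (simp add: distrib_left)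
qed

lemma harmonic_span_zero: "harmonic_span (\<lambda>x. 0)"
  using harmonic_span.base[OF harmonic_zero[of 0], of 0] by simp

lemma harmonic_span_sum:
  assumes "\<And>i. i \<in> I \<Longrightarrow> harmonic_span (f i)"
  shows "harmonic_span (\<lambda>x. \<Sum>i\<in>I. f i x)"
  using assms
proof (induction I rule: infinite_finite_induct)
  case (insert i I)
  then show ?case using harmonic_span.add[of "f i" "\<lambda>x. \<Sum>i\<in>I. f i x"] by simp
qed (simp_all add: harmonic_span_zero)

text \<open>Add and subtract: \<open>x_i h\<close> is the harmonic polynomial
  \<open>x_i h + c |x|^2 partial i h\<close> minus \<open>c |x|^2\<close> times the harmonic
  polynomial \<open>partial i h\<close>.\<close>

lemma harmonic_span_times_component:
  fixes f :: "real^'n::finite \<Rightarrow> real"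
  assumes dim: "CARD('n) \<ge> 2" and "harmonic_span f"
  shows "harmonic_span (\<lambda>x. x $ i * f x)"
  using assms(2)
proof (induction rule: harmonic_span.induct)
  case (base k h j)
  define c where "c = - 1 / (real CARD('n) + 2 * real k - 2)"
  have "harmonic_span (\<lambda>x. norm x ^ (2 * j) * (x $ i * h x + c * ((norm x)\<^sup>2 * partial i h x))
     + norm x ^ (2 * Suc j) * (- c * partial i h x))"
    unfolding c_def
    by (intro harmonic_span.add harmonic_span.base[OF harmonic_times_component[OF dim base]]
        harmonic_span.base[OF harmonic_cmult[OF harmonic_partial[OF base]]])
  moreover have "norm x ^ (2 * j) * (x $ i * h x + c * ((norm x)\<^sup>2 * partial i h x))
     + norm x ^ (2 * Suc j) * (- c * partial i h x) = x $ i * (norm x ^ (2 * j) * h x)" for x :: "real^'n"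
    by (simp add: algebra_simps power2_eq_square)
  ultimately show ?case by simp
next
  case (add f g)
  then show ?case using harmonic_span.add by (simp add: distrib_left)
qed

text \<open>The induction works on a stronger claim, that multiplication by \<open>p\<close>
  preserves the span; a product of polynomials is then two successive multiplications. The lemma is
  the case of the constant 1.\<close>

lemma polynomial_harmonic_span:
  fixes p :: "real^'n::finite \<Rightarrow> real"
  assumes dim: "CARD('n) \<ge> 2" and "real_polynomial_function p"
  shows "harmonic_span p"
proof -
  have mult: "harmonic_span f \<Longrightarrow> harmonic_span (\<lambda>x. p x * f x)" for f
    using assms(2)
  proof (induction p arbitrary: f rule: real_polynomial_function.induct)
    case (linear g)
    have gx: "g x = (\<Sum>i\<in>UNIV. g (axis i 1) * x $ i)" for x
      using linear_component_sum[OF linear(1), of x] by (simp add: mult.commute)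
    have "(\<lambda>x. g x * f x) = (\<lambda>x. \<Sum>i\<in>UNIV. g (axis i 1) * (x $ i * f x))"
      by (rule ext, subst gx) (simp add: sum_distrib_right mult.assoc)
    moreover have "harmonic_span (\<lambda>x. \<Sum>i\<in>UNIV. g (axis i 1) * (x $ i * f x))"
      by (intro harmonic_span_sum harmonic_span_cmult harmonic_span_times_component dim linear)
    ultimately show ?case by simp
  next
    case (const c)
    then show ?case by (simp add: harmonic_span_cmult)
  next
    case (add p q)
    show ?case unfolding distrib_right by (intro harmonic_span.add add.IH add.prems)
  next
    case (mult p q)
    show ?case unfolding mult.assoc by (intro mult.IH mult.prems)
  qed
  have "harmonic_span (\<lambda>x::real^'n. 1)"
    using harmonic_span.base[OF harmonic_const[of 1], of 0] by simp
  from mult[OF this] show ?thesis by simp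
qed

section \<open>Eigenfunctions\<close>

lemma has_partial_norm_powr:
  "has_partial i (\<lambda>x. norm x powr \<sigma>) (\<lambda>x. \<sigma> * norm x powr (\<sigma> - 2) * x $ i)"
proof -
  have "has_partial i (\<lambda>x. ((norm x)\<^sup>2) powr (\<sigma> / 2)) (\<lambda>x. (\<sigma> / 2) * ((norm x)\<^sup>2) powr (\<sigma> / 2 - 1) * (2 * x $ i))"
    by (rule has_partial_compose[OF has_partial_norm_sq]) (auto intro!: derivative_eq_intros)
  moreover have "((norm x)\<^sup>2) powr a = norm x powr (2 * a)" for x :: "real^'a" and a
  proof (cases "x = 0")
    case False
    then show ?thesis using powr_powr[of "norm x" 2 a] by (simp add: powr_numeral)
  qed simp
  ultimately show ?thesis by (simp add: algebra_simps)
qed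

lemma norm_powr_add_2: "x \<noteq> 0 \<Longrightarrow> norm x powr \<sigma> = (norm x)\<^sup>2 * norm x powr (\<sigma> - 2)"
  by (simp add: powr_diff powr_numeral)

text \<open>Homogeneity is asked for positive \<open>t\<close> only, because \<open>Q\<close> will
  contain factors \<open>norm x\<close>.\<close>

lemma homogeneous_bound:
  fixes Q :: "real^'n::finite \<Rightarrow> real"
  assumes "continuous_on (sphere 0 1) Q" "\<And>t x. t > 0 \<Longrightarrow> Q (t *\<^sub>R x) = t ^ k * Q x"
  obtains C where "C \<ge> 0" "\<And>x. x \<noteq> 0 \<Longrightarrow> \<bar>Q x\<bar> \<le> C * norm x ^ k"
proof -
  have "bounded (Q ` sphere 0 1)"
    by (intro compact_imp_bounded compact_continuous_image assms compact_sphere)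
  then obtain B where "\<forall>y\<in>Q ` sphere 0 1. norm y \<le> B" unfolding bounded_iff by blast
  then have B: "\<bar>Q x\<bar> \<le> B" if "x \<in> sphere 0 1" for x using that by force
  have "\<bar>Q x\<bar> \<le> \<bar>B\<bar> * norm x ^ k" if "x \<noteq> 0" for x
  proof -
    have "Q x = norm x ^ k * Q (x /\<^sub>R norm x)"
      using assms(2)[of "norm x" "x /\<^sub>R norm x"] that by simp
    moreover have "\<bar>Q (x /\<^sub>R norm x)\<bar> \<le> \<bar>B\<bar>" using B[of "x /\<^sub>R norm x"] that by simp
    ultimately show ?thesis by (simp add: abs_mult mult.commute[of "\<bar>B\<bar>"] mult_left_mono)
  qed
  then show ?thesis using that[of "\<bar>B\<bar>"] by simp
qed

text \<open>The total degree \<open>a = \<sigma> + k\<close> is nonnegative, so there is no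
  singularity at 0, and \<open>r^a = exp (a * ln r) \<le> exp (a * r)\<close> bounds the
  growth.\<close>

lemma exp_bounded_powr_mult:
  fixes Q :: "real^'n::finite \<Rightarrow> real"
  assumes \<sigma>: "\<sigma> + real k \<ge> 0" and Q: "Q \<in> borel_measurable borel"
    and cont: "continuous_on (sphere 0 1) Q" and hom: "\<And>t x. t > 0 \<Longrightarrow> Q (t *\<^sub>R x) = t ^ k * Q x"
  shows "exp_bounded (\<lambda>x. norm x powr \<sigma> * Q x)"
proof -
  obtain C where C: "C \<ge> 0" "\<And>x. x \<noteq> 0 \<Longrightarrow> \<bar>Q x\<bar> \<le> C * norm x ^ k"
    using homogeneous_bound[OF cont hom] by blast
  have "\<bar>norm x powr \<sigma> * Q x\<bar> \<le> C * exp ((\<sigma> + real k) * norm x)" for x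
  proof (cases "x = 0")
    case False
    have "\<bar>norm x powr \<sigma> * Q x\<bar> \<le> norm x powr \<sigma> * (C * norm x ^ k)"
      unfolding abs_mult using C(2)[OF False] by (simp add: mult_left_mono)
    also have "\<dots> = C * norm x powr (\<sigma> + real k)"
      using False by (simp add: powr_add powr_realpow)
    also have "\<dots> \<le> C * exp ((\<sigma> + real k) * norm x)"
    proof (rule mult_left_mono[OF _ C(1)])
      have "ln (norm x) \<le> norm x" using False ln_le_minus_one[of "norm x"] by simp
      then have "(\<sigma> + real k) * ln (norm x) \<le> (\<sigma> + real k) * norm x"
        by (intro mult_left_mono \<sigma>)
      then show "norm x powr (\<sigma> + real k) \<le> exp ((\<sigma> + real k) * norm x)"
        using False by (simp add: powr_def)
    qed
    finally show ?thesis .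
  qed (use C in simp)
  then show ?thesis using Q by (intro exp_boundedI) auto
qed

text \<open>The function is homogeneous of degree \<open>s = \<sigma> + k\<close>, so
  \<open>x \<bullet> \<nabla>\<close> multiplies it by \<open>s\<close>; harmonicity and Euler's
  identity for \<open>h\<close> reduce its Laplacian to
  \<open>\<sigma> (\<sigma> + N - 2 + 2 k)\<close> times \<open>|x|^(\<sigma>-2) h\<close>. In terms
  of \<open>s\<close> the first coefficient is \<open>s (s + N) - k (k + N - 2)\<close>, and the
  second is \<open>- 2 s\<close>.\<close>

lemma Lop_powr_harmonic:
  fixes h :: "real^'n::finite \<Rightarrow> real"
  assumes h: "harmonic k h" and \<sigma>: "\<sigma> + real k \<ge> 0"
  shows "Lop (\<lambda>x. norm x powr \<sigma> * h x)
    (\<lambda>x. (\<sigma> * (\<sigma> + real CARD('n) - 2 + 2 * real k) + 2 * (\<sigma> + real k)) * (norm x powr (\<sigma> - 2) * h x)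
        - 2 * (\<sigma> + real k) * (norm x powr \<sigma> * h x))"
proof -
  have p: "real_polynomial_function h" "homogeneous k h" and lap: "\<And>x. laplacian h x = 0"
    using h by (auto simp: harmonic_def)
  have dp: "real_polynomial_function (partial i h)" "real_polynomial_function (partial i (partial i h))" for i
    using p by (auto intro: polynomial_partial)
  have hp: "has_partial i q (partial i q)" if "real_polynomial_function q" for i q
    using polynomial_partial(2)[OF that] by (simp add: has_partial_def)
  define F1 where "F1 i x = \<sigma> * norm x powr (\<sigma> - 2) * x $ i * h x + norm x powr \<sigma> * partial i h x" for i x
  define F2 where "F2 i x = \<sigma> * ((\<sigma> - 2) * norm x powr (\<sigma> - 4) * x $ i * (x $ i * h x)
      + norm x powr (\<sigma> - 2) * (h x + x $ i * partial i h x))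
    + (\<sigma> * norm x powr (\<sigma> - 2) * x $ i * partial i h x + norm x powr \<sigma> * partial i (partial i h) x)" for i x
  have ray1: "t * partial i h (t *\<^sub>R x) = t ^ k * partial i h x" for t i x
    by (rule homogeneous_partial_ray[OF p])
  have ray2: "t\<^sup>2 * partial i (partial i h) (t *\<^sub>R x) = t ^ k * partial i (partial i h) x" if "t > 0" for t i x
  proof (cases k)
    case 0
    then have "partial i h = (\<lambda>x. 0)" using homogeneous_0_partial p(2) by blast
    then show ?thesis by (simp add: partial_const)
  next
    case (Suc m)
    have "t * partial i (partial i h) (t *\<^sub>R x) = t ^ m * partial i (partial i h) x"
      using homogeneous_partial_ray[OF dp(1) homogeneous_partial[OF p]] Suc by simp
    then show ?thesis using Suc by (simp add: power2_eq_square mult.assoc)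
  qed
  \<comment> \<open>A derivative of \<open>h\<close> multiplied by the power of |x| that it lost has
    degree \<open>k\<close> again under positive scalings, so one bound treats \<open>h\<close> and
    both derivatives.\<close>
  have e0: "exp_bounded (\<lambda>x. norm x powr \<sigma> * h x)"
    using p by (intro exp_bounded_powr_mult[OF \<sigma>] polynomial_measurable polynomial_continuous_on)
       (auto simp: homogeneous_def)
  have e1: "exp_bounded (\<lambda>x. norm x powr \<sigma> * (norm x * partial i h x))" for i
  proof (rule exp_bounded_powr_mult[OF \<sigma>])
    show "(\<lambda>x. norm x * partial i h x) \<in> borel_measurable borel"
      using polynomial_measurable[OF dp(1)] by measurable
    show "continuous_on (sphere 0 1) (\<lambda>x. norm x * partial i h x)"
      by (intro continuous_intros polynomial_continuous_on dp)
    show "norm (t *\<^sub>R x) * partial i h (t *\<^sub>R x) = t ^ k * (norm x * partial i h x)" if "t > 0" for t x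
      using ray1[of t i x, symmetric] that by (simp add: mult.left_commute mult.assoc)
  qed
  have e2: "exp_bounded (\<lambda>x. norm x powr \<sigma> * ((norm x)\<^sup>2 * partial i (partial i h) x))" for i
  proof (rule exp_bounded_powr_mult[OF \<sigma>])
    show "(\<lambda>x. (norm x)\<^sup>2 * partial i (partial i h) x) \<in> borel_measurable borel"
      using polynomial_measurable[OF dp(2)] by measurable
    show "continuous_on (sphere 0 1) (\<lambda>x. (norm x)\<^sup>2 * partial i (partial i h) x)"
      by (intro continuous_intros polynomial_continuous_on dp)
    show "(norm (t *\<^sub>R x))\<^sup>2 * partial i (partial i h) (t *\<^sub>R x)
        = t ^ k * ((norm x)\<^sup>2 * partial i (partial i h) x)" if "t > 0" for t x
      using ray2[OF that, of i x, symmetric] that by (simp add: mult.left_commute mult.assoc power_mult_distrib)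
  qed
  show ?thesis
  proof (rule LopI[of _ F1 F2])
    show "exp_bounded (\<lambda>x. norm x powr \<sigma> * h x)" by (rule e0)
    show "has_partial i (\<lambda>x. norm x powr \<sigma> * h x) (F1 i)" for i
      unfolding F1_def[abs_def]
      by (rule has_partial_mult[OF has_partial_norm_powr hp[OF p(1)]])
    show "has_partial i (F1 i) (F2 i)" for i
    proof -
      have a: "has_partial i (\<lambda>x. x $ i * h x) (\<lambda>x. (if i = i then 1 else 0) * h x + x $ i * partial i h x)"
        by (rule has_partial_mult[OF has_partial_component hp[OF p(1)]])
      have "has_partial i (\<lambda>x. \<sigma> * (norm x powr (\<sigma> - 2) * (x $ i * h x)) + norm x powr \<sigma> * partial i h x)
        (\<lambda>x. \<sigma> * ((\<sigma> - 2) * norm x powr (\<sigma> - 2 - 2) * x $ i * (x $ i * h x)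
          + norm x powr (\<sigma> - 2) * ((if i = i then 1 else 0) * h x + x $ i * partial i h x))
        + (\<sigma> * norm x powr (\<sigma> - 2) * x $ i * partial i h x + norm x powr \<sigma> * partial i (partial i h) x))"
        by (intro has_partial_add has_partial_cmult has_partial_mult[OF has_partial_norm_powr] a hp dp)
      then show ?thesis by (simp add: F1_def[abs_def] F2_def[abs_def] mult.assoc)
    qed
    show "exp_bounded (\<lambda>x. norm x * F1 i x)" for i
    proof -
      have "exp_bounded (\<lambda>x. \<sigma> * ((x $ i / norm x) * (norm x powr \<sigma> * h x))
          + norm x powr \<sigma> * (norm x * partial i h x))"
        by (intro exp_bounded_add[OF exp_bounded_mult[OF exp_bounded_const exp_bounded_mult[OF exp_bounded_unit_component e0]] e1])
      moreover have "norm x * F1 i x = \<sigma> * ((x $ i / norm x) * (norm x powr \<sigma> * h x))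
          + norm x powr \<sigma> * (norm x * partial i h x)" for x
      proof (cases "x = 0")
        case False
        then show ?thesis
          by (simp add: F1_def norm_powr_add_2[of x \<sigma>] power2_eq_square field_simps)
      qed simp
      ultimately show ?thesis by simp
    qed
    show "exp_bounded (\<lambda>x. (norm x)\<^sup>2 * F2 i x)" for i
    proof -
      have "exp_bounded (\<lambda>x. (\<sigma> * (\<sigma> - 2)) * ((x $ i / norm x)\<^sup>2 * (norm x powr \<sigma> * h x))
          + \<sigma> * (norm x powr \<sigma> * h x)
          + (2 * \<sigma>) * ((x $ i / norm x) * (norm x powr \<sigma> * (norm x * partial i h x)))
          + norm x powr \<sigma> * ((norm x)\<^sup>2 * partial i (partial i h) x))"
        by (rule exp_bounded_add[OF exp_bounded_add[OF exp_bounded_add[OF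
           exp_bounded_mult[OF exp_bounded_const exp_bounded_mult[OF exp_bounded_power[OF exp_bounded_unit_component] e0]]
           exp_bounded_mult[OF exp_bounded_const e0]]
           exp_bounded_mult[OF exp_bounded_const exp_bounded_mult[OF exp_bounded_unit_component e1]]] e2])
      moreover have "(norm x)\<^sup>2 * F2 i x = (\<sigma> * (\<sigma> - 2)) * ((x $ i / norm x)\<^sup>2 * (norm x powr \<sigma> * h x))
          + \<sigma> * (norm x powr \<sigma> * h x)
          + (2 * \<sigma>) * ((x $ i / norm x) * (norm x powr \<sigma> * (norm x * partial i h x)))
          + norm x powr \<sigma> * ((norm x)\<^sup>2 * partial i (partial i h) x)" for x
      proof (cases "x = 0")
        case False
        then show ?thesis
          using norm_powr_add_2[of x "\<sigma> - 2"]
          by (simp add: F2_def norm_powr_add_2[of x \<sigma>] power2_eq_square field_simps)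
      qed simp
      ultimately show ?thesis by simp
    qed
    fix x :: "real^'n" assume x: "x \<noteq> 0"
    define r where "r = (norm x)\<^sup>2"
    have r: "r \<noteq> 0" using x by (simp add: r_def)
    \<comment> \<open>The lowest power that occurs. The others are \<open>r P\<close> and
      \<open>r^2 P\<close>, which turns the claim into an algebraic identity.\<close>
    define P where "P = norm x powr (\<sigma> - 4)"
    have P2: "norm x powr (\<sigma> - 2) = r * P"
      using norm_powr_add_2[OF x, of "\<sigma> - 2"] by (simp add: P_def r_def)
    have P0: "norm x powr \<sigma> = r * (r * P)"
      using norm_powr_add_2[OF x, of \<sigma>] P2 by (simp add: r_def)
    have eul: "(\<Sum>i\<in>UNIV. x $ i * partial i h x) = real k * h x"
      by (rule euler_homogeneous[OF p])
    have sq: "(\<Sum>i\<in>UNIV. x $ i * x $ i) = r" by (simp add: r_def norm_sq_sum)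
    have l0: "(\<Sum>i\<in>UNIV. partial i (partial i h) x) = 0" using lap by (simp add: laplacian_def)
    have S2: "(\<Sum>i\<in>UNIV. F2 i x) = \<sigma> * (\<sigma> - 2) * P * h x * r + \<sigma> * (r * P) * (real CARD('n) * h x)
        + 2 * \<sigma> * (r * P) * (real k * h x)"
    proof -
      have "(\<Sum>i\<in>UNIV. F2 i x) = (\<Sum>i\<in>UNIV. \<sigma> * (\<sigma> - 2) * P * h x * (x $ i * x $ i) + \<sigma> * (r * P) * h x
        + 2 * \<sigma> * (r * P) * (x $ i * partial i h x) + r * (r * P) * partial i (partial i h) x)"
        by (intro sum.cong refl) (simp add: F2_def P0 P2 P_def[symmetric] algebra_simps)
      also have "\<dots> = \<sigma> * (\<sigma> - 2) * P * h x * (\<Sum>i\<in>UNIV. x $ i * x $ i) + real CARD('n) * (\<sigma> * (r * P) * h x)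
        + 2 * \<sigma> * (r * P) * (\<Sum>i\<in>UNIV. x $ i * partial i h x)
        + r * (r * P) * (\<Sum>i\<in>UNIV. partial i (partial i h) x)"
        by (simp only: sum.distrib sum_distrib_left[symmetric] sum_constant mult.left_commute[of "real CARD('n)"])
      finally show ?thesis unfolding eul sq l0 by simp
    qed
    have S1: "(\<Sum>i\<in>UNIV. x $ i * F1 i x) = \<sigma> * (r * P) * h x * r + r * (r * P) * (real k * h x)"
    proof -
      have "(\<Sum>i\<in>UNIV. x $ i * F1 i x) = (\<Sum>i\<in>UNIV. \<sigma> * (r * P) * h x * (x $ i * x $ i)
          + r * (r * P) * (x $ i * partial i h x))"
        by (intro sum.cong refl) (simp add: F1_def P0 P2 algebra_simps)
      also have "\<dots> = \<sigma> * (r * P) * h x * (\<Sum>i\<in>UNIV. x $ i * x $ i)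
          + r * (r * P) * (\<Sum>i\<in>UNIV. x $ i * partial i h x)"
        by (simp only: sum.distrib sum_distrib_left[symmetric])
      finally show ?thesis unfolding eul sq .
    qed
    show "(\<Sum>i\<in>UNIV. F2 i x) + (2 / (norm x)\<^sup>2 - 2) * (\<Sum>i\<in>UNIV. x $ i * F1 i x) =
      (\<sigma> * (\<sigma> + real CARD('n) - 2 + 2 * real k) + 2 * (\<sigma> + real k)) * (norm x powr (\<sigma> - 2) * h x)
        - 2 * (\<sigma> + real k) * (norm x powr \<sigma> * h x)"
      unfolding S1 S2 P0 P2 r_def[symmetric] using r by (simp add: field_simps)
  qed
qed

text \<open>The Laguerre recursion without Laguerre polynomials: \<open>L\<close> is triangular on the functions
  \<open>|x|^(s - k + 2 m) h\<close> with distinct diagonal entries.\<close>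

lemma eig_decomposition:
  fixes h :: "real^'n::finite \<Rightarrow> real"
  assumes h: "harmonic k h" and s: "s \<ge> 0" "s * (s + real CARD('n)) = real k * (real k + real CARD('n) - 2)"
  defines "f \<equiv> (\<lambda>m x. norm x powr (s - real k + 2 * real m) * h x)"
  shows "\<exists>e. (\<forall>i\<le>m. eig (2 * s + 4 * real i) (e i)) \<and> (\<exists>c. e 0 = (\<lambda>x. c * f 0 x)) \<and>
    (m \<ge> 1 \<longrightarrow> (\<exists>c d. e 1 = (\<lambda>x. c * f 0 x + d * f 1 x))) \<and> f m = (\<lambda>x. \<Sum>i\<le>m. e i x)"
proof (induction m)
  case 0
  have "Lop (f 0) (\<lambda>x. (- (2 * s)) * f 0 x)"
  proof (rule Lop_cong)
    show "Lop (f 0) (\<lambda>x. ((s - real k) * ((s - real k) + real CARD('n) - 2 + 2 * real k) + 2 * ((s - real k) + real k))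
        * (norm x powr ((s - real k) - 2) * h x) - 2 * ((s - real k) + real k) * (norm x powr (s - real k) * h x))"
      using Lop_powr_harmonic[OF h, of "s - real k"] s(1) by (simp add: f_def)
    have "(s - real k) * ((s - real k) + real CARD('n) - 2 + 2 * real k) + 2 * ((s - real k) + real k) = 0"
      using s(2) by (simp add: algebra_simps)
    then show "((s - real k) * ((s - real k) + real CARD('n) - 2 + 2 * real k) + 2 * ((s - real k) + real k))
        * (norm x powr ((s - real k) - 2) * h x) - 2 * ((s - real k) + real k) * (norm x powr (s - real k) * h x)
        = (- (2 * s)) * f 0 x" for x
      by (simp add: f_def)
  qed
  then show ?case
    by (intro exI[of _ "\<lambda>i. f 0"]) (auto simp: eig_def intro!: exI[of _ 1])
next
  case (Suc m)
  then obtain e where e: "\<And>i. i \<le> m \<Longrightarrow> eig (2 * s + 4 * real i) (e i)"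
    "\<exists>c. e 0 = (\<lambda>x. c * f 0 x)" "m \<ge> 1 \<longrightarrow> (\<exists>c d. e 1 = (\<lambda>x. c * f 0 x + d * f 1 x))"
    "f m = (\<lambda>x. \<Sum>i\<le>m. e i x)" by blast
  define lam where "lam i = 2 * s + 4 * real i" for i
  \<comment> \<open>\<open>b\<close> is the coefficient with which \<open>L\<close> maps
    \<open>f (Suc m)\<close> down to \<open>f m\<close>, simplified by the equation for
    \<open>s\<close>. As \<open>f m\<close> is the sum of the \<open>e i\<close>, subtracting
    \<open>w i * e i\<close> with \<open>(lam (Suc m) - lam i) * w i = b\<close> removes this part
    and leaves an eigenfunction.\<close>
  define b where "b = 2 * real (Suc m) * (2 * real (Suc m) + 2 * s + real CARD('n))"
  define w where "w i = b / (lam (Suc m) - lam i)" for i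
  define e' where "e' i = (if i \<le> m then (\<lambda>x. w i * e i x)
      else (\<lambda>x. f (Suc m) x + (- 1) * (\<Sum>i\<le>m. w i * e i x)))" for i
  have Lf: "Lop (f (Suc m)) (\<lambda>x. b * f m x - lam (Suc m) * f (Suc m) x)"
  proof (rule Lop_cong)
    define \<sigma> where "\<sigma> = s - real k + 2 * real (Suc m)"
    show "Lop (f (Suc m)) (\<lambda>x. (\<sigma> * (\<sigma> + real CARD('n) - 2 + 2 * real k) + 2 * (\<sigma> + real k)) * (norm x powr (\<sigma> - 2) * h x)
        - 2 * (\<sigma> + real k) * (norm x powr \<sigma> * h x))"
      using Lop_powr_harmonic[OF h, of \<sigma>] s(1) by (simp add: f_def \<sigma>_def)
    have "\<sigma> * (\<sigma> + real CARD('n) - 2 + 2 * real k) + 2 * (\<sigma> + real k) = b"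
    proof -
      define M where "M = real (Suc m)"
      have "\<sigma> * (\<sigma> + real CARD('n) - 2 + 2 * real k) + 2 * (\<sigma> + real k)
        = (s * (s + real CARD('n)) - real k * (real k + real CARD('n) - 2)) + b"
        unfolding \<sigma>_def b_def M_def[symmetric] by (simp add: algebra_simps)
      then show ?thesis using s(2) by simp
    qed
    moreover have "\<sigma> - 2 = s - real k + 2 * real m" "2 * (\<sigma> + real k) = lam (Suc m)"
      by (simp_all add: \<sigma>_def lam_def)
    moreover have "f (Suc m) = (\<lambda>x. norm x powr \<sigma> * h x)" "f m = (\<lambda>x. norm x powr (s - real k + 2 * real m) * h x)"
      by (simp_all add: f_def \<sigma>_def)
    ultimately show "(\<sigma> * (\<sigma> + real CARD('n) - 2 + 2 * real k) + 2 * (\<sigma> + real k)) * (norm x powr (\<sigma> - 2) * h x)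
        - 2 * (\<sigma> + real k) * (norm x powr \<sigma> * h x) = b * f m x - lam (Suc m) * f (Suc m) x" for x
      by (simp only:)
  qed
  have Le: "Lop (\<lambda>x. w i * e i x) (\<lambda>x. w i * (- lam i * e i x))" if "i \<le> m" for i
    using Lop_cmult e(1)[OF that] by (simp add: eig_def lam_def)
  have eig_e: "eig (lam i) (\<lambda>x. w i * e i x)" if "i \<le> m" for i
    using Le[OF that] by (simp add: eig_def mult.left_commute)
  have "Lop (e' (Suc m)) (\<lambda>x. (b * f m x - lam (Suc m) * f (Suc m) x) + (- 1) * (\<Sum>i\<le>m. w i * (- lam i * e i x)))"
  proof -
    have "Lop (\<lambda>x. \<Sum>i\<le>m. w i * e i x) (\<lambda>x. \<Sum>i\<le>m. w i * (- lam i * e i x))"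
      by (rule Lop_sum, rule Le) simp
    from Lop_add[OF Lf Lop_cmult[OF this, of "- 1"]] show ?thesis by (simp add: e'_def)
  qed
  moreover have "(b * f m x - lam (Suc m) * f (Suc m) x) + (- 1) * (\<Sum>i\<le>m. w i * (- lam i * e i x))
      = - lam (Suc m) * e' (Suc m) x" for x
  proof -
    have "b * f m x = (\<Sum>i\<le>m. (lam (Suc m) - lam i) * (w i * e i x))"
    proof -
      have "b * f m x = (\<Sum>i\<le>m. b * e i x)" by (simp add: e(4) sum_distrib_left)
      also have "\<dots> = (\<Sum>i\<le>m. (lam (Suc m) - lam i) * (w i * e i x))"
        by (intro sum.cong refl) (simp add: w_def lam_def)
      finally show ?thesis .
    qed
    also have "\<dots> = lam (Suc m) * (\<Sum>i\<le>m. w i * e i x) + (\<Sum>i\<le>m. w i * (- lam i * e i x))"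
      unfolding sum_distrib_left sum.distrib[symmetric] by (intro sum.cong refl) (simp add: algebra_simps)
    finally show ?thesis by (simp add: e'_def algebra_simps)
  qed
  ultimately have "eig (lam (Suc m)) (e' (Suc m))" unfolding eig_def by (rule Lop_cong)
  then have 1: "\<forall>i\<le>Suc m. eig (2 * s + 4 * real i) (e' i)"
    using eig_e unfolding lam_def[symmetric] by (auto simp: e'_def le_Suc_eq)
  \<comment> \<open>Only the components 0 and 1 are tracked explicitly, since no eigenvalue below
    \<open>D3\<close> has a higher radial index.\<close>
  obtain c where c: "e 0 = (\<lambda>x. c * f 0 x)" using e(2) by blast
  have 2: "\<exists>c. e' 0 = (\<lambda>x. c * f 0 x)"
    by (intro exI[of _ "w 0 * c"]) (simp add: e'_def c mult.assoc)
  have 3: "\<exists>c d. e' 1 = (\<lambda>x. c * f 0 x + d * f 1 x)"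
  proof (cases "m \<ge> 1")
    case True
    then obtain c d where "e 1 = (\<lambda>x. c * f 0 x + d * f 1 x)" using e(3) by blast
    then show ?thesis
      using True by (intro exI[of _ "w 1 * c"] exI[of _ "w 1 * d"]) (simp add: e'_def distrib_left mult.assoc)
  next
    case False
    then have "m = 0" by simp
    then show ?thesis
      by (intro exI[of _ "- (w 0 * c)"] exI[of _ 1]) (simp add: e'_def c fun_eq_iff)
  qed
  have 4: "f (Suc m) = (\<lambda>x. \<Sum>i\<le>Suc m. e' i x)"
    by (simp add: e'_def fun_eq_iff)
  show ?case using 1 2 3 4 by blast
qed

section \<open>Sums of eigenfunctions\<close>

text \<open>\<open>Dk k N / 2\<close> is the nonnegative root of the quadratic equation for the
  exponent \<open>s\<close>, with the discriminant under the square root.\<close>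

lemma Dk_half:
  assumes "N \<ge> 2"
  shows "Dk k N / 2 \<ge> 0" "Dk k N / 2 * (Dk k N / 2 + N) = real k * (real k + N - 2)"
proof -
  have nn: "4 * real k * (N + real k - 2) \<ge> 0" using assms by (intro mult_nonneg_nonneg) auto
  then have "sqrt (N\<^sup>2) \<le> sqrt (N\<^sup>2 + 4 * real k * (N + real k - 2))"
    by (intro real_sqrt_le_mono) simp
  then show "Dk k N / 2 \<ge> 0" using assms by (simp add: Dk_def)
  have "(sqrt (N\<^sup>2 + 4 * real k * (N + real k - 2)))\<^sup>2 = N\<^sup>2 + 4 * real k * (N + real k - 2)"
    using nn by (intro real_sqrt_pow2) (simp add: add_nonneg_nonneg)
  moreover define r where "r = sqrt (N\<^sup>2 + 4 * real k * (N + real k - 2))"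
  ultimately have "r\<^sup>2 = N\<^sup>2 + 4 * real k * (N + real k - 2)" by simp
  moreover have "Dk k N / 2 * (Dk k N / 2 + N) = (r\<^sup>2 - N\<^sup>2) / 4"
    unfolding Dk_def r_def[symmetric] by (simp add: field_simps power2_eq_square)
  ultimately show "Dk k N / 2 * (Dk k N / 2 + N) = real k * (real k + N - 2)"
    by (simp add: algebra_simps)
qed

text \<open>At \<open>s = k\<close> the increasing function \<open>s (s + N)\<close> exceeds
  \<open>k (k + N - 2)\<close> by \<open>2 k\<close>. The strict inequality will make |x|^(k - Dk/2)
  continuous at the origin.\<close>

lemma Dk_half_less:
  assumes "N \<ge> 2" "k \<ge> 1"
  shows "Dk k N / 2 < real k"
proof (rule ccontr)
  assume "\<not> Dk k N / 2 < real k"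
  then have "real k * (real k + N) \<le> Dk k N / 2 * (Dk k N / 2 + N)"
    using assms by (intro mult_mono) auto
  then show False using Dk_half(2)[OF assms(1), of k] assms by (simp add: algebra_simps)
qed

lemma Dk_mono:
  assumes "N \<ge> 2" "j \<le> k" shows "Dk j N \<le> Dk k N"
proof -
  have "4 * real j * (N + real j - 2) \<le> 4 * real k * (N + real k - 2)"
    using assms by (intro mult_mono) auto
  then show ?thesis unfolding Dk_def by simp
qed

lemma Dk_0: "N \<ge> 0 \<Longrightarrow> Dk 0 N = 0"
  by (simp add: Dk_def)

text \<open>The last two bounds exclude higher radial levels: \<open>Dk k N + 4 i\<close> is at
  least \<open>Dk 3 N\<close> if \<open>k \<ge> 1\<close> and \<open>i \<ge> 1\<close>, and also if
  \<open>k = 0\<close> and \<open>i \<ge> 2\<close>. Squared, the bound by \<open>Dk 1 N + 4\<close>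
  amounts to \<open>N \<le> sqrt (N^2 + 4 N - 4)\<close>.\<close>

lemma Dk_ordering:
  assumes "N \<ge> 2"
  shows "0 < Dk 1 N" "Dk 1 N < Dk 2 N" "Dk 2 N < 4" "4 < Dk 3 N" "Dk 3 N \<le> Dk 1 N + 4" "Dk 3 N \<le> 8"
proof -
  have D1: "Dk 1 N = sqrt (N\<^sup>2 + 4 * N - 4) - N" by (simp add: Dk_def algebra_simps)
  have D2: "Dk 2 N = sqrt (N\<^sup>2 + 8 * N) - N" by (simp add: Dk_def algebra_simps)
  have D3: "Dk 3 N = sqrt (N\<^sup>2 + 12 * N + 12) - N" by (simp add: Dk_def algebra_simps)
  have a: "N < sqrt (N\<^sup>2 + 4 * N - 4)"
    using assms by (intro real_less_rsqrt) simp
  then show "0 < Dk 1 N" unfolding D1 by simp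
  show "Dk 1 N < Dk 2 N" unfolding D1 D2 using assms by simp
  have "sqrt (N\<^sup>2 + 8 * N) < N + 4"
    using assms by (intro real_less_lsqrt) (auto simp: power2_eq_square algebra_simps)
  then show "Dk 2 N < 4" unfolding D2 by simp
  have "N + 4 < sqrt (N\<^sup>2 + 12 * N + 12)"
    using assms by (intro real_less_rsqrt) (simp add: power2_eq_square algebra_simps)
  then show "4 < Dk 3 N" unfolding D3 by simp
  have "sqrt (N\<^sup>2 + 12 * N + 12) \<le> sqrt (N\<^sup>2 + 4 * N - 4) + 4"
  proof (rule real_le_lsqrt)
    have "(sqrt (N\<^sup>2 + 4 * N - 4) + 4)\<^sup>2 = (N\<^sup>2 + 4 * N - 4) + 8 * sqrt (N\<^sup>2 + 4 * N - 4) + 16"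
    proof -
      have "0 \<le> N\<^sup>2 + 4 * N - 4" using assms zero_le_power2[of N] by linarith
      then show ?thesis by (simp add: power2_sum)
    qed
    then show "N\<^sup>2 + 12 * N + 12 \<le> (sqrt (N\<^sup>2 + 4 * N - 4) + 4)\<^sup>2" using a by simp
  qed (use a assms in auto)
  then show D31: "Dk 3 N \<le> Dk 1 N + 4" unfolding D1 D3 by simp
  show "Dk 3 N \<le> 8" using D31 \<open>Dk 1 N < Dk 2 N\<close> \<open>Dk 2 N < 4\<close> by simp
qed

text \<open>\<open>mode l u\<close>: \<open>u\<close> is an eigenfunction for \<open>l\<close>, of the explicit form required by the theorem when
  \<open>l\<close> is one of the four lowest eigenvalues \<open>0 < D1 < D2 < 4\<close>; below \<open>D3\<close> there are no others.\<close>

definition mode :: "real \<Rightarrow> (real^'n::finite \<Rightarrow> real) \<Rightarrow> bool" where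
  "mode l u \<longleftrightarrow> eig l u \<and>
     (l = 0 \<longrightarrow> (\<exists>c. \<forall>x. x \<noteq> 0 \<longrightarrow> u x = c)) \<and>
     (l = Dk 1 (real CARD('n)) \<longrightarrow>
        (\<exists>h. harmonic 1 h \<and> (\<forall>x. x \<noteq> 0 \<longrightarrow> u x = norm x powr (Dk 1 (real CARD('n)) / 2 - 1) * h x))) \<and>
     (l = Dk 2 (real CARD('n)) \<longrightarrow>
        (\<exists>h. harmonic 2 h \<and> (\<forall>x. x \<noteq> 0 \<longrightarrow> u x = norm x powr (Dk 2 (real CARD('n)) / 2 - 2) * h x))) \<and>
     (l = 4 \<longrightarrow> (\<exists>c d. \<forall>x. x \<noteq> 0 \<longrightarrow> u x = c + d * (norm x)\<^sup>2)) \<and>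
     (l < Dk 3 (real CARD('n)) \<and> l \<notin> {0, Dk 1 (real CARD('n)), Dk 2 (real CARD('n)), 4} \<longrightarrow> (\<forall>x. u x = 0))"

lemma modeD:
  fixes u :: "real^'n::finite \<Rightarrow> real"
  assumes "mode l u"
  shows "eig l u"
    "l = 0 \<Longrightarrow> \<exists>c. \<forall>x. x \<noteq> 0 \<longrightarrow> u x = c"
    "l = Dk 1 (real CARD('n)) \<Longrightarrow>
        \<exists>h. harmonic 1 h \<and> (\<forall>x. x \<noteq> 0 \<longrightarrow> u x = norm x powr (Dk 1 (real CARD('n)) / 2 - 1) * h x)"
    "l = Dk 2 (real CARD('n)) \<Longrightarrow>
        \<exists>h. harmonic 2 h \<and> (\<forall>x. x \<noteq> 0 \<longrightarrow> u x = norm x powr (Dk 2 (real CARD('n)) / 2 - 2) * h x)"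
    "l = 4 \<Longrightarrow> \<exists>c d. \<forall>x. x \<noteq> 0 \<longrightarrow> u x = c + d * (norm x)\<^sup>2"
    "l < Dk 3 (real CARD('n)) \<Longrightarrow> l \<notin> {0, Dk 1 (real CARD('n)), Dk 2 (real CARD('n)), 4} \<Longrightarrow> u x = 0"
  using assms unfolding mode_def by (simp_all only: not_False_eq_True simp_thms)

lemma eig_add: "eig l u \<Longrightarrow> eig l v \<Longrightarrow> eig l (\<lambda>x. u x + v x)"
  unfolding eig_def using Lop_add by (fastforce simp: distrib_left)

lemma mode_zero: "mode l (\<lambda>x. 0)"
proof -
  have "\<exists>c d. \<forall>x::real^'a. x \<noteq> 0 \<longrightarrow> 0 = c + d * (norm x)\<^sup>2" by (rule exI[of _ 0], rule exI[of _ 0]) simp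
  then show ?thesis
    unfolding mode_def eig_def using Lop_zero by (auto intro!: exI[of _ "\<lambda>x. 0"] harmonic_zero)
qed

lemma mode_add:
  assumes "mode l u" "mode l v" shows "mode l (\<lambda>x. u x + v x)"
  unfolding mode_def
proof (intro conjI impI allI)
  show "eig l (\<lambda>x. u x + v x)" using assms by (simp add: mode_def eig_add)
next
  assume l: "l = 0"
  obtain c d where "\<forall>x. x \<noteq> 0 \<longrightarrow> u x = c" "\<forall>x. x \<noteq> 0 \<longrightarrow> v x = d"
    using modeD(2)[OF assms(1) l] modeD(2)[OF assms(2) l] by auto
  then show "\<exists>c. \<forall>x. x \<noteq> 0 \<longrightarrow> u x + v x = c" by auto
next
  assume l: "l = Dk 1 (real CARD('a))"
  obtain h g where "harmonic 1 h" "\<forall>x. x \<noteq> 0 \<longrightarrow> u x = norm x powr (Dk 1 (real CARD('a)) / 2 - 1) * h x"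
    "harmonic 1 g" "\<forall>x. x \<noteq> 0 \<longrightarrow> v x = norm x powr (Dk 1 (real CARD('a)) / 2 - 1) * g x"
    using modeD(3)[OF assms(1) l] modeD(3)[OF assms(2) l] by auto
  then show "\<exists>h. harmonic 1 h \<and> (\<forall>x. x \<noteq> 0 \<longrightarrow> u x + v x = norm x powr (Dk 1 (real CARD('a)) / 2 - 1) * h x)"
    by (intro exI[of _ "\<lambda>x. h x + g x"]) (simp add: harmonic_add distrib_left)
next
  assume l: "l = Dk 2 (real CARD('a))"
  obtain h g where "harmonic 2 h" "\<forall>x. x \<noteq> 0 \<longrightarrow> u x = norm x powr (Dk 2 (real CARD('a)) / 2 - 2) * h x"
    "harmonic 2 g" "\<forall>x. x \<noteq> 0 \<longrightarrow> v x = norm x powr (Dk 2 (real CARD('a)) / 2 - 2) * g x"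
    using modeD(4)[OF assms(1) l] modeD(4)[OF assms(2) l] by auto
  then show "\<exists>h. harmonic 2 h \<and> (\<forall>x. x \<noteq> 0 \<longrightarrow> u x + v x = norm x powr (Dk 2 (real CARD('a)) / 2 - 2) * h x)"
    by (intro exI[of _ "\<lambda>x. h x + g x"]) (simp add: harmonic_add distrib_left)
next
  assume l: "l = 4"
  obtain c d c' d' where "\<forall>x. x \<noteq> 0 \<longrightarrow> u x = c + d * (norm x)\<^sup>2" "\<forall>x. x \<noteq> 0 \<longrightarrow> v x = c' + d' * (norm x)\<^sup>2"
    using modeD(5)[OF assms(1) l] modeD(5)[OF assms(2) l] by auto
  then show "\<exists>c d. \<forall>x. x \<noteq> 0 \<longrightarrow> u x + v x = c + d * (norm x)\<^sup>2"
    by (intro exI[of _ "c + c'"] exI[of _ "d + d'"]) (simp add: algebra_simps)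
next
  fix x assume "l < Dk 3 (real CARD('a)) \<and> l \<notin> {0, Dk 1 (real CARD('a)), Dk 2 (real CARD('a)), 4}"
  then show "u x + v x = 0" using modeD(6)[OF assms(1)] modeD(6)[OF assms(2)] by simp
qed

text \<open>The index set consists of the eigenvalues themselves. Everything belonging to one
  eigenvalue is collected in one mode, so different summands are orthogonal.\<close>

definition mode_sum :: "(real^'n::finite \<Rightarrow> real) \<Rightarrow> bool" where
  "mode_sum f \<longleftrightarrow> (\<exists>L u. finite L \<and> (\<forall>l. mode l (u l)) \<and> f = (\<lambda>x. \<Sum>l\<in>L. u l x))"

lemma mode_sum_single: assumes "mode l u" shows "mode_sum u"
  unfolding mode_sum_def
  using assms by (intro exI[of _ "{l}"] exI[of _ "\<lambda>k. if k = l then u else (\<lambda>x. 0)"]) (simp add: mode_zero)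

lemma mode_sum_add:
  assumes "mode_sum f" "mode_sum g" shows "mode_sum (\<lambda>x. f x + g x)"
proof -
  obtain L u M v where L: "finite L" "\<And>l. mode l (u l)" "f = (\<lambda>x. \<Sum>l\<in>L. u l x)"
    and M: "finite M" "\<And>l. mode l (v l)" "g = (\<lambda>x. \<Sum>l\<in>M. v l x)"
    using assms unfolding mode_sum_def by blast
  define u' where "u' l x = (if l \<in> L then u l x else 0)" for l x
  define v' where "v' l x = (if l \<in> M then v l x else 0)" for l x
  have m: "mode l (u' l)" "mode l (v' l)" for l
    using L(2) M(2) mode_zero[of l] by (cases "l \<in> L"; cases "l \<in> M"; simp add: u'_def[abs_def] v'_def[abs_def])+
  have "f x + g x = (\<Sum>l\<in>L \<union> M. u' l x + v' l x)" for x
  proof -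
    have "f x = (\<Sum>l\<in>L \<union> M. u' l x)"
      unfolding L(3) u'_def using L(1) M(1) by (simp add: sum.inter_restrict[symmetric] Int_absorb1 Int_commute)
    moreover have "g x = (\<Sum>l\<in>L \<union> M. v' l x)"
      unfolding M(3) v'_def using L(1) M(1) by (simp add: sum.inter_restrict[symmetric] Int_absorb1 Int_commute)
    ultimately show ?thesis by (simp add: sum.distrib)
  qed
  then show ?thesis
    unfolding mode_sum_def using L(1) M(1) m
    by (intro exI[of _ "L \<union> M"] exI[of _ "\<lambda>l x. u' l x + v' l x"]) (simp add: mode_add)
qed

lemma mode_sum_zero: "mode_sum (\<lambda>x. 0)"
  by (rule mode_sum_single[OF mode_zero[of 0]])

lemma mode_sum_sum:
  assumes "\<And>i. i \<in> I \<Longrightarrow> mode_sum (f i)"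
  shows "mode_sum (\<lambda>x. \<Sum>i\<in>I. f i x)"
  using assms
proof (induction I rule: infinite_finite_induct)
  case (insert i I)
  then show ?case using mode_sum_add[of "f i" "\<lambda>x. \<Sum>i\<in>I. f i x"] by simp
qed (simp_all add: mode_sum_zero)

lemma mode_exp_bounded: "mode l u \<Longrightarrow> exp_bounded u"
  using modeD(1) eig_tame tame_exp_bounded by blast

lemma mode_sum_exp_bounded: "mode_sum f \<Longrightarrow> exp_bounded f"
  unfolding mode_sum_def using mode_exp_bounded exp_bounded_sum by fastforce

text \<open>Below \<open>D3\<close> only the pairs (k, i) = (0,0), (1,0), (2,0), (0,1) occur, with
  eigenvalues 0, \<open>D1\<close>, \<open>D2\<close>, 4. These are distinct, so each pair has to
  satisfy just one of the explicit descriptions, which \<open>low\<close> supplies.\<close>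

lemma eig_mode:
  fixes u :: "real^'n::finite \<Rightarrow> real"
  assumes dim: "CARD('n) \<ge> 2" and h: "harmonic k h" and u: "eig (Dk k (real CARD('n)) + 4 * real i) u"
    and low: "i = 0 \<Longrightarrow> \<exists>c. u = (\<lambda>x. c * (norm x powr (Dk k (real CARD('n)) / 2 - real k) * h x))"
      "i = 1 \<Longrightarrow> \<exists>c d. u = (\<lambda>x. c * (norm x powr (Dk k (real CARD('n)) / 2 - real k) * h x)
         + d * (norm x powr (Dk k (real CARD('n)) / 2 - real k + 2) * h x))"
  shows "mode (Dk k (real CARD('n)) + 4 * real i) u"
proof -
  define N where "N = real CARD('n)"
  have N: "N \<ge> 2" using dim by (simp add: N_def)
  note ord = Dk_ordering[OF N]
  define l where "l = Dk k N + 4 * real i"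
  have u: "eig l u" using u by (simp add: l_def N_def)
  consider "k = 0" "i = 0" | "k = 0" "i = 1" | "k = 1" "i = 0" | "k = 2" "i = 0" | "l \<ge> Dk 3 N"
  proof -
    have "l \<ge> Dk 3 N" if "k = 0" "i \<ge> 2"
      using that ord N by (simp add: l_def Dk_0)
    moreover have "l \<ge> Dk 3 N" if "k \<ge> 1" "i \<ge> 1"
      using that ord Dk_mono[OF N that(1)] by (simp add: l_def)
    moreover have "l \<ge> Dk 3 N" if "k \<ge> 3"
      using Dk_mono[OF N that] by (simp add: l_def)
    ultimately show ?thesis using that
      by (metis One_nat_def Suc_1 less_2_cases less_Suc_eq not_less_eq_eq numeral_3_eq_3 not_le le_less_linear)
  qed
  then have "mode l u"
  proof cases
    case 1
    then have l: "l = 0" using N by (simp add: l_def Dk_0)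
    obtain c where "u = (\<lambda>x. c * (norm x powr (Dk k N / 2 - real k) * h x))"
      using low(1) 1 by (auto simp: N_def)
    moreover obtain a where "h = (\<lambda>x. a)"
      using h 1 homogeneous_0_const unfolding harmonic_def by blast
    \<comment> \<open>At the origin \<open>u\<close> is 0 instead, by the convention
      \<open>0 powr 0 = 0\<close>.\<close>
    ultimately have "\<forall>x. x \<noteq> 0 \<longrightarrow> u x = c * a" using 1 N by (simp add: Dk_0)
    then show ?thesis unfolding mode_def N_def[symmetric] using u l ord by auto
  next
    case 2
    then have l: "l = 4" using N by (simp add: l_def Dk_0)
    obtain c d where "u = (\<lambda>x. c * (norm x powr (Dk k N / 2 - real k) * h x)
         + d * (norm x powr (Dk k N / 2 - real k + 2) * h x))"
      using low(2) 2 by (auto simp: N_def)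
    moreover obtain a where "h = (\<lambda>x. a)"
      using h 2 homogeneous_0_const unfolding harmonic_def by blast
    ultimately have "\<forall>x. x \<noteq> 0 \<longrightarrow> u x = c * a + (d * a) * (norm x)\<^sup>2"
      using 2 N by (simp add: Dk_0 algebra_simps)
    then show ?thesis unfolding mode_def N_def[symmetric] using u l ord by auto
  next
    case 3
    then have l: "l = Dk 1 N" by (simp add: l_def)
    obtain c where "u = (\<lambda>x. c * (norm x powr (Dk k N / 2 - real k) * h x))"
      using low(1) 3 by (auto simp: N_def)
    then have "\<exists>h. harmonic 1 h \<and> (\<forall>x. x \<noteq> 0 \<longrightarrow> u x = norm x powr (Dk 1 N / 2 - 1) * h x)"
      using 3 h by (intro exI[of _ "\<lambda>x. c * h x"]) (auto intro: harmonic_cmult)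
    then show ?thesis unfolding mode_def N_def[symmetric] using u l ord by auto
  next
    case 4
    then have l: "l = Dk 2 N" by (simp add: l_def)
    obtain c where "u = (\<lambda>x. c * (norm x powr (Dk k N / 2 - real k) * h x))"
      using low(1) 4 by (auto simp: N_def)
    then have "\<exists>h. harmonic 2 h \<and> (\<forall>x. x \<noteq> 0 \<longrightarrow> u x = norm x powr (Dk 2 N / 2 - 2) * h x)"
      using 4 h by (intro exI[of _ "\<lambda>x. c * h x"]) (auto intro: harmonic_cmult)
    then show ?thesis unfolding mode_def N_def[symmetric] using u l ord by auto
  next
    case 5
    then show ?thesis unfolding mode_def N_def[symmetric] using u ord by auto
  qed
  then show ?thesis by (simp add: l_def N_def)
qed

lemma mode_sum_powr_harmonic:
  fixes h :: "real^'n::finite \<Rightarrow> real"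
  assumes dim: "CARD('n) \<ge> 2" and h: "harmonic k h"
  shows "mode_sum (\<lambda>x. norm x powr (Dk k (real CARD('n)) / 2 - real k + 2 * real m) * h x)"
proof -
  define N where "N = real CARD('n)"
  have N: "N \<ge> 2" using dim by (simp add: N_def)
  define s where "s = Dk k N / 2"
  have s: "s \<ge> 0" "s * (s + real CARD('n)) = real k * (real k + real CARD('n) - 2)"
    using Dk_half[OF N, of k] by (simp_all add: s_def N_def)
  obtain e where e: "\<forall>i\<le>m. eig (2 * s + 4 * real i) (e i)"
    "\<exists>c. e 0 = (\<lambda>x. c * (norm x powr (s - real k + 2 * real 0) * h x))"
    "m \<ge> 1 \<longrightarrow> (\<exists>c d. e 1 = (\<lambda>x. c * (norm x powr (s - real k + 2 * real 0) * h x)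
        + d * (norm x powr (s - real k + 2 * real 1) * h x)))"
    "(\<lambda>x. norm x powr (s - real k + 2 * real m) * h x) = (\<lambda>x. \<Sum>i\<le>m. e i x)"
    using eig_decomposition[OF h s, of m] by blast
  have "mode (Dk k (real CARD('n)) + 4 * real i) (e i)" if "i \<le> m" for i
  proof (rule eig_mode[OF dim h])
    show "eig (Dk k (real CARD('n)) + 4 * real i) (e i)"
      using e(1) that by (simp add: s_def N_def)
    show "\<exists>c. e i = (\<lambda>x. c * (norm x powr (Dk k (real CARD('n)) / 2 - real k) * h x))" if "i = 0"
      using e(2) that by (simp add: s_def N_def)
    show "\<exists>c d. e i = (\<lambda>x. c * (norm x powr (Dk k (real CARD('n)) / 2 - real k) * h x)
         + d * (norm x powr (Dk k (real CARD('n)) / 2 - real k + 2) * h x))" if "i = 1"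
      using e(3) that \<open>i \<le> m\<close> by (simp add: s_def N_def)
  qed
  then have "mode_sum (\<lambda>x. \<Sum>i\<le>m. e i x)"
    by (intro mode_sum_sum) (auto intro: mode_sum_single)
  then show ?thesis using e(4) by (simp add: s_def N_def)
qed

text \<open>Membership in the L^2(nu) closure of the mode sums; \<open>e\<close> bounds the squared
  distance.\<close>

definition approximable :: "(real^'n::finite \<Rightarrow> real) \<Rightarrow> bool" where
  "approximable f \<longleftrightarrow> exp_bounded f \<and>
     (\<forall>e>0. \<exists>u. mode_sum u \<and> bsq (\<lambda>x. f x - u x) < e)"

text \<open>From \<open>(a + b)^2 \<le> 2 a^2 + 2 b^2\<close>. Working with squared distances, it
  plays the part of the triangle inequality; hence the \<open>e / 4\<close> in the proofs that use
  it.\<close>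

lemma bform_add_le:
  assumes "exp_bounded f" "exp_bounded g"
  shows "bsq (\<lambda>x. f x + g x) \<le> 2 * bsq f + 2 * bsq g"
proof -
  have "bsq (\<lambda>x. f x + g x) \<le>
    gint (\<lambda>x. 2 * ((norm x * f x) * (norm x * f x)) + 2 * ((norm x * g x) * (norm x * g x)))"
    unfolding bform_def
  proof (rule gint_mono)
    show "norm x * (f x + g x) * (norm x * (f x + g x))
      \<le> 2 * (norm x * f x * (norm x * f x)) + 2 * (norm x * g x * (norm x * g x))" for x
      using sum_squares_bound[of "norm x * f x" "norm x * g x"] by (simp add: algebra_simps power2_eq_square)
  qed (intro exp_bounded_add exp_bounded_mult exp_bounded_norm exp_bounded_const assms)+
  also have "\<dots> = 2 * bsq f + 2 * bsq g"
    unfolding bform_def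
    by (subst gint_add) (intro exp_bounded_mult exp_bounded_norm exp_bounded_const assms | simp add: gint_cmult)+
  finally show ?thesis .
qed

lemma approximable_limit:
  assumes f: "exp_bounded f"
    and lim: "\<And>e. e > 0 \<Longrightarrow> \<exists>g. approximable g \<and> bsq (\<lambda>x. f x - g x) < e"
  shows "approximable f"
  unfolding approximable_def
proof (intro conjI f allI impI)
  fix e :: real assume e: "e > 0"
  obtain g where g: "approximable g" "bsq (\<lambda>x. f x - g x) < e / 4"
    using lim[of "e / 4"] e by auto
  obtain u where u: "mode_sum u" "bsq (\<lambda>x. g x - u x) < e / 4"
    using g(1) e unfolding approximable_def by (metis divide_pos_pos zero_less_numeral)
  have "bsq (\<lambda>x. (f x - g x) + (g x - u x)) \<le>
    2 * bsq (\<lambda>x. f x - g x) + 2 * bsq (\<lambda>x. g x - u x)"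
    using f g(1) u(1) by (intro bform_add_le exp_bounded_diff) (auto simp: approximable_def mode_sum_exp_bounded)
  then show "\<exists>u. mode_sum u \<and> bsq (\<lambda>x. f x - u x) < e"
    using g(2) u by (intro exI[of _ u]) simp
qed

lemma bform_zero: "bsq (\<lambda>x. 0) = 0"
  by (simp add: bform_def gint_def)

lemma mode_sum_approximable: "mode_sum f \<Longrightarrow> approximable f"
  unfolding approximable_def by (auto simp: mode_sum_exp_bounded bform_zero intro!: exI[of _ f])

lemma approximable_add:
  assumes "approximable f" "approximable g" shows "approximable (\<lambda>x. f x + g x)"
  unfolding approximable_def
proof (intro conjI allI impI)
  show "exp_bounded (\<lambda>x. f x + g x)" using assms by (auto simp: approximable_def)
  fix e :: real assume e: "e > 0"
  obtain u where u: "mode_sum u" "bsq (\<lambda>x. f x - u x) < e / 4"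
    using assms(1) e unfolding approximable_def by (metis divide_pos_pos zero_less_numeral)
  obtain v where v: "mode_sum v" "bsq (\<lambda>x. g x - v x) < e / 4"
    using assms(2) e unfolding approximable_def by (metis divide_pos_pos zero_less_numeral)
  have "bsq (\<lambda>x. (f x - u x) + (g x - v x)) \<le>
    2 * bsq (\<lambda>x. f x - u x) + 2 * bsq (\<lambda>x. g x - v x)"
    using assms u(1) v(1) by (intro bform_add_le exp_bounded_diff) (auto simp: approximable_def mode_sum_exp_bounded)
  moreover have "(\<lambda>x. (f x - u x) + (g x - v x)) = (\<lambda>x. f x + g x - (u x + v x))" by (simp add: fun_eq_iff)
  ultimately show "\<exists>w. mode_sum w \<and> bsq (\<lambda>x. f x + g x - w x) < e"
    using u v by (intro exI[of _ "\<lambda>x. u x + v x"]) (simp add: mode_sum_add)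
qed

lemma approximable_sum:
  assumes "\<And>i. i \<in> I \<Longrightarrow> approximable (f i)"
  shows "approximable (\<lambda>x. \<Sum>i\<in>I. f i x)"
  using assms
proof (induction I rule: infinite_finite_induct)
  case (insert i I)
  then show ?case using approximable_add[of "f i" "\<lambda>x. \<Sum>i\<in>I. f i x"] by simp
qed (simp_all add: mode_sum_approximable mode_sum_zero)

text \<open>This reconciles the convention \<open>0 powr a = 0\<close> with functions that are
  continuous at the origin.\<close>

lemma approximable_cong:
  fixes f g :: "real^'n::finite \<Rightarrow> real"
  assumes f: "approximable f" and g: "exp_bounded g" and fg: "\<And>x. x \<noteq> 0 \<Longrightarrow> f x = g x"
  shows "approximable g"
proof (rule approximable_limit[OF g])
  fix e :: real assume "e > 0"
  moreover have "bsq (\<lambda>x. g x - f x) = gint (\<lambda>x::real^'n. 0)"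
    unfolding bform_def
  proof (rule gint_cong)
    have "exp_bounded f" using f by (simp add: approximable_def)
    then show "(\<lambda>x. norm x * (g x - f x) * (norm x * (g x - f x))) \<in> borel_measurable borel"
      by (intro exp_bounded_measurable exp_bounded_mult exp_bounded_diff exp_bounded_norm g)
  qed (use fg in auto)
  ultimately show "\<exists>f. approximable f \<and> bsq (\<lambda>x. g x - f x) < e"
    using f by (intro exI[of _ f]) (simp add: gint_def)
qed

section \<open>Density of the eigenfunctions\<close>

lemma mode_cmult:
  assumes "mode l u" shows "mode l (\<lambda>x. c * u x)"
  unfolding mode_def
proof (intro conjI impI allI)
  show "eig l (\<lambda>x. c * u x)"
    using Lop_cmult modeD(1)[OF assms] unfolding eig_def by (fastforce simp: mult.left_commute)
next
  assume l: "l = 0"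
  then show "\<exists>d. \<forall>x. x \<noteq> 0 \<longrightarrow> c * u x = d" using modeD(2)[OF assms l] by auto
next
  assume l: "l = Dk 1 (real CARD('a))"
  obtain h where "harmonic 1 h" "\<forall>x. x \<noteq> 0 \<longrightarrow> u x = norm x powr (Dk 1 (real CARD('a)) / 2 - 1) * h x"
    using modeD(3)[OF assms l] by auto
  then show "\<exists>h. harmonic 1 h \<and> (\<forall>x. x \<noteq> 0 \<longrightarrow> c * u x = norm x powr (Dk 1 (real CARD('a)) / 2 - 1) * h x)"
    by (intro exI[of _ "\<lambda>x. c * h x"]) (simp add: harmonic_cmult)
next
  assume l: "l = Dk 2 (real CARD('a))"
  obtain h where "harmonic 2 h" "\<forall>x. x \<noteq> 0 \<longrightarrow> u x = norm x powr (Dk 2 (real CARD('a)) / 2 - 2) * h x"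
    using modeD(4)[OF assms l] by auto
  then show "\<exists>h. harmonic 2 h \<and> (\<forall>x. x \<noteq> 0 \<longrightarrow> c * u x = norm x powr (Dk 2 (real CARD('a)) / 2 - 2) * h x)"
    by (intro exI[of _ "\<lambda>x. c * h x"]) (simp add: harmonic_cmult)
next
  assume l: "l = 4"
  obtain a b where "\<forall>x. x \<noteq> 0 \<longrightarrow> u x = a + b * (norm x)\<^sup>2" using modeD(5)[OF assms l] by auto
  then show "\<exists>a b. \<forall>x. x \<noteq> 0 \<longrightarrow> c * u x = a + b * (norm x)\<^sup>2"
    by (intro exI[of _ "c * a"] exI[of _ "c * b"]) (simp add: algebra_simps)
next
  fix x assume "l < Dk 3 (real CARD('a)) \<and> l \<notin> {0, Dk 1 (real CARD('a)), Dk 2 (real CARD('a)), 4}"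
  then show "c * u x = 0" using modeD(6)[OF assms] by simp
qed

lemma mode_sum_cmult: "mode_sum f \<Longrightarrow> mode_sum (\<lambda>x. c * f x)"
proof -
  assume "mode_sum f"
  then obtain L u where L: "finite L" "\<And>l. mode l (u l)" "f = (\<lambda>x. \<Sum>l\<in>L. u l x)"
    unfolding mode_sum_def by blast
  have "mode l (\<lambda>x. c * u l x)" for l
    by (rule mode_cmult[OF L(2)])
  then show ?thesis
    unfolding mode_sum_def L(3) using L(1)
    by (intro exI[of _ L] exI[of _ "\<lambda>l x. c * u l x"]) (simp add: sum_distrib_left)
qed

lemma approximable_cmult:
  assumes "approximable f" shows "approximable (\<lambda>x. c * f x)"
  unfolding approximable_def
proof (intro conjI allI impI)
  show "exp_bounded (\<lambda>x. c * f x)" using assms by (auto simp: approximable_def)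
  fix e :: real assume e: "e > 0"
  \<comment> \<open>The summand 1 covers \<open>c = 0\<close>.\<close>
  define e' where "e' = e / (c\<^sup>2 + 1)"
  have c1: "c\<^sup>2 + 1 > 0" by (simp add: add_nonneg_pos)
  then have "e' > 0" using e by (simp add: e'_def)
  then obtain u where u: "mode_sum u" "bsq (\<lambda>x. f x - u x) < e'"
    using assms unfolding approximable_def by blast
  have "bsq (\<lambda>x. c * f x - c * u x) = c\<^sup>2 * bsq (\<lambda>x. f x - u x)"
    unfolding bform_def gint_cmult[symmetric] by (simp add: power2_eq_square algebra_simps)
  also have "\<dots> \<le> c\<^sup>2 * e'" using u(2) by (intro mult_left_mono) auto
  also have "\<dots> < (c\<^sup>2 + 1) * e'" using \<open>e' > 0\<close> by (simp add: algebra_simps)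
  also have "\<dots> = e" using c1 by (simp add: e'_def)
  finally show "\<exists>u. mode_sum u \<and> bsq (\<lambda>x. c * f x - u x) < e"
    using mode_sum_cmult[OF u(1), of c] by blast
qed

lemma exp_sums_divide_fact: "(\<lambda>i. y ^ i / fact i) sums exp (y::real)"
  using exp_converges[of y] by (simp add: divide_inverse mult.commute)

text \<open>Crude but uniform in \<open>n\<close>, as dominated convergence requires.\<close>

lemma exp_taylor_remainder_bound:
  fixes y :: real
  assumes "y \<ge> 0"
  shows "\<bar>exp (- y) - (\<Sum>i<n. (- y) ^ i / fact i)\<bar> \<le> 2 * exp y"
proof -
  have "\<bar>\<Sum>i<n. (- y) ^ i / fact i\<bar> \<le> (\<Sum>i<n. y ^ i / fact i)"
    by (rule order_trans[OF sum_abs]) (simp add: power_abs assms)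
  also have "\<dots> \<le> exp y"
  proof -
    have "(\<lambda>i. y ^ i / fact i) sums exp y"
      by (rule exp_sums_divide_fact)
    then show ?thesis
      using assms sum_le_suminf[of "\<lambda>i. y ^ i / fact i" "{..<n}"] by (auto simp: sums_iff)
  qed
  moreover have "exp (- y) \<le> exp y" using assms by simp
  ultimately show ?thesis using exp_gt_zero[of "- y"] by linarith
qed

lemma exp_bounded_gauss_mult:
  assumes w: "exp_bounded w" and c: "c \<ge> 0"
  shows "exp_bounded (\<lambda>x. exp (- (c * (norm x)\<^sup>2)) * w x)"
proof (rule exp_bounded_mono[OF w])
  show "(\<lambda>x. exp (- (c * (norm x)\<^sup>2)) * w x) \<in> borel_measurable borel"
    using exp_bounded_measurable[OF w] by measurable
  show "\<bar>exp (- (c * (norm x)\<^sup>2)) * w x\<bar> \<le> \<bar>w x\<bar>" for x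
    using c by (simp add: abs_mult mult_left_le_one_le)
qed

text \<open>\<open>exp(-t/4)\<close> is expanded in its Taylor series, which converges in \<open>L^2(\<nu>)\<close> by dominated
  convergence since \<open>(exp(t/4))^2\<close> is integrable against \<open>exp(-t)\<close>, \<open>t = |x|^2\<close>.\<close>

lemma approximable_exp_step:
  fixes w :: "real^'n::finite \<Rightarrow> real"
  assumes w: "exp_bounded w" and ap: "\<And>i. approximable (\<lambda>x. (norm x) ^ (2 * i) * w x)"
  shows "approximable (\<lambda>x. exp (- (norm x)\<^sup>2 / 4) * w x)"
proof (rule approximable_limit)
  show eb: "exp_bounded (\<lambda>x. exp (- (norm x)\<^sup>2 / 4) * w x)"
    using exp_bounded_gauss_mult[OF w, of "1/4"] by simp
  define g where "g n x = (\<Sum>i<n. ((- 1 / 4) ^ i / fact i) * ((norm x) ^ (2 * i) * w x))" for n and x :: "real^'n"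
  have g: "approximable (g n)" for n
    unfolding g_def by (rule approximable_sum, rule approximable_cmult, rule ap)
  define R where "R n t = exp (- t / 4) - (\<Sum>i<n. (- t / 4) ^ i / fact i)" for n and t :: real
  have diff: "exp (- (norm x)\<^sup>2 / 4) * w x - g n x = R n ((norm x)\<^sup>2) * w x" for n and x :: "real^'n"
  proof -
    have "(- 1 / 4) ^ i / fact i * (norm x ^ (2 * i) * w x) = ((- (norm x)\<^sup>2 / 4) ^ i / fact i) * w x" for i
    proof -
      have "(- (norm x)\<^sup>2 / 4) ^ i = ((- 1 / 4) * (norm x)\<^sup>2) ^ i" by simp
      also have "\<dots> = (- 1 / 4) ^ i * norm x ^ (2 * i)" by (simp only: power_mult_distrib power_mult)
      finally show ?thesis by simp
    qed
    then have "g n x = (\<Sum>i<n. ((- (norm x)\<^sup>2 / 4) ^ i / fact i) * w x)"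
      unfolding g_def by (intro sum.cong refl)
    then show ?thesis unfolding R_def by (simp only: left_diff_distrib sum_distrib_right)
  qed
  have [measurable]: "w \<in> borel_measurable borel" using w by auto
  have [measurable]: "R n \<in> borel_measurable borel" for n unfolding R_def by measurable
  have Rb: "\<bar>R n t\<bar> \<le> 2 * exp (t / 4)" if "t \<ge> 0" for n t
    using exp_taylor_remainder_bound[of "t / 4" n] that by (simp add: R_def)
  have "(\<lambda>n. LINT x|lborel. exp (- (norm x)\<^sup>2) * ((norm x * (R n ((norm x)\<^sup>2) * w x)) * (norm x * (R n ((norm x)\<^sup>2) * w x))))
     \<longlonglongrightarrow> (LINT x::real^'n|lborel. 0)"
  \<comment> \<open>The squared remainder bound is \<open>4 exp (|x|^2 / 2)\<close>, which leaves
    \<open>exp (- |x|^2 / 2)\<close> of the weight. Any rate below 1/2 in place of 1/4 would leave a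
    decaying Gaussian.\<close>
  proof (rule integral_dominated_convergence[where w = "\<lambda>x. 4 * (exp (- (1/2) * (norm x)\<^sup>2) * ((norm x * w x) * (norm x * w x)))"])
    show "integrable lborel (\<lambda>x. 4 * (exp (- (1/2) * (norm x)\<^sup>2) * ((norm x * w x) * (norm x * w x))))"
      by (intro integrable_mult_right integrable_gauss exp_bounded_mult w exp_bounded_norm) simp
    show "AE x in lborel. (\<lambda>n. exp (- (norm x)\<^sup>2) * ((norm x * (R n ((norm x)\<^sup>2) * w x)) * (norm x * (R n ((norm x)\<^sup>2) * w x))))
       \<longlonglongrightarrow> 0"
    proof (rule AE_I2)
      fix x :: "real^'n"
      have "(\<lambda>n. R n t) \<longlonglongrightarrow> 0" for t
      proof -
        have "(\<lambda>i. (- t / 4) ^ i / fact i) sums exp (- t / 4)"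
          by (rule exp_sums_divide_fact)
        then have "(\<lambda>n. \<Sum>i<n. (- t / 4) ^ i / fact i) \<longlonglongrightarrow> exp (- t / 4)"
          by (simp add: sums_def)
        from tendsto_diff[OF tendsto_const[of "exp (- t / 4)"] this] show ?thesis by (simp add: R_def)
      qed
      then have A: "(\<lambda>n. norm x * (R n ((norm x)\<^sup>2) * w x)) \<longlonglongrightarrow> 0"
        by (intro tendsto_mult_right_zero tendsto_mult_left_zero)
      show "(\<lambda>n. exp (- (norm x)\<^sup>2) * ((norm x * (R n ((norm x)\<^sup>2) * w x)) * (norm x * (R n ((norm x)\<^sup>2) * w x)))) \<longlonglongrightarrow> 0"
        by (rule tendsto_mult_right_zero[OF tendsto_mult_zero[OF A A]])
    qed
    show "AE x in lborel. norm (exp (- (norm x)\<^sup>2) * ((norm x * (R n ((norm x)\<^sup>2) * w x)) * (norm x * (R n ((norm x)\<^sup>2) * w x))))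
       \<le> 4 * (exp (- (1/2) * (norm x)\<^sup>2) * ((norm x * w x) * (norm x * w x)))" for n
    proof (rule AE_I2)
      fix x :: "real^'n"
      define t where "t = (norm x)\<^sup>2"
      have "\<bar>R n t\<bar> * \<bar>R n t\<bar> \<le> (2 * exp (t / 4)) * (2 * exp (t / 4))"
        using Rb[of t n] by (intro mult_mono) (auto simp: t_def)
      also have "\<dots> = 4 * exp (t / 2)" by (simp add: exp_add[symmetric])
      finally have R2: "R n t * R n t \<le> 4 * exp (t / 2)" by simp
      have "norm (exp (- t) * ((norm x * (R n t * w x)) * (norm x * (R n t * w x))))
        = exp (- t) * (((norm x * w x) * (norm x * w x)) * (R n t * R n t))"
        by (simp add: abs_mult algebra_simps)
      also have "\<dots> \<le> exp (- t) * (((norm x * w x) * (norm x * w x)) * (4 * exp (t / 2)))"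
        by (intro mult_left_mono R2) auto
      also have "\<dots> = 4 * ((exp (- t) * exp (t / 2)) * ((norm x * w x) * (norm x * w x)))" by (simp add: algebra_simps)
      also have "exp (- t) * exp (t / 2) = exp (- (1/2) * t)" by (simp add: exp_add[symmetric])
      finally show "norm (exp (- (norm x)\<^sup>2) * ((norm x * (R n ((norm x)\<^sup>2) * w x)) * (norm x * (R n ((norm x)\<^sup>2) * w x))))
       \<le> 4 * (exp (- (1/2) * (norm x)\<^sup>2) * ((norm x * w x) * (norm x * w x)))" by (simp only: t_def)
    qed
  qed measurable
  then have lim: "(\<lambda>n. bsq (\<lambda>x. exp (- (norm x)\<^sup>2 / 4) * w x - g n x)) \<longlonglongrightarrow> 0"
    unfolding diff bform_def gint_def by simp
  fix e :: real assume "e > 0"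
  then obtain n where "bsq (\<lambda>x. exp (- (norm x)\<^sup>2 / 4) * w x - g n x) < e"
    using order_tendstoD(2)[OF lim] by (auto simp: eventually_sequentially)
  then show "\<exists>g. approximable g \<and>
      bsq (\<lambda>x. exp (- (norm x)\<^sup>2 / 4) * w x - g x) < e"
    using g by (intro exI[of _ "g n"]) simp
qed

text \<open>The exponentials are introduced one factor at a time. Expanding
  \<open>exp (- j t / 4)\<close> at once would lead to the bound \<open>exp (j t / 2)\<close>, not
  integrable against \<open>exp (- t)\<close> for \<open>j \<ge> 2\<close>. All powers |x|^(2i) are
  kept in the claim because the next step consumes them.\<close>

lemma approximable_radial_exp:
  fixes w :: "real^'n::finite \<Rightarrow> real"
  assumes w: "exp_bounded w" and ap: "\<And>i. approximable (\<lambda>x. (norm x) ^ (2 * i) * w x)"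
  shows "approximable (\<lambda>x. (norm x) ^ (2 * i) * (exp (- (norm x)\<^sup>2 / 4) ^ j * w x))"
proof (induction j arbitrary: i)
  case 0
  then show ?case using ap by simp
next
  case (Suc j)
  have eb: "exp_bounded (\<lambda>x. exp (- (norm x)\<^sup>2 / 4) ^ j * w x)"
  proof -
    have "exp (- (norm x)\<^sup>2 / 4) ^ j = exp (- ((real j / 4) * (norm x)\<^sup>2))" for x :: "real^'n"
      by (simp add: exp_of_nat_mult[symmetric])
    then show ?thesis using exp_bounded_gauss_mult[OF w, of "real j / 4"] by simp
  qed
  have "approximable (\<lambda>x. exp (- (norm x)\<^sup>2 / 4) * (norm x ^ (2 * i) * (exp (- (norm x)\<^sup>2 / 4) ^ j * w x)))"
  proof (rule approximable_exp_step)
    show "exp_bounded (\<lambda>x. norm x ^ (2 * i) * (exp (- (norm x)\<^sup>2 / 4) ^ j * w x))"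
      by (intro exp_bounded_mult exp_bounded_power exp_bounded_norm eb)
    show "approximable (\<lambda>x. norm x ^ (2 * m) * (norm x ^ (2 * i) * (exp (- (norm x)\<^sup>2 / 4) ^ j * w x)))" for m
      using Suc[of "m + i"] by (simp add: power_add distrib_left mult.assoc)
  qed
  then show ?case by (simp add: mult.left_commute mult.assoc)
qed

lemma bform_le_of_bound:
  assumes f: "exp_bounded f" and w: "exp_bounded w" and b: "\<And>x. \<bar>f x\<bar> \<le> c * \<bar>w x\<bar>"
  shows "bsq f \<le> c\<^sup>2 * bsq w"
  unfolding bform_def gint_cmult[symmetric]
proof (rule gint_mono)
  show "norm x * f x * (norm x * f x) \<le> c\<^sup>2 * (norm x * w x * (norm x * w x))" for x
  proof -
    have "(f x)\<^sup>2 \<le> (c * \<bar>w x\<bar>)\<^sup>2" using b[of x] by (metis abs_ge_zero power2_abs power_mono)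
    then have "(norm x)\<^sup>2 * (f x)\<^sup>2 \<le> (norm x)\<^sup>2 * (c * \<bar>w x\<bar>)\<^sup>2" by (intro mult_left_mono) auto
    then show ?thesis by (simp add: power2_eq_square algebra_simps)
  qed
qed (intro exp_bounded_mult exp_bounded_norm exp_bounded_const f w)+

text \<open>A pointwise error \<open>d * \<bar>w x\<bar>\<close> costs at most
  \<open>d^2 * bsq w\<close>, so a uniform approximation of a bounded factor may be multiplied by an
  unbounded \<open>w\<close>.\<close>

lemma approximable_uniform_limit:
  assumes f: "exp_bounded f" and w: "exp_bounded w"
    and lim: "\<And>d. d > 0 \<Longrightarrow> \<exists>g. approximable g \<and> (\<forall>x. \<bar>f x - g x\<bar> \<le> d * \<bar>w x\<bar>)"
  shows "approximable f"
proof (rule approximable_limit[OF f])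
  fix e :: real assume e: "e > 0"
  have K: "bsq w \<ge> 0" unfolding bform_def by (rule gint_nonneg) simp
  define d where "d = sqrt (e / (bsq w + 1)) / 2"
  have "d > 0" using e K by (simp add: d_def)
  then obtain g where g: "approximable g" "\<And>x. \<bar>f x - g x\<bar> \<le> d * \<bar>w x\<bar>" using lim by blast
  have "bsq (\<lambda>x. f x - g x) \<le> d\<^sup>2 * bsq w"
    using f g w by (intro bform_le_of_bound) (auto simp: approximable_def)
  also have "d\<^sup>2 * bsq w = e * (bsq w / (4 * (bsq w + 1)))"
    using e K by (simp add: d_def power_divide)
  also have "\<dots> < e * 1" using e K by (intro mult_strict_left_mono) auto
  finally show "\<exists>g. approximable g \<and> bsq (\<lambda>x. f x - g x) < e" using g(1) by auto
qed

lemma exp_bounded_bounded_mult: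
  assumes "\<And>x. \<bar>f x\<bar> \<le> B" "f \<in> borel_measurable borel" "exp_bounded w"
  shows "exp_bounded (\<lambda>x. f x * w x)"
proof (rule exp_bounded_mult[OF _ assms(3)])
  show "exp_bounded f"
    by (rule exp_boundedI[where C = B and a = 0]) (use assms in auto)
qed

text \<open>The substitution \<open>y = exp (- t / 4)\<close> maps \<open>[0, \<infinity>)\<close>
  onto \<open>(0, 1]\<close>. As \<open>\<psi>\<close> vanishes for large \<open>t\<close>, it
  becomes a continuous function of \<open>y\<close> on the compact interval \<open>[0, 1]\<close>,
  where Weierstrass applies.\<close>

lemma approximable_radial:
  fixes w :: "real^'n::finite \<Rightarrow> real"
  assumes w: "exp_bounded w" and ap: "\<And>i. approximable (\<lambda>x. (norm x) ^ (2 * i) * w x)"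
    and \<psi>: "continuous_on {0..} \<psi>" "\<And>t. t \<ge> R \<Longrightarrow> \<psi> t = 0" and R: "R \<ge> 0"
  shows "approximable (\<lambda>x. \<psi> ((norm x)\<^sup>2) * w x)"
proof -
  define y0 where "y0 = exp (- R / 4)"
  \<comment> \<open>The maximum keeps the logarithm away from 0 and changes nothing: for
    \<open>y\<close> below \<open>y0\<close>, the image of \<open>R\<close>, the value is
    \<open>\<psi> R = 0\<close>.\<close>
  define f where "f y = \<psi> (- 4 * ln (max y y0))" for y
  have y0: "y0 > 0" "y0 \<le> 1" using R by (auto simp: y0_def)
  have "continuous_on {0..1} f"
    unfolding f_def
  proof (rule continuous_on_compose2[OF \<psi>(1)])
    show "continuous_on {0..1} (\<lambda>y. - 4 * ln (max y y0))"
      using y0 by (intro continuous_intros) (auto simp: max_def)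
    show "(\<lambda>y. - 4 * ln (max y y0)) ` {0..1} \<subseteq> {0..}"
      using y0 by auto
  qed
  have f_exp: "f (exp (- t / 4)) = \<psi> t" if "t \<ge> 0" for t
  proof (cases "t \<le> R")
    case True
    then have "max (exp (- t / 4)) y0 = exp (- t / 4)" by (simp add: y0_def)
    then show ?thesis by (simp add: f_def)
  next
    case False
    then have "max (exp (- t / 4)) y0 = exp (- R / 4)" by (simp add: y0_def)
    then show ?thesis using False \<psi>(2)[of R] \<psi>(2)[of t] by (simp add: f_def)
  qed
  have "bounded (f ` {0..1})"
    by (intro compact_imp_bounded compact_continuous_image \<open>continuous_on {0..1} f\<close>) simp
  then obtain B where "\<forall>z\<in>f ` {0..1}. norm z \<le> B" unfolding bounded_iff by blast
  then have B: "\<bar>\<psi> t\<bar> \<le> B" if "t \<ge> 0" for t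
    using f_exp[OF that] that by (metis abs_exp_cancel atLeastAtMost_iff exp_ge_zero exp_le_one_iff
        image_eqI real_norm_def divide_nonpos_pos neg_le_0_iff_le zero_less_numeral)
  have cont: "continuous_on UNIV (\<lambda>x::real^'n. \<psi> ((norm x)\<^sup>2))"
    by (rule continuous_on_compose2[OF \<psi>(1)]) (auto intro!: continuous_intros)
  have eb: "exp_bounded (\<lambda>x. \<psi> ((norm x)\<^sup>2) * w x)"
  proof (rule exp_bounded_bounded_mult[OF _ borel_measurable_continuous_onI[OF cont] w])
    show "\<bar>\<psi> ((norm x)\<^sup>2)\<bar> \<le> B" for x :: "real^'n" by (simp add: B)
  qed
  show ?thesis
  proof (rule approximable_uniform_limit[OF eb w])
    fix d :: real assume d: "d > 0"
    obtain q where q: "real_polynomial_function q" "\<And>y. y \<in> {0..1} \<Longrightarrow> \<bar>f y - q y\<bar> < d"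
      using Stone_Weierstrass_real_polynomial_function[OF _ \<open>continuous_on {0..1} f\<close> d] by auto
    obtain a n where a: "q = (\<lambda>y. \<Sum>j\<le>n. a j * y ^ j)"
      using q(1) real_polynomial_function_iff_sum by blast
    define g where "g x = q (exp (- (norm x)\<^sup>2 / 4)) * w x" for x :: "real^'n"
    have "g = (\<lambda>x. \<Sum>j\<le>n. a j * (norm x ^ (2 * 0) * (exp (- (norm x)\<^sup>2 / 4) ^ j * w x)))"
      unfolding g_def[abs_def] a by (simp add: sum_distrib_right mult.assoc)
    moreover have "approximable (\<lambda>x. \<Sum>j\<le>n. a j * (norm x ^ (2 * 0) * (exp (- (norm x)\<^sup>2 / 4) ^ j * w x)))"
      by (intro approximable_sum approximable_cmult approximable_radial_exp w ap)
    ultimately have "approximable g" by simp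
    moreover have "\<bar>\<psi> ((norm x)\<^sup>2) * w x - g x\<bar> \<le> d * \<bar>w x\<bar>" for x
    proof -
      have "\<bar>f (exp (- (norm x)\<^sup>2 / 4)) - q (exp (- (norm x)\<^sup>2 / 4))\<bar> < d"
        by (rule q(2)) simp
      then have "\<bar>\<psi> ((norm x)\<^sup>2) - q (exp (- (norm x)\<^sup>2 / 4))\<bar> * \<bar>w x\<bar> \<le> d * \<bar>w x\<bar>"
        using f_exp[of "(norm x)\<^sup>2"] by (intro mult_right_mono) auto
      then show ?thesis by (simp add: g_def abs_mult[symmetric] left_diff_distrib)
    qed
    ultimately show "\<exists>g. approximable g \<and> (\<forall>x. \<bar>\<psi> ((norm x)\<^sup>2) * w x - g x\<bar> \<le> d * \<bar>w x\<bar>)" by blast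
  qed
qed

text \<open>Split off the lowest eigenfunction \<open>w = |x|^(s-k) h\<close>, whose products with
  even powers of |x| are mode sums, and move the excess power |x|^(k-s) into the radial factor
  \<open>\<psi>\<close>; it is continuous at 0 because \<open>s < k\<close> for
  \<open>k \<ge> 1\<close>.\<close>

lemma approximable_harmonic_cutoff:
  fixes h :: "real^'n::finite \<Rightarrow> real"
  assumes dim: "CARD('n) \<ge> 2" and h: "harmonic k h"
    and \<theta>: "continuous_on {0..} \<theta>" "\<And>t. t \<ge> R \<Longrightarrow> \<theta> t = 0" and R: "R \<ge> 0"
  shows "approximable (\<lambda>x. \<theta> ((norm x)\<^sup>2) * (norm x ^ (2 * j) * h x))"
proof -
  define N where "N = real CARD('n)"
  have N: "N \<ge> 2" using dim by (simp add: N_def)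
  define s where "s = Dk k N / 2"
  define w where "w x = norm x powr (s - real k) * h x" for x
  \<comment> \<open>For \<open>k = 0\<close> the exponent is 0, and \<open>0 powr 0 = 0\<close>
    could make \<open>\<psi>\<close> jump at 0.\<close>
  define \<psi> where "\<psi> t = \<theta> t * (t ^ j * (if k = 0 then 1 else t powr ((real k - s) / 2)))" for t
  have ap: "approximable (\<lambda>x. norm x ^ (2 * i) * w x)" for i
  proof -
    have "norm x powr (s - real k + 2 * real i) * h x = norm x ^ (2 * i) * w x" for x
    proof (cases "x = 0")
      case False
      then have "norm x powr (2 * real i) = norm x ^ (2 * i)"
        using powr_realpow[of "norm x" "2 * i"] by simp
      then show ?thesis by (simp add: w_def powr_add)
    qed (simp add: w_def)
    then show ?thesis
      using mode_sum_approximable[OF mode_sum_powr_harmonic[OF dim h, of i]] by (simp add: s_def N_def)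
  qed
  have wb: "exp_bounded w" using ap[of 0] by (simp add: approximable_def)
  have "approximable (\<lambda>x. \<psi> ((norm x)\<^sup>2) * w x)"
  proof (rule approximable_radial[OF wb ap _ _ R])
    have "s < real k" if "k \<noteq> 0" using Dk_half_less[OF N, of k] that by (simp add: s_def)
    then show "continuous_on {0..} \<psi>"
      unfolding \<psi>_def using \<theta>(1)
      by (cases "k = 0") (auto intro!: continuous_intros continuous_on_powr')
    show "\<psi> t = 0" if "t \<ge> R" for t using \<theta>(2)[OF that] by (simp add: \<psi>_def)
  qed
  then show ?thesis
  proof (rule approximable_cong)
    have hb: "exp_bounded h"
    proof -
      \<comment> \<open>This function is 0 at the origin, again by \<open>0 powr 0 = 0\<close>, so
        the value \<open>h 0\<close> is added separately.\<close>
      have "exp_bounded (\<lambda>x. norm x powr 0 * h x)"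
        using h by (intro exp_bounded_powr_mult[of 0 k] polynomial_measurable polynomial_continuous_on)
          (auto simp: harmonic_def homogeneous_def)
      moreover have "exp_bounded (\<lambda>x. if x = 0 then h 0 else 0)"
        by (rule exp_boundedI[where C = "\<bar>h 0\<bar>" and a = 0]) auto
      ultimately have "exp_bounded (\<lambda>x. norm x powr 0 * h x + (if x = 0 then h 0 else 0))"
        by (rule exp_bounded_add)
      moreover have "(\<lambda>x. norm x powr 0 * h x + (if x = 0 then h 0 else 0)) = h" by auto
      ultimately show ?thesis by simp
    qed
    have "bounded (\<theta> ` {0..R})"
      by (intro compact_imp_bounded compact_continuous_image continuous_on_subset[OF \<theta>(1)]) auto
    then obtain B where "\<forall>z\<in>\<theta> ` {0..R}. norm z \<le> B" unfolding bounded_iff by blast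
    then have B: "\<bar>\<theta> t\<bar> \<le> \<bar>B\<bar>" if "t \<ge> 0" for t
      using \<theta>(2)[of t] that by (cases "t \<le> R") force+
    have cont: "continuous_on UNIV (\<lambda>x::real^'n. \<theta> ((norm x)\<^sup>2))"
      by (rule continuous_on_compose2[OF \<theta>(1)]) (auto intro!: continuous_intros)
    show "exp_bounded (\<lambda>x. \<theta> ((norm x)\<^sup>2) * (norm x ^ (2 * j) * h x))"
    proof (rule exp_bounded_bounded_mult[OF _ borel_measurable_continuous_onI[OF cont]])
      show "\<bar>\<theta> ((norm x)\<^sup>2)\<bar> \<le> \<bar>B\<bar>" for x :: "real^'n" by (simp add: B)
    qed (intro exp_bounded_mult exp_bounded_power exp_bounded_norm hb)
    fix x :: "real^'n" assume x: "x \<noteq> 0"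
    have "((norm x)\<^sup>2) powr ((real k - s) / 2) * norm x powr (s - real k) = 1"
    proof -
      have "((norm x)\<^sup>2) powr ((real k - s) / 2) = norm x powr (real k - s)"
      proof -
        have "(norm x powr 2) powr ((real k - s) / 2) = norm x powr (real k - s)"
        proof -
          have "2 * ((real k - s) / 2) = real k - s" by (simp add: field_simps)
          then show ?thesis by (simp only: powr_powr)
        qed
        then show ?thesis using x by (simp add: powr_numeral)
      qed
      then show ?thesis using x by (simp add: powr_add[symmetric])
    qed
    then have one: "((norm x)\<^sup>2) powr ((real k - s) / 2) * (norm x powr (s - real k) * z) = z" for z
      by (simp only: mult.assoc[symmetric] mult_1)
    show "\<psi> ((norm x)\<^sup>2) * w x = \<theta> ((norm x)\<^sup>2) * (norm x ^ (2 * j) * h x)"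
    proof (cases "k = 0")
      case True
      then have "s = 0" using N by (simp add: s_def Dk_0)
      then show ?thesis using True x by (simp add: \<psi>_def w_def power_mult)
    next
      case False
      then show ?thesis by (simp only: \<psi>_def w_def power_mult mult.assoc one if_False)
    qed
  qed
qed

lemma approximable_polynomial_cutoff:
  fixes p :: "real^'n::finite \<Rightarrow> real"
  assumes dim: "CARD('n) \<ge> 2" and p: "real_polynomial_function p"
    and \<theta>: "continuous_on {0..} \<theta>" "\<And>t. t \<ge> R \<Longrightarrow> \<theta> t = 0" and R: "R \<ge> 0"
  shows "approximable (\<lambda>x. \<theta> ((norm x)\<^sup>2) * p x)"
  using polynomial_harmonic_span[OF dim p]
proof (induction rule: harmonic_span.induct)
  case (base k h j)
  show ?case by (rule approximable_harmonic_cutoff[OF dim base \<theta> R])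
next
  case (add f g)
  then show ?case using approximable_add by (simp add: distrib_left)
qed

lemma approximable_compact_support:
  fixes v :: "real^'n::finite \<Rightarrow> real"
  assumes dim: "CARD('n) \<ge> 2" and v: "continuous_on UNIV v" "exp_bounded v"
    and supp: "\<And>x. (norm x)\<^sup>2 > R \<Longrightarrow> v x = 0" and R: "R \<ge> 0"
  shows "approximable v"
proof (rule approximable_uniform_limit[OF v(2) exp_bounded_const[of 1]])
  fix d :: real assume d: "d > 0"
  \<comment> \<open>\<open>\<theta>\<close> descends from 1 at \<open>R\<close> to 0 at
    \<open>R + 1\<close>. In the shell between, \<open>v = 0\<close> and
    \<open>\<bar>p x\<bar> < d\<close>, so the cutoff does not increase the error beyond
    \<open>d\<close>.\<close>
  define \<theta> :: "real \<Rightarrow> real" where "\<theta> t = max 0 (min 1 (R + 1 - t))" for t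
  obtain p where p: "real_polynomial_function p" "\<And>x. x \<in> cball 0 (sqrt (R + 1)) \<Longrightarrow> \<bar>v x - p x\<bar> < d"
    using Stone_Weierstrass_real_polynomial_function[OF compact_cball continuous_on_subset[OF v(1)] d] by blast
  have \<theta>: "continuous_on {0..} \<theta>" "\<And>t. t \<ge> R + 1 \<Longrightarrow> \<theta> t = 0"
    unfolding \<theta>_def by (auto intro!: continuous_intros)
  have g: "approximable (\<lambda>x. \<theta> ((norm x)\<^sup>2) * p x)"
    by (rule approximable_polynomial_cutoff[OF dim p(1) \<theta>(1), where R = "R + 1"]) (use R \<theta>(2) in auto)
  have "\<bar>v x - \<theta> ((norm x)\<^sup>2) * p x\<bar> \<le> d * \<bar>1\<bar>" for x
  proof -
    define t where "t = (norm x)\<^sup>2"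
    have px: "\<bar>v x - p x\<bar> < d" if "t \<le> R + 1"
      using that by (intro p(2)) (simp add: t_def real_le_rsqrt)
    consider "t \<le> R" | "R < t" "t \<le> R + 1" | "R + 1 < t" by linarith
    then show "\<bar>v x - \<theta> ((norm x)\<^sup>2) * p x\<bar> \<le> d * \<bar>1\<bar>"
      unfolding t_def[symmetric]
    proof cases
      case 1
      then show "\<bar>v x - \<theta> t * p x\<bar> \<le> d * \<bar>1\<bar>" using px by (simp add: \<theta>_def)
    next
      case 2
      then have "v x = 0" "\<bar>p x\<bar> < d" using px supp[of x] by (auto simp: t_def)
      moreover have "\<bar>\<theta> t * p x\<bar> \<le> \<bar>p x\<bar>"
        using 2 by (simp add: \<theta>_def abs_mult mult_left_le_one_le)
      ultimately show "\<bar>v x - \<theta> t * p x\<bar> \<le> d * \<bar>1\<bar>" by simp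
    next
      case 3
      then have "v x = 0" "\<theta> t = 0" using supp[of x] \<theta>(2)[of t] by (auto simp: t_def)
      then show "\<bar>v x - \<theta> t * p x\<bar> \<le> d * \<bar>1\<bar>" using d by simp
    qed
  qed
  then show "\<exists>g. approximable g \<and> (\<forall>x. \<bar>v x - g x\<bar> \<le> d * \<bar>1\<bar>)"
    using g by (intro exI[of _ "\<lambda>x. \<theta> ((norm x)\<^sup>2) * p x"]) simp
qed

lemma approximable_test_function:
  fixes v :: "real^'n::finite \<Rightarrow> real"
  assumes dim: "CARD('n) \<ge> 2" and v: "test_function v"
  shows "approximable v"
proof -
  have "bounded (closure {x. v x \<noteq> 0})" using v by (simp add: test_function_def compact_imp_bounded)
  then obtain B where B: "\<And>x. x \<in> closure {x. v x \<noteq> 0} \<Longrightarrow> norm x \<le> B" unfolding bounded_iff by blast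
  show ?thesis
  proof (rule approximable_compact_support[OF dim test_function_continuous(1)[OF v] tame_exp_bounded[OF test_function_tame[OF v]], of "B\<^sup>2"])
    fix x :: "real^'n" assume x: "B\<^sup>2 < (norm x)\<^sup>2"
    show "v x = 0"
    proof (rule ccontr)
      assume "v x \<noteq> 0"
      then have "norm x \<le> B" using B[of x] closure_subset[of "{x. v x \<noteq> 0}"] by auto
      then show False using x power_mono[of "norm x" B 2] by simp
    qed
  qed simp
qed

section \<open>The inequality\<close>

lemma bform_cong:
  assumes "\<And>x. x \<noteq> 0 \<Longrightarrow> f x = g x" "f \<in> borel_measurable borel" "g \<in> borel_measurable borel"
  shows "bsq f = bsq g"
  unfolding bform_def by (rule gint_cong) (use assms in \<open>simp_all, measurable\<close>)

text \<open>The component with eigenvalue \<open>l\<close> contributes \<open>w l\<close> to those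
  of the four remainders from which its mode is not subtracted. Their coefficients add up to
  \<open>l\<close> if \<open>l\<close> is 0, \<open>D1\<close>, \<open>D2\<close> or 4, and to
  \<open>D3\<close> otherwise, where \<open>D3 \<le> l\<close>. So the left side is at most
  \<open>\<Sum> l * w l\<close> plus the approximation errors.\<close>

lemma low_modes_bound:
  fixes v :: "real^'n::finite \<Rightarrow> real"
  assumes dim: "CARD('n) \<ge> 2" and v: "test_function v" and e: "e > 0"
  defines "D1 \<equiv> Dk 1 (real CARD('n))" and "D2 \<equiv> Dk 2 (real CARD('n))" and "D3 \<equiv> Dk 3 (real CARD('n))"
  obtains u0 u1 u2 u4 where "mode 0 u0" "mode D1 u1" "mode D2 u2" "mode 4 u4"
    "D1 * bsq (\<lambda>x. v x - u0 x)
     + (D2 - D1) * bsq (\<lambda>x. v x - (u0 x + u1 x))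
     + (4 - D2) * bsq (\<lambda>x. v x - (u0 x + u1 x + u2 x))
     + (D3 - 4) * bsq (\<lambda>x. v x - (u0 x + u1 x + u2 x + u4 x))
     \<le> eform v v + e"
proof -
  have ord: "0 < D1" "D1 < D2" "D2 < 4" "4 < D3"
    using Dk_ordering[of "real CARD('n)"] dim by (simp_all add: D1_def D2_def D3_def)
  \<comment> \<open>The four coefficients sum to \<open>D3\<close>, so an error \<open>e'\<close> in
    each remainder costs \<open>e\<close> altogether.\<close>
  define e' where "e' = e / D3"
  have "e' > 0" using e ord by (simp add: e'_def)
  then obtain f where f: "mode_sum f" "bsq (\<lambda>x. v x - f x) < e'"
    using approximable_test_function[OF dim v] unfolding approximable_def by blast
  obtain L0 u0 where L0: "finite L0" "\<And>l. mode l (u0 l)" "f = (\<lambda>x. \<Sum>l\<in>L0. u0 l x)"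
    using f(1) unfolding mode_sum_def by blast
  define S where "S = {0, D1, D2, 4}"
  \<comment> \<open>The four low eigenvalues are always included, with zero modes if
    \<open>f\<close> lacks them; other eigenvalues below \<open>D3\<close> carry zero modes only and
    are dropped.\<close>
  define L where "L = {l \<in> L0. l \<ge> D3} \<union> S"
  define u where "u l = (if l \<in> L0 then u0 l else (\<lambda>x. 0))" for l
  have L: "finite L" using L0(1) by (simp add: L_def S_def)
  have u: "mode l (u l)" for l by (simp add: u_def mode_zero L0(2))
  have f_sum: "f x = (\<Sum>l\<in>L. u l x)" for x
  proof -
    have "f x = (\<Sum>l\<in>L0 \<union> L. u l x)"
      unfolding L0(3) by (rule sum.mono_neutral_cong_left) (auto simp: u_def L0(1) L)
    also have "\<dots> = (\<Sum>l\<in>L. u l x)"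
    proof (rule sum.mono_neutral_right)
      show "\<forall>l\<in>L0 \<union> L - L. u l x = 0"
      proof
        fix l assume "l \<in> L0 \<union> L - L"
        then have "l < D3" "l \<notin> {0, D1, D2, 4}" by (auto simp: L_def S_def)
        then show "u l x = 0" unfolding D1_def D2_def D3_def by (rule modeD(6)[OF u])
      qed
    qed (use L0(1) L in auto)
    finally show ?thesis .
  qed
  have close: "bsq (\<lambda>x. v x - (\<Sum>l\<in>L. u l x)) \<le> e'"
    using f(2) by (simp add: f_sum)
  obtain c w where "(\<Sum>l\<in>L. l * w l) \<le> eform v v \<and> (\<forall>l. w l \<ge> 0) \<and>
    (\<forall>M. M \<subseteq> L \<longrightarrow> bsq (\<lambda>x. v x - (\<Sum>l\<in>M. c l * u l x))
        \<le> e' + (\<Sum>l\<in>L - M. w l))"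
    using bessel_pythagoras[OF dim test_function_tame[OF v] L modeD(1)[OF u] close] by (elim exE)
  then have cw: "(\<Sum>l\<in>L. l * w l) \<le> eform v v" "\<And>l. w l \<ge> 0"
    "\<And>M. M \<subseteq> L \<Longrightarrow> bsq (\<lambda>x. v x - (\<Sum>l\<in>M. c l * u l x))
        \<le> e' + (\<Sum>l\<in>L - M. w l)"
    by simp_all
  define p where "p l x = c l * u l x" for l x
  \<comment> \<open>All four remainders become sums over the same set \<open>L\<close>, so that they
    can be compared with \<open>\<Sum> l * w l\<close> term by term.\<close>
  define B where "B M = (\<Sum>l\<in>L. if l \<in> M then 0 else w l)" for M
  have sub: "{0} \<subseteq> L" "{0, D1} \<subseteq> L" "{0, D1, D2} \<subseteq> L" "{0, D1, D2, 4} \<subseteq> L"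
    by (auto simp: L_def S_def)
  have BM: "(\<Sum>l\<in>L - M. w l) = B M" if "M \<subseteq> L" for M
    unfolding B_def using L by (intro sum.mono_neutral_cong_left) auto
  have b: "bsq (\<lambda>x. v x - p 0 x) \<le> e' + B {0}"
    "bsq (\<lambda>x. v x - (p 0 x + p D1 x)) \<le> e' + B {0, D1}"
    "bsq (\<lambda>x. v x - (p 0 x + p D1 x + p D2 x)) \<le> e' + B {0, D1, D2}"
    "bsq (\<lambda>x. v x - (p 0 x + p D1 x + p D2 x + p 4 x))
       \<le> e' + B {0, D1, D2, 4}"
    using cw(3)[OF sub(1)] cw(3)[OF sub(2)] cw(3)[OF sub(3)] cw(3)[OF sub(4)] ord
    unfolding BM[OF sub(1)] BM[OF sub(2)] BM[OF sub(3)] BM[OF sub(4)]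
    by (simp_all add: p_def add.assoc)
  have m: "mode l (p l)" for l unfolding p_def by (rule mode_cmult[OF u])
  have "D1 * B {0} + (D2 - D1) * B {0, D1} + (4 - D2) * B {0, D1, D2} + (D3 - 4) * B {0, D1, D2, 4}
      \<le> (\<Sum>l\<in>L. l * w l)"
    unfolding B_def sum_distrib_left sum.distrib[symmetric]
  proof (rule sum_mono)
    fix l assume l: "l \<in> L"
    have w: "w l \<ge> 0" by (rule cw(2))
    consider "l = 0" | "l = D1" | "l = D2" | "l = 4" | "l \<ge> D3" using l by (auto simp: L_def S_def)
    then show "D1 * (if l \<in> {0} then 0 else w l) + (D2 - D1) * (if l \<in> {0, D1} then 0 else w l)
       + (4 - D2) * (if l \<in> {0, D1, D2} then 0 else w l)
       + (D3 - 4) * (if l \<in> {0, D1, D2, 4} then 0 else w l) \<le> l * w l"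
    proof cases
      case 5
      then have "D3 * w l \<le> l * w l" using w by (intro mult_right_mono)
      then show ?thesis using 5 ord by (simp add: algebra_simps)
    qed (use ord in \<open>simp_all add: algebra_simps\<close>)
  qed
  moreover have "D1 * bsq (\<lambda>x. v x - p 0 x) \<le> D1 * (e' + B {0})"
    "(D2 - D1) * bsq (\<lambda>x. v x - (p 0 x + p D1 x)) \<le> (D2 - D1) * (e' + B {0, D1})"
    "(4 - D2) * bsq (\<lambda>x. v x - (p 0 x + p D1 x + p D2 x))
       \<le> (4 - D2) * (e' + B {0, D1, D2})"
    "(D3 - 4) * bsq (\<lambda>x. v x - (p 0 x + p D1 x + p D2 x + p 4 x))
       \<le> (D3 - 4) * (e' + B {0, D1, D2, 4})"
    using ord by (intro mult_left_mono b; simp)+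
  moreover have "D1 * (e' + B {0}) + (D2 - D1) * (e' + B {0, D1}) + (4 - D2) * (e' + B {0, D1, D2})
      + (D3 - 4) * (e' + B {0, D1, D2, 4})
     = (D1 * B {0} + (D2 - D1) * B {0, D1} + (4 - D2) * B {0, D1, D2} + (D3 - 4) * B {0, D1, D2, 4}) + D3 * e'"
    by (simp add: algebra_simps)
  moreover have "D3 * e' = e" using ord by (simp add: e'_def)
  ultimately show ?thesis using cw(1) by (intro that[OF m m m m]) linarith
qed

lemma harmonic_1_bdot:
  fixes h :: "real^'n::finite \<Rightarrow> real"
  assumes "harmonic 1 h" obtains a where "h = bdot a"
proof -
  have p: "real_polynomial_function h" "homogeneous 1 h" using assms by (auto simp: harmonic_def)
  have "h x = bdot (\<chi> i. partial i h 0) x" for x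
  proof -
    have "((\<lambda>t. h (t *\<^sub>R x)) has_real_derivative (\<Sum>i\<in>UNIV. x $ i * partial i h 0)) (at 0)"
      using polynomial_ray_derivative[OF p(1), of x 0] by simp
    moreover have "(\<lambda>t. h (t *\<^sub>R x)) = (\<lambda>t. t * h x)" using p(2) by (simp add: homogeneous_def)
    moreover have "((\<lambda>t. t * h x) has_real_derivative h x) (at 0)" by (auto intro!: derivative_eq_intros)
    ultimately have "h x = (\<Sum>i\<in>UNIV. x $ i * partial i h 0)" using DERIV_unique by metis
    then show ?thesis by (simp add: bdot_def mult.commute)
  qed
  then show ?thesis using that[of "\<chi> i. partial i h 0"] by blast
qed

lemma exp_bounded_powr_harmonic:
  assumes "harmonic k h" "\<sigma> + real k \<ge> 0"
  shows "exp_bounded (\<lambda>x. norm x powr \<sigma> * h x)"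
  using assms by (intro exp_bounded_powr_mult[of \<sigma> k] polynomial_measurable polynomial_continuous_on)
    (auto simp: harmonic_def homogeneous_def)

lemma harmonic_bdot:
  fixes a :: "real^'n::finite" shows "harmonic 1 (bdot a :: real^'n \<Rightarrow> real)"
proof -
  have b: "(bdot a :: real^'n \<Rightarrow> real) = (\<lambda>x. a \<bullet> x)" by (simp add: bdot_def inner_vec_def fun_eq_iff)
  have "bounded_linear (\<lambda>x::real^'n. a \<bullet> x)" by (rule bounded_linear_inner_right)
  then show ?thesis
    unfolding b harmonic_def homogeneous_def laplacian_def
    by (auto simp: partial_linear partial_const)
qed

text \<open>On the unit sphere \<open>\<Phi>\<close> agrees with harmonic polynomials, and both sides vanish at 0.\<close>

lemma sphere_harmonic_extension:
  fixes p :: "real^'n::finite \<Rightarrow> real"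
  assumes p: "homogeneous 2 p" and Y: "\<And>x. x \<in> sphere 0 1 \<Longrightarrow> Y x = p x"
  shows "norm x powr s * Y (x /\<^sub>R norm x) = norm x powr (s - 2) * p x"
proof (cases "x = 0")
  case False
  have "p x = (norm x)\<^sup>2 * p (x /\<^sub>R norm x)"
    using p[unfolded homogeneous_def, rule_format, of "norm x" "x /\<^sub>R norm x"] False by simp
  then show ?thesis
    using False norm_powr_add_2[OF False, of s] Y[of "x /\<^sub>R norm x"] by simp
qed simp

text \<open>\<open>\<Phi>\<close> is controlled on the sphere only. Replacing its radial extension
  by |x|^(s-2) times harmonic polynomials provides both measurability and the bound.\<close>

lemma exp_bounded_basis_term:
  fixes \<Phi> :: "real^'n::finite \<Rightarrow> real^'m::finite" and b :: "real^'m"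
  assumes \<Phi>: "orthonormal_harmonic_basis 2 \<Phi>" and s: "s \<ge> 0"
  shows "exp_bounded (\<lambda>x. norm x powr s * bdot b (\<Phi> (x /\<^sub>R norm x)))"
proof -
  have "\<exists>p. harmonic 2 p \<and> (\<forall>x\<in>sphere 0 1. \<Phi> x $ i = p x)" for i
    using \<Phi> unfolding orthonormal_harmonic_basis_def spherical_harmonic_def harmonic_def homogeneous_def by blast
  then obtain p where p: "\<And>i. harmonic 2 (p i)" "\<And>i x. x \<in> sphere 0 1 \<Longrightarrow> \<Phi> x $ i = p i x" by metis
  have "norm x powr s * bdot b (\<Phi> (x /\<^sub>R norm x)) = (\<Sum>i\<in>UNIV. b $ i * (norm x powr (s - 2) * p i x))" for x
  proof -
    have "norm x powr s * bdot b (\<Phi> (x /\<^sub>R norm x)) = (\<Sum>i\<in>UNIV. b $ i * (norm x powr s * \<Phi> (x /\<^sub>R norm x) $ i))"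
      by (simp add: bdot_def sum_distrib_left mult.left_commute)
    also have "\<dots> = (\<Sum>i\<in>UNIV. b $ i * (norm x powr (s - 2) * p i x))"
    proof (rule sum.cong[OF refl])
      fix i
      have "homogeneous 2 (p i)" using p(1) by (simp add: harmonic_def)
      from sphere_harmonic_extension[OF this, of "\<lambda>x. \<Phi> x $ i", OF p(2)]
      show "b $ i * (norm x powr s * \<Phi> (x /\<^sub>R norm x) $ i) = b $ i * (norm x powr (s - 2) * p i x)" by simp
    qed
    finally show ?thesis .
  qed
  moreover have "exp_bounded (\<lambda>x. \<Sum>i\<in>UNIV. b $ i * (norm x powr (s - 2) * p i x))"
    by (intro exp_bounded_sum exp_bounded_mult[OF exp_bounded_const] exp_bounded_powr_harmonic[OF p(1)])
       (use s in simp)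
  ultimately show ?thesis by simp
qed

lemma harmonic_2_basis:
  fixes \<Phi> :: "real^'n::finite \<Rightarrow> real^'m::finite"
  assumes \<Phi>: "orthonormal_harmonic_basis 2 \<Phi>" and h: "harmonic 2 h"
  obtains b :: "real^'m" where "\<And>x s. norm x powr (s - 2) * h x = norm x powr s * bdot b (\<Phi> (x /\<^sub>R norm x))"
proof -
  have hom: "homogeneous 2 h" using h by (simp add: harmonic_def)
  have "spherical_harmonic 2 h"
    using h unfolding spherical_harmonic_def harmonic_def homogeneous_def by blast
  then obtain b where b: "\<And>x. x \<in> sphere 0 1 \<Longrightarrow> h x = (\<Sum>i\<in>UNIV. b i * \<Phi> x $ i)"
    using \<Phi> unfolding orthonormal_harmonic_basis_def by blast
  have "norm x powr (s - 2) * h x = norm x powr s * bdot (\<chi> i. b i) (\<Phi> (x /\<^sub>R norm x))" for x s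
    by (rule sphere_harmonic_extension[OF hom, of "\<lambda>x. bdot (\<chi> i. b i) (\<Phi> x)", symmetric])
       (simp add: bdot_def b)
  then show ?thesis using that by blast
qed

text \<open>Polymorphic in the scalars, so that the real and the complex half of the theorem fold to
  the same formula.\<close>

definition deg1_term :: "'a::real_normed_field ^ 'n::finite \<Rightarrow> real ^ 'n \<Rightarrow> 'a" where
  "deg1_term a x = norm x powr (Dk 1 (real CARD('n)) / 2 - 1) *\<^sub>R bdot a x"

definition deg2_term :: "(real ^ 'n::finite \<Rightarrow> real ^ 'm::finite) \<Rightarrow> 'a::real_normed_field ^ 'm \<Rightarrow> real ^ 'n \<Rightarrow> 'a" where
  "deg2_term \<Phi> b x = norm x powr (Dk 2 (real CARD('n)) / 2) *\<^sub>R bdot b (\<Phi> (x /\<^sub>R norm x))"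

definition nsq :: "(real^'n::finite \<Rightarrow> 'a::real_normed_vector) \<Rightarrow> real" where
  "nsq f = (LINT x|nu. (norm (f x))\<^sup>2)"

section \<open>Integrals against nu in terms of the two forms\<close>

lemma nu_integral:
  assumes [measurable]: "f \<in> borel_measurable borel"
  shows "(LINT x|nu. f x) = gint (\<lambda>x. (norm x)\<^sup>2 * f x)"
  unfolding nu_def gint_def
  by (subst integral_density) (auto simp: mult.assoc)

lemma nsq_real:
  fixes f :: "real^'n::finite \<Rightarrow> real"
  assumes [measurable]: "f \<in> borel_measurable borel"
  shows "nsq f = bsq f"
proof -
  have "nsq f = gint (\<lambda>x. (norm x)\<^sup>2 * (norm (f x))\<^sup>2)"
    unfolding nsq_def by (rule nu_integral) measurable
  then show ?thesis by (simp add: bform_def power2_eq_square algebra_simps)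
qed

lemma nsq_nonneg: "nsq f \<ge> 0"
  unfolding nsq_def by (rule Bochner_Integration.integral_nonneg) simp

lemma exp_bounded_deg1_term:
  "exp_bounded (deg1_term (a :: real^'n::finite) :: real^'n \<Rightarrow> real)" if "CARD('n) \<ge> 2"
proof -
  have "Dk 1 (real CARD('n)) / 2 \<ge> 0" using Dk_half(1)[of "real CARD('n)" 1] that by simp
  then show ?thesis
    unfolding deg1_term_def[abs_def] real_scaleR_def
    by (intro exp_bounded_powr_harmonic[OF harmonic_bdot]) simp
qed

lemma exp_bounded_deg2_term:
  fixes \<Phi> :: "real^'n::finite \<Rightarrow> real^'m::finite" and b :: "real^'m"
  assumes "CARD('n) \<ge> 2" "orthonormal_harmonic_basis 2 \<Phi>"
  shows "exp_bounded (deg2_term \<Phi> b)"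
proof -
  have "Dk 2 (real CARD('n)) / 2 \<ge> 0" using Dk_half(1)[of "real CARD('n)" 2] assms(1) by simp
  then show ?thesis
    unfolding deg2_term_def[abs_def] real_scaleR_def by (rule exp_bounded_basis_term[OF assms(2)])
qed

text \<open>The same \<open>c\<close>, \<open>a\<close>, \<open>b\<close> serve in every remainder,
  except that the mode for 4 is \<open>c4 + d |x|^2\<close> and its constant part is merged into
  \<open>c'\<close>.\<close>

lemma real_approximate_bound:
  fixes v :: "real^'n::finite \<Rightarrow> real" and \<Phi> :: "real^'n \<Rightarrow> real^'m::finite"
  assumes dim: "CARD('n) \<ge> 2" and \<Phi>: "orthonormal_harmonic_basis 2 \<Phi>"
    and v: "test_function v" and e: "e > 0"
  defines "D1 \<equiv> Dk 1 (real CARD('n))" and "D2 \<equiv> Dk 2 (real CARD('n))" and "D3 \<equiv> Dk 3 (real CARD('n))"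
  shows "\<exists>(c::real) (a::real^'n) (b::real^'m) c' d.
     D1 * bsq (\<lambda>x. v x - c)
     + (D2 - D1) * bsq (\<lambda>x. v x - c - deg1_term a x)
     + (4 - D2) * bsq (\<lambda>x. v x - c - deg1_term a x - deg2_term \<Phi> b x)
     + (D3 - 4) * bsq (\<lambda>x. v x - c' - (norm x)\<^sup>2 *\<^sub>R d - deg1_term a x - deg2_term \<Phi> b x)
     \<le> eform v v + e"
proof -
  obtain u0 u1 u2 u4 where u: "mode 0 u0" "mode D1 u1" "mode D2 u2" "mode 4 u4"
    and bound: "D1 * bsq (\<lambda>x. v x - u0 x)
     + (D2 - D1) * bsq (\<lambda>x. v x - (u0 x + u1 x))
     + (4 - D2) * bsq (\<lambda>x. v x - (u0 x + u1 x + u2 x))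
     + (D3 - 4) * bsq (\<lambda>x. v x - (u0 x + u1 x + u2 x + u4 x))
     \<le> eform v v + e"
    using low_modes_bound[OF dim v e] unfolding D1_def D2_def D3_def by blast
  obtain c where c: "\<And>x. x \<noteq> 0 \<Longrightarrow> u0 x = c" using modeD(2)[OF u(1)] by auto
  obtain h1 where h1: "harmonic 1 h1" "\<And>x. x \<noteq> 0 \<Longrightarrow> u1 x = norm x powr (D1 / 2 - 1) * h1 x"
    using modeD(3)[OF u(2)[unfolded D1_def] refl] unfolding D1_def by blast
  obtain h2 where h2: "harmonic 2 h2" "\<And>x. x \<noteq> 0 \<Longrightarrow> u2 x = norm x powr (D2 / 2 - 2) * h2 x"
    using modeD(4)[OF u(3)[unfolded D2_def] refl] unfolding D2_def by blast
  obtain c4 d where c4: "\<And>x. x \<noteq> 0 \<Longrightarrow> u4 x = c4 + d * (norm x)\<^sup>2" using modeD(5)[OF u(4)] by auto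
  obtain a where a: "h1 = bdot a" using harmonic_1_bdot[OF h1(1)] by blast
  obtain b where b: "\<And>x s. norm x powr (s - 2) * h2 x = norm x powr s * bdot b (\<Phi> (x /\<^sub>R norm x))"
    using harmonic_2_basis[OF \<Phi> h2(1)] by blast
  have t1: "u1 x = deg1_term a x" if "x \<noteq> 0" for x
    using h1(2)[OF that] by (simp add: deg1_term_def a D1_def)
  have t2: "u2 x = deg2_term \<Phi> b x" if "x \<noteq> 0" for x
    using h2(2)[OF that] b[of x "D2 / 2"] by (simp add: deg2_term_def D2_def)
  have [measurable]: "v \<in> borel_measurable borel"
    using v by (intro exp_bounded_measurable tame_exp_bounded test_function_tame)
  have [measurable]: "u0 \<in> borel_measurable borel" "u1 \<in> borel_measurable borel"
    "u2 \<in> borel_measurable borel" "u4 \<in> borel_measurable borel"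
    using u by (auto intro!: exp_bounded_measurable mode_exp_bounded)
  have [measurable]: "deg1_term a \<in> borel_measurable borel" "deg2_term \<Phi> b \<in> borel_measurable borel"
    using exp_bounded_deg1_term[OF dim] exp_bounded_deg2_term[OF dim \<Phi>] by auto
  have e0: "bsq (\<lambda>x. v x - u0 x) = bsq (\<lambda>x. v x - c)"
    by (rule bform_cong) (simp add: c, measurable)
  have e1: "bsq (\<lambda>x. v x - (u0 x + u1 x))
      = bsq (\<lambda>x. v x - c - deg1_term a x)"
    by (rule bform_cong) (simp add: c t1, measurable)
  have e2: "bsq (\<lambda>x. v x - (u0 x + u1 x + u2 x))
      = bsq (\<lambda>x. v x - c - deg1_term a x - deg2_term \<Phi> b x)"
    by (rule bform_cong) (simp add: c t1 t2, measurable)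
  have e3: "bsq (\<lambda>x. v x - (u0 x + u1 x + u2 x + u4 x))
      = bsq (\<lambda>x. v x - (c + c4) - (norm x)\<^sup>2 *\<^sub>R d - deg1_term a x - deg2_term \<Phi> b x)"
    by (rule bform_cong) (simp add: c t1 t2 c4 algebra_simps, measurable)
  show ?thesis
    using bound unfolding e0 e1 e2 e3 by blast
qed

lemma norm_grad_sq: "(norm (grad v x))\<^sup>2 = (\<Sum>i\<in>UNIV. (norm (partial i v x))\<^sup>2)"
  by (simp add: norm_vec_def L2_set_def grad_def sum_nonneg)

lemma dirichlet_real:
  fixes v :: "real^'n::finite \<Rightarrow> real"
  assumes "test_function v"
  shows "nsq (grad v) = eform v v"
proof -
  have [measurable]: "partial i v \<in> borel_measurable borel" for i
    by (intro borel_measurable_continuous_onI test_function_continuous assms)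
  have "nsq (grad v) = gint (\<lambda>x. (norm x)\<^sup>2 * (\<Sum>i\<in>UNIV. (norm (partial i v x))\<^sup>2))"
    unfolding nsq_def norm_grad_sq by (rule nu_integral) measurable
  also have "\<dots> = eform v v"
    unfolding eform_def by (simp add: sum_distrib_left power2_eq_square algebra_simps)
  finally show ?thesis .
qed

lemma partial_bounded_linear:
  assumes f: "bounded_linear f" and v: "v differentiable (at x)"
  shows "partial i (\<lambda>x. f (v x)) x = f (partial i v x)"
proof -
  have "((\<lambda>t. v (x + t *\<^sub>R axis i 1)) has_vector_derivative partial i v x) (at 0)"
    by (rule differentiable_has_partial[OF v])
  then have "((\<lambda>t. f (v (x + t *\<^sub>R axis i 1))) has_vector_derivative f (partial i v x)) (at 0)"
    by (rule bounded_linear.has_vector_derivative[OF f])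
  then show ?thesis unfolding partial_def[of i "\<lambda>x. f (v x)"] by (rule vector_derivative_at)
qed

text \<open>Applied to \<open>Re\<close> and \<open>Im\<close>, which commute with all iterated
  partial derivatives.\<close>

lemma test_function_bounded_linear:
  assumes f: "bounded_linear f" and v: "test_function v"
  shows "test_function (\<lambda>x. f (v x))"
    and "partial i (\<lambda>x. f (v x)) x = f (partial i v x)"
proof -
  note sm = test_function_differentiable[OF v]
  show "partial i (\<lambda>x. f (v x)) x = f (partial i v x)"
    by (rule partial_bounded_linear[OF f]) (use sm[of "[]"] in simp)
  have it: "iterated_partial is (\<lambda>x. f (v x)) = (\<lambda>x. f (iterated_partial is v x))" for "is"
  proof (induction "is")
    case (Cons i "is")
    have "partial i (\<lambda>x. f (iterated_partial is v x)) = (\<lambda>x. f (partial i (iterated_partial is v) x))"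
      by (rule ext) (rule partial_bounded_linear[OF f sm])
    then show ?case by (simp add: Cons.IH)
  qed simp
  have "(\<lambda>x. f (iterated_partial is v x)) differentiable (at x)" for "is" x
  proof -
    obtain D where "(iterated_partial is v has_derivative D) (at x)" using sm by (auto simp: differentiable_def)
    from bounded_linear.has_derivative[OF f this] show ?thesis by (auto simp: differentiable_def)
  qed
  moreover have "compact (closure {x. f (v x) \<noteq> 0})"
  proof -
    have "closure {x. f (v x) \<noteq> 0} \<subseteq> closure {x. v x \<noteq> 0}"
      by (rule closure_mono) (use linear_0[OF bounded_linear.linear[OF f]] in auto)
    then show ?thesis using v unfolding test_function_def by (meson closed_closure compact_closure
        bounded_subset compact_eq_bounded_closed)
  qed
  ultimately show "test_function (\<lambda>x. f (v x))"
    unfolding test_function_def smooth_def it by blast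
qed

lemma nsq_complex:
  assumes "exp_bounded (\<lambda>x. Re (f x))" "exp_bounded (\<lambda>x. Im (f x))"
  shows "nsq f = bsq (\<lambda>x. Re (f x)) + bsq (\<lambda>x. Im (f x))"
proof -
  have [measurable]: "(\<lambda>x. Re (f x)) \<in> borel_measurable borel" "(\<lambda>x. Im (f x)) \<in> borel_measurable borel"
    using assms by auto
  have "nsq f = (LINT x|nu. (Re (f x))\<^sup>2 + (Im (f x))\<^sup>2)" by (simp add: nsq_def cmod_power2)
  also have "\<dots> = gint (\<lambda>x. (norm x)\<^sup>2 * ((Re (f x))\<^sup>2 + (Im (f x))\<^sup>2))" by (rule nu_integral) measurable
  also have "\<dots> = gint (\<lambda>x. (norm x * Re (f x)) * (norm x * Re (f x)) + (norm x * Im (f x)) * (norm x * Im (f x)))"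
    by (simp add: power2_eq_square algebra_simps)
  also have "\<dots> = bsq (\<lambda>x. Re (f x)) + bsq (\<lambda>x. Im (f x))"
    unfolding bform_def by (rule gint_add) (intro exp_bounded_mult exp_bounded_norm assms)+
  finally show ?thesis .
qed

lemma dirichlet_complex:
  fixes v :: "real^'n::finite \<Rightarrow> complex"
  assumes v: "test_function v"
  shows "nsq (grad v)
     = eform (\<lambda>x. Re (v x)) (\<lambda>x. Re (v x)) + eform (\<lambda>x. Im (v x)) (\<lambda>x. Im (v x))"
proof -
  note re = test_function_bounded_linear[OF bounded_linear_Re v]
  note im = test_function_bounded_linear[OF bounded_linear_Im v]
  have [measurable]: "partial i (\<lambda>x. Re (v x)) \<in> borel_measurable borel"
    "partial i (\<lambda>x. Im (v x)) \<in> borel_measurable borel" for i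
    by (intro borel_measurable_continuous_onI test_function_continuous re im)+
  have "(norm (grad v x))\<^sup>2 = (\<Sum>i\<in>UNIV. (partial i (\<lambda>x. Re (v x)) x)\<^sup>2)
      + (\<Sum>i\<in>UNIV. (partial i (\<lambda>x. Im (v x)) x)\<^sup>2)" for x
    by (simp add: norm_grad_sq re im cmod_power2 sum.distrib)
  then have "nsq (grad v) = gint (\<lambda>x. (norm x)\<^sup>2 * ((\<Sum>i\<in>UNIV. (partial i (\<lambda>x. Re (v x)) x)\<^sup>2)
      + (\<Sum>i\<in>UNIV. (partial i (\<lambda>x. Im (v x)) x)\<^sup>2)))"
    unfolding nsq_def by (subst nu_integral[symmetric]) simp_all
  also have "\<dots> = gint (\<lambda>x. (\<Sum>i\<in>UNIV. (norm x * partial i (\<lambda>x. Re (v x)) x) * (norm x * partial i (\<lambda>x. Re (v x)) x))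
      + (\<Sum>i\<in>UNIV. (norm x * partial i (\<lambda>x. Im (v x)) x) * (norm x * partial i (\<lambda>x. Im (v x)) x)))"
    by (simp add: distrib_left sum_distrib_left power2_eq_square mult.assoc mult.left_commute)
  also have "\<dots> = eform (\<lambda>x. Re (v x)) (\<lambda>x. Re (v x)) + eform (\<lambda>x. Im (v x)) (\<lambda>x. Im (v x))"
    unfolding eform_def
    by (rule gint_add) (intro exp_bounded_sum exp_bounded_mult tame_norm_partial test_function_tame re im)+
  finally show ?thesis .
qed

lemma bdot_Complex:
  "Re (bdot (\<chi> i. Complex (a $ i) (b $ i)) y) = bdot a y"
  "Im (bdot (\<chi> i. Complex (a $ i) (b $ i)) y) = bdot b y"
  by (simp_all add: bdot_def)

lemma term_Complex:
  "Re (deg1_term (\<chi> i. Complex (a $ i) (b $ i)) x) = deg1_term a x"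
  "Im (deg1_term (\<chi> i. Complex (a $ i) (b $ i)) x) = deg1_term b x"
  "Re (deg2_term \<Phi> (\<chi> i. Complex (c $ i) (d $ i)) x) = deg2_term \<Phi> c x"
  "Im (deg2_term \<Phi> (\<chi> i. Complex (c $ i) (d $ i)) x) = deg2_term \<Phi> d x"
  by (simp_all add: deg1_term_def deg2_term_def bdot_Complex)

text \<open>An infimum is at most the value at any parameter, and the coefficients are positive. It
  thus suffices to find, for each \<open>e\<close>, parameters that satisfy the inequality up to
  \<open>e\<close>; nothing is claimed about minimizers.\<close>

lemma infima_le:
  fixes v :: "real^'n::finite \<Rightarrow> 'a::real_normed_field" and \<Phi> :: "real^'n \<Rightarrow> real^'m::finite"
  assumes dim: "CARD('n) \<ge> 2"
  defines "D1 \<equiv> Dk 1 (real CARD('n))" and "D2 \<equiv> Dk 2 (real CARD('n))" and "D3 \<equiv> Dk 3 (real CARD('n))"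
  assumes approx: "\<And>e. e > 0 \<Longrightarrow> \<exists>c a b c' d.
     D1 * nsq (\<lambda>x. v x - c)
     + (D2 - D1) * nsq (\<lambda>x. v x - c - deg1_term a x)
     + (4 - D2) * nsq (\<lambda>x. v x - c - deg1_term a x - deg2_term \<Phi> b x)
     + (D3 - 4) * nsq (\<lambda>x. v x - c' - (norm x)\<^sup>2 *\<^sub>R d - deg1_term a x - deg2_term \<Phi> b x) \<le> E + e"
  shows "D1 * (INF c. nsq (\<lambda>x. v x - c))
     + (D2 - D1) * (INF (c, a). nsq (\<lambda>x. v x - c - deg1_term a x))
     + (4 - D2) * (INF (c, a, b). nsq (\<lambda>x. v x - c - deg1_term a x - deg2_term \<Phi> b x))
     + (D3 - 4) * (INF (c, d, a, b). nsq (\<lambda>x. v x - c - (norm x)\<^sup>2 *\<^sub>R d - deg1_term a x - deg2_term \<Phi> b x)) \<le> E"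
proof (rule field_le_epsilon)
  fix e :: real assume "e > 0"
  then obtain c a b c' d where le: "D1 * nsq (\<lambda>x. v x - c)
     + (D2 - D1) * nsq (\<lambda>x. v x - c - deg1_term a x)
     + (4 - D2) * nsq (\<lambda>x. v x - c - deg1_term a x - deg2_term \<Phi> b x)
     + (D3 - 4) * nsq (\<lambda>x. v x - c' - (norm x)\<^sup>2 *\<^sub>R d - deg1_term a x - deg2_term \<Phi> b x) \<le> E + e"
    using approx by blast
  have ord: "0 < D1" "D1 < D2" "D2 < 4" "4 < D3"
    using Dk_ordering[of "real CARD('n)"] dim by (simp_all add: D1_def D2_def D3_def)
  have lower: "(INF p. nsq (F p)) \<le> nsq (F p)" for F :: "'b \<Rightarrow> real^'n \<Rightarrow> 'a" and p
    by (rule cINF_lower) (auto intro!: bdd_belowI[of _ 0] nsq_nonneg)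
  have 0: "(INF c. nsq (\<lambda>x. v x - c)) \<le> nsq (\<lambda>x. v x - c)"
    by (rule lower)
  have 1: "(INF (c, a). nsq (\<lambda>x. v x - c - deg1_term a x)) \<le> nsq (\<lambda>x. v x - c - deg1_term a x)"
    using cINF_lower[of "\<lambda>(c, a). nsq (\<lambda>x. v x - c - deg1_term a x)" UNIV "(c, a)"]
    by (force intro!: bdd_belowI[of _ 0] nsq_nonneg)
  have 2: "(INF (c, a, b). nsq (\<lambda>x. v x - c - deg1_term a x - deg2_term \<Phi> b x))
      \<le> nsq (\<lambda>x. v x - c - deg1_term a x - deg2_term \<Phi> b x)"
    using cINF_lower[of "\<lambda>(c, a, b). nsq (\<lambda>x. v x - c - deg1_term a x - deg2_term \<Phi> b x)" UNIV "(c, a, b)"]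
    by (force intro!: bdd_belowI[of _ 0] nsq_nonneg)
  have 3: "(INF (c, d, a, b). nsq (\<lambda>x. v x - c - (norm x)\<^sup>2 *\<^sub>R d - deg1_term a x - deg2_term \<Phi> b x))
      \<le> nsq (\<lambda>x. v x - c' - (norm x)\<^sup>2 *\<^sub>R d - deg1_term a x - deg2_term \<Phi> b x)"
    using cINF_lower[of "\<lambda>(c, d, a, b). nsq (\<lambda>x. v x - c - (norm x)\<^sup>2 *\<^sub>R d - deg1_term a x - deg2_term \<Phi> b x)"
        UNIV "(c', d, a, b)"]
    by (force intro!: bdd_belowI[of _ 0] nsq_nonneg)
  show "D1 * (INF c. nsq (\<lambda>x. v x - c))
     + (D2 - D1) * (INF (c, a). nsq (\<lambda>x. v x - c - deg1_term a x))
     + (4 - D2) * (INF (c, a, b). nsq (\<lambda>x. v x - c - deg1_term a x - deg2_term \<Phi> b x))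
     + (D3 - 4) * (INF (c, d, a, b). nsq (\<lambda>x. v x - c - (norm x)\<^sup>2 *\<^sub>R d - deg1_term a x - deg2_term \<Phi> b x)) \<le> E + e"
    by (rule order_trans[OF _ le]) (intro add_mono mult_left_mono 0 1 2 3; use ord in simp)
qed

theorem theorem5p1:
  fixes \<Phi> :: "real ^ 'n::finite \<Rightarrow> real ^ 'm::finite"
    and D1 D2 D3 :: real
  defines "D1 \<equiv> Dk 1 (real CARD('n))"
    and "D2 \<equiv> Dk 2 (real CARD('n))"
    and "D3 \<equiv> Dk 3 (real CARD('n))"
  assumes "CARD('n) \<ge> 2"
    and "orthonormal_harmonic_basis 2 \<Phi>"
  shows "(\<forall>v :: real ^ 'n \<Rightarrow> real. test_function v \<longrightarrow>
      (LINT x|nu. (norm (grad v x))\<^sup>2) \<ge>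
        D1 * (INF c :: real. LINT x|nu. (norm (v x - c))\<^sup>2)
      + (D2 - D1) * (INF (c :: real, a :: real ^ 'n).
          LINT x|nu. (norm (v x - c - norm x powr (D1 / 2 - 1) *\<^sub>R bdot a x))\<^sup>2)
      + (4 - D2) * (INF (c :: real, a :: real ^ 'n, b :: real ^ 'm).
          LINT x|nu. (norm (v x - c - norm x powr (D1 / 2 - 1) *\<^sub>R bdot a x
            - norm x powr (D2 / 2) *\<^sub>R bdot b (\<Phi> (x /\<^sub>R norm x))))\<^sup>2)
      + (D3 - 4) * (INF (c :: real, d :: real, a :: real ^ 'n, b :: real ^ 'm).
          LINT x|nu. (norm (v x - c - (norm x)\<^sup>2 *\<^sub>R d - norm x powr (D1 / 2 - 1) *\<^sub>R bdot a x
            - norm x powr (D2 / 2) *\<^sub>R bdot b (\<Phi> (x /\<^sub>R norm x))))\<^sup>2))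
   \<and> (\<forall>v :: real ^ 'n \<Rightarrow> complex. test_function v \<longrightarrow>
      (LINT x|nu. (norm (grad v x))\<^sup>2) \<ge>
        D1 * (INF c :: complex. LINT x|nu. (norm (v x - c))\<^sup>2)
      + (D2 - D1) * (INF (c :: complex, a :: complex ^ 'n).
          LINT x|nu. (norm (v x - c - norm x powr (D1 / 2 - 1) *\<^sub>R bdot a x))\<^sup>2)
      + (4 - D2) * (INF (c :: complex, a :: complex ^ 'n, b :: complex ^ 'm).
          LINT x|nu. (norm (v x - c - norm x powr (D1 / 2 - 1) *\<^sub>R bdot a x
            - norm x powr (D2 / 2) *\<^sub>R bdot b (\<Phi> (x /\<^sub>R norm x))))\<^sup>2)
      + (D3 - 4) * (INF (c :: complex, d :: complex, a :: complex ^ 'n, b :: complex ^ 'm).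
          LINT x|nu. (norm (v x - c - (norm x)\<^sup>2 *\<^sub>R d - norm x powr (D1 / 2 - 1) *\<^sub>R bdot a x
            - norm x powr (D2 / 2) *\<^sub>R bdot b (\<Phi> (x /\<^sub>R norm x))))\<^sup>2))"
  unfolding D1_def D2_def D3_def deg1_term_def[symmetric] deg2_term_def[symmetric] nsq_def[symmetric]
proof (intro conjI allI impI)
  note dim = assms(4) and \<Phi> = assms(5)
  note eb1 = exp_bounded_deg1_term[OF dim] and eb2 = exp_bounded_deg2_term[OF dim \<Phi>]
  \<comment> \<open>This gives measurability in the real case and the splitting of
    \<open>nsq\<close> into real and imaginary parts in the complex case.\<close>
  have ebs: "exp_bounded (\<lambda>x. u x - c)"
    "exp_bounded (\<lambda>x. u x - c - deg1_term a x)"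
    "exp_bounded (\<lambda>x. u x - c - deg1_term a x - deg2_term \<Phi> b x)"
    "exp_bounded (\<lambda>x. u x - c - (norm x)\<^sup>2 *\<^sub>R d - deg1_term a x - deg2_term \<Phi> b x)"
    if "test_function u" for u :: "real^'n \<Rightarrow> real" and c d a b
  proof -
    have u: "exp_bounded u" by (rule tame_exp_bounded[OF test_function_tame[OF that]])
    show "exp_bounded (\<lambda>x. u x - c)"
      "exp_bounded (\<lambda>x. u x - c - deg1_term a x)"
      "exp_bounded (\<lambda>x. u x - c - deg1_term a x - deg2_term \<Phi> b x)"
      "exp_bounded (\<lambda>x. u x - c - (norm x)\<^sup>2 *\<^sub>R d - deg1_term a x - deg2_term \<Phi> b x)"
      unfolding real_scaleR_def
      by (intro exp_bounded_diff exp_bounded_const exp_bounded_mult exp_bounded_power exp_bounded_norm u eb1 eb2)+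
  qed
  {
    fix v :: "real^'n \<Rightarrow> real" assume v: "test_function v"
    note m = exp_bounded_measurable[OF ebs(1)[OF v]] exp_bounded_measurable[OF ebs(2)[OF v]]
      exp_bounded_measurable[OF ebs(3)[OF v]] exp_bounded_measurable[OF ebs(4)[OF v]]
    show "Dk 1 (real CARD('n)) * (INF c. nsq (\<lambda>x. v x - c))
     + (Dk 2 (real CARD('n)) - Dk 1 (real CARD('n))) * (INF (c, a). nsq (\<lambda>x. v x - c - deg1_term a x))
     + (4 - Dk 2 (real CARD('n))) * (INF (c, a, b). nsq (\<lambda>x. v x - c - deg1_term a x - deg2_term \<Phi> b x))
     + (Dk 3 (real CARD('n)) - 4) * (INF (c, d, a, b). nsq (\<lambda>x. v x - c - (norm x)\<^sup>2 *\<^sub>R d - deg1_term a x - deg2_term \<Phi> b x))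
     \<le> nsq (grad v)"
      unfolding dirichlet_real[OF v]
      by (rule infima_le[OF dim]) (simp only: nsq_real[OF m(1)] nsq_real[OF m(2)] nsq_real[OF m(3)] nsq_real[OF m(4)],
          rule real_approximate_bound[OF dim \<Phi> v])
  }
  {
    fix v :: "real^'n \<Rightarrow> complex" assume v: "test_function v"
    define D1' where "D1' = Dk 1 (real CARD('n))"
    define D2' where "D2' = Dk 2 (real CARD('n))"
    define D3' where "D3' = Dk 3 (real CARD('n))"
    have re: "test_function (\<lambda>x. Re (v x))" and im: "test_function (\<lambda>x. Im (v x))"
      by (rule test_function_bounded_linear(1)[OF bounded_linear_Re v]
          test_function_bounded_linear(1)[OF bounded_linear_Im v])+
    show "Dk 1 (real CARD('n)) * (INF c. nsq (\<lambda>x. v x - c))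
     + (Dk 2 (real CARD('n)) - Dk 1 (real CARD('n))) * (INF (c, a). nsq (\<lambda>x. v x - c - deg1_term a x))
     + (4 - Dk 2 (real CARD('n))) * (INF (c, a, b). nsq (\<lambda>x. v x - c - deg1_term a x - deg2_term \<Phi> b x))
     + (Dk 3 (real CARD('n)) - 4) * (INF (c, d, a, b). nsq (\<lambda>x. v x - c - (norm x)\<^sup>2 *\<^sub>R d - deg1_term a x - deg2_term \<Phi> b x))
     \<le> nsq (grad v)"
    proof (rule infima_le[OF dim])
      fix e :: real assume e: "e > 0"
      obtain c1 a1 b1 k1 d1 where r: "D1' * bsq (\<lambda>x. Re (v x) - c1)
     + (D2' - D1') * bsq (\<lambda>x. Re (v x) - c1 - deg1_term a1 x)
     + (4 - D2') * bsq (\<lambda>x. Re (v x) - c1 - deg1_term a1 x - deg2_term \<Phi> b1 x)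
     + (D3' - 4) * bsq (\<lambda>x. Re (v x) - k1 - (norm x)\<^sup>2 *\<^sub>R d1 - deg1_term a1 x - deg2_term \<Phi> b1 x)
     \<le> eform (\<lambda>x. Re (v x)) (\<lambda>x. Re (v x)) + e / 2"
        using real_approximate_bound[OF dim \<Phi> re, of "e / 2"] e unfolding D1'_def D2'_def D3'_def by auto
      obtain c2 a2 b2 k2 d2 where i: "D1' * bsq (\<lambda>x. Im (v x) - c2)
     + (D2' - D1') * bsq (\<lambda>x. Im (v x) - c2 - deg1_term a2 x)
     + (4 - D2') * bsq (\<lambda>x. Im (v x) - c2 - deg1_term a2 x - deg2_term \<Phi> b2 x)
     + (D3' - 4) * bsq (\<lambda>x. Im (v x) - k2 - (norm x)\<^sup>2 *\<^sub>R d2 - deg1_term a2 x - deg2_term \<Phi> b2 x)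
     \<le> eform (\<lambda>x. Im (v x)) (\<lambda>x. Im (v x)) + e / 2"
        using real_approximate_bound[OF dim \<Phi> im, of "e / 2"] e unfolding D1'_def D2'_def D3'_def by auto
      \<comment> \<open>The parameters found for \<open>Re\<close> and \<open>Im\<close> of
        \<open>v\<close> are paired. Since \<open>x\<close> and \<open>\<Phi>\<close> are real, the
        real and imaginary parts of the complex remainders are exactly the two real
        remainders.\<close>
      define c where "c = Complex c1 c2"
      define k where "k = Complex k1 k2"
      define d where "d = Complex d1 d2"
      define a :: "complex^'n" where "a = (\<chi> i. Complex (a1 $ i) (a2 $ i))"
      define b :: "complex^'m" where "b = (\<chi> i. Complex (b1 $ i) (b2 $ i))"
      note parts = a_def b_def c_def k_def d_def term_Complex
      have n0: "nsq (\<lambda>x. v x - c) = bsq (\<lambda>x. Re (v x) - c1)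
          + bsq (\<lambda>x. Im (v x) - c2)"
        by (subst nsq_complex) (simp_all add: parts ebs re im)
      have n1: "nsq (\<lambda>x. v x - c - deg1_term a x)
          = bsq (\<lambda>x. Re (v x) - c1 - deg1_term a1 x)
          + bsq (\<lambda>x. Im (v x) - c2 - deg1_term a2 x)"
        by (subst nsq_complex) (simp_all add: parts ebs re im)
      have n2: "nsq (\<lambda>x. v x - c - deg1_term a x - deg2_term \<Phi> b x)
          = bsq (\<lambda>x. Re (v x) - c1 - deg1_term a1 x - deg2_term \<Phi> b1 x)
          + bsq (\<lambda>x. Im (v x) - c2 - deg1_term a2 x - deg2_term \<Phi> b2 x)"
        by (subst nsq_complex) (simp_all add: parts ebs re im)
      have n3: "nsq (\<lambda>x. v x - k - (norm x)\<^sup>2 *\<^sub>R d - deg1_term a x - deg2_term \<Phi> b x)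
          = bsq (\<lambda>x. Re (v x) - k1 - (norm x)\<^sup>2 *\<^sub>R d1 - deg1_term a1 x - deg2_term \<Phi> b1 x)
          + bsq (\<lambda>x. Im (v x) - k2 - (norm x)\<^sup>2 *\<^sub>R d2 - deg1_term a2 x - deg2_term \<Phi> b2 x)"
        by (subst nsq_complex) (simp_all add: parts ebs[unfolded real_scaleR_def] re im)
      show "\<exists>c a b c' d.
     Dk 1 (real CARD('n)) * nsq (\<lambda>x. v x - c)
     + (Dk 2 (real CARD('n)) - Dk 1 (real CARD('n))) * nsq (\<lambda>x. v x - c - deg1_term a x)
     + (4 - Dk 2 (real CARD('n))) * nsq (\<lambda>x. v x - c - deg1_term a x - deg2_term \<Phi> b x)
     + (Dk 3 (real CARD('n)) - 4) * nsq (\<lambda>x. v x - c' - (norm x)\<^sup>2 *\<^sub>R d - deg1_term a x - deg2_term \<Phi> b x)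
     \<le> nsq (grad v) + e"
        unfolding dirichlet_complex[OF v] D1'_def[symmetric] D2'_def[symmetric] D3'_def[symmetric]
      proof (intro exI)
        show "D1' * nsq (\<lambda>x. v x - c) + (D2' - D1') * nsq (\<lambda>x. v x - c - deg1_term a x)
     + (4 - D2') * nsq (\<lambda>x. v x - c - deg1_term a x - deg2_term \<Phi> b x)
     + (D3' - 4) * nsq (\<lambda>x. v x - k - (norm x)\<^sup>2 *\<^sub>R d - deg1_term a x - deg2_term \<Phi> b x)
     \<le> eform (\<lambda>x. Re (v x)) (\<lambda>x. Re (v x)) + eform (\<lambda>x. Im (v x)) (\<lambda>x. Im (v x)) + e"
          using r i unfolding n0 n1 n2 n3 distrib_left by linarith
      qed
    qed
  }
qed

end
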